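(* Let $(\gamma_2,\gamma,\gamma_1)$ be a trio of oriented simple closed geodesics on the modular torus $\mathfrak X$ that pairwise intersect once, such that either of the two complementary triangles of $\gamma_1\cup\gamma\cup\gamma_2$ sees the curves in the counterclockwise cyclic order $\gamma_2,\gamma,\gamma_1$ around its boundary, and suppose that the corresponding ordered Markov triple is $(n_1,n,n_2)$. Then $$\mathrm{tw}_{\mathfrak X}(\gamma)=2\cosh^{-1}\left(\frac{n_1}{2}\sqrt{9-\frac{4}{n^2}}\right).$$
   Context: Modular torus: $\mathfrak X=\mathbb{H}^2/\Gamma$, where $\Gamma$ is the commutator subgroup of $\mathrm{PSL}(2,\mathbb{Z})$; it is a complete finite-area hyperbolic once-punctured torus, and $\Gamma$ is free on $\alpha=\begin{pmatrix}2&1\\1&1\end{pmatrix}$ and $\beta=\begin{pmatrix}2&-1\\-1&1\end{pmatrix}$. Identify $H_1(\mathfrak X,\mathbb{Z})\cong\mathbb{Z}^2$ so that $[\alpha]=(1,-1)$ and $[\beta]=(0,1)$. For $\frac pq\in\mathbb{Q}$ in lowest terms with $q>0$, let $\gamma_{p/q}$ be the unique oriented simple closed geodesic on $\mathfrak X$ in the class $(q,p)$, with length $\ell_{\mathfrak X}(\gamma_{p/q})$. Markov labels: a Markov triple is a positive integer solution of $x^2+y^2+z^2=3xyz$. Fractions $\frac pq,\frac ab$ in $\mathbb{Q}\cup\{\frac10\}$ (lowest terms, nonnegative denominators) are Farey neighbors if $|pb-qa|=1$; a Farey triple with center $\frac pq$ is a triple $\frac ab<\frac pq<\frac cd$ of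 pairwise Farey neighbors with $a+c=p$, $b+d=q$ ($\frac10=\infty$ being larger than all rationals); $\frac ab,\frac cd$ are then the immediate precedents of $\frac pq$. The Markov label $m(p/q)$ is defined by $m(\frac{-1}{1})=m(\frac01)=m(\frac10)=1$ and, inductively for $\frac pq\in(0,1]$ with immediate precedents $r,s$, $m(\frac pq)=3\,m(r)\,m(s)-m(t)$, where $t$ is the unique common immediate precedent of $r$ and $s$, that is, the common Farey neighbor of $r$ and $s$ other than $\frac pq$ (for $\frac pq=\frac11$, $t=\frac{-1}1$). The trace of $\gamma_{p/q}$ is $3m(p/q)$, i.e. $2\cosh(\ell_{\mathfrak X}(\gamma_{p/q})/2)=3m(p/q)$. A Markov triple $(n_1,n,n_2)$ is called ordered if there is a Farey triple $\frac{p_1}{q_1}<\frac pq<\frac{p_2}{q_2}$ in $\mathbb{Q}\cap[0,1]$ with center $\frac pq$ whose Markov labels are $n_1,n,n_2$ respectively. It corresponds to the trio with $\gamma_1=\gamma_{p_1/q_1}$, $\gamma=\gamma_{p/q}$, $\gamma_2=\gamma_{p_2/q_2}$ (note the reversal: each complementary triangle on $\mathfrak X$ sees them in counterclockwise cyclic order $\gamma_2,\gamma,\gamma_1$). Absolute twist: the completion of $\mathfrak X\setminus\gamma$ is a pair of pants with two geodesic boundary components and one cusp. From each geodesic boundary component there is exactly one simple orthogeodesic to the cusp; let $A_l$ and $A_r$ be the feet on $\gamma$ of the orthogeodesics on the left and right sides of $\gamma$, respectively. Then $\mathrm{tw}_{\mathfrak X}(\gamma)\in[0,\ell_{\mathfrak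 X}(\gamma))$ is the distance travelled from $A_l$ to the first arrival at $A_r$ along $\gamma$ in its positive direction (and is $0$ if $A_l=A_r$). *)

theory Defs
  imports "HOL-Analysis.Analysis" "HOL-Algebra.Algebra"
begin

section \<open>The modular torus\<close>

definition SL2Z :: "(int^2^2) monoid" where
  "SL2Z = \<lparr>carrier = {A. det A = 1}, mult = (**), one = mat 1\<rparr>"

definition center_SL2Z :: "(int^2^2) set" where
  "center_SL2Z = {mat 1, - mat 1}"

definition PSL2Z :: "(int^2^2) set monoid" where
  "PSL2Z = SL2Z Mod center_SL2Z"

definition PSL_class :: "int^2^2 \<Rightarrow> (int^2^2) set" where
  "PSL_class A = center_SL2Z #>\<^bsub>SL2Z\<^esub> A"

definition torus_group :: "(int^2^2) set monoid" where
  "torus_group = PSL2Z\<lparr>carrier := derived PSL2Z (carrier PSL2Z)\<rparr>"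

definition gen_alpha :: "(int^2^2) set" where
  "gen_alpha = PSL_class (vector [vector [2, 1], vector [1, 1]])"

definition gen_beta :: "(int^2^2) set" where
  "gen_beta = PSL_class (vector [vector [2, -1], vector [-1, 1]])"

definition upper_half_plane :: "complex set" where
  "upper_half_plane = {z. 0 < Im z}"

definition hdist :: "complex \<Rightarrow> complex \<Rightarrow> real" where
  "hdist z w = arcosh (1 + (cmod (z - w))\<^sup>2 / (2 * Im z * Im w))"

definition mob :: "int^2^2 \<Rightarrow> complex \<Rightarrow> complex" where
  "mob A = moebius (of_int (A$1$1)) (of_int (A$1$2)) (of_int (A$2$1)) (of_int (A$2$2))"

text \<open>A point of the modular torus is an orbit of the group in the upper half-plane, and
  \<open>orb\<close> is the covering projection. The surface carries the orientation induced by the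
  standard orientation of the complex plane.\<close>

definition orb :: "complex \<Rightarrow> complex set" where
  "orb z = {mob A z | A g. g \<in> carrier torus_group \<and> A \<in> g}"


section \<open>First homology\<close>

text \<open>The deck group of the universal covering is \<open>torus_group\<close>, so the first integral
  homology of the torus is its abelianization.\<close>

definition H1 :: "(int^2^2) set set monoid" where
  "H1 = torus_group Mod derived torus_group (carrier torus_group)"

definition H1_class :: "(int^2^2) set \<Rightarrow> (int^2^2) set set" where
  "H1_class g = derived torus_group (carrier torus_group) #>\<^bsub>torus_group\<^esub> g"

definition H1_identification :: "((int^2^2) set set \<Rightarrow> int \<times> int) \<Rightarrow> bool" where
  "H1_identification \<phi> \<longleftrightarrow>
     \<phi> \<in> iso H1 (integer_group \<times>\<times> integer_group) \<and>
     \<phi> (H1_class gen_alpha) = (1, -1) \<and> \<phi> (H1_class gen_beta) = (0, 1)"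


section \<open>Oriented simple closed geodesics\<close>

definition unit_speed_geodesic :: "real set \<Rightarrow> (real \<Rightarrow> complex) \<Rightarrow> bool" where
  "unit_speed_geodesic I \<sigma> \<longleftrightarrow>
     (\<forall>t\<in>I. \<sigma> t \<in> upper_half_plane) \<and> (\<forall>s\<in>I. \<forall>t\<in>I. hdist (\<sigma> s) (\<sigma> t) = \<bar>s - t\<bar>)"

definition is_lift :: "(real \<Rightarrow> complex) \<Rightarrow> (real \<Rightarrow> complex set) \<Rightarrow> bool" where
  "is_lift \<sigma> c \<longleftrightarrow> unit_speed_geodesic UNIV \<sigma> \<and> c = orb \<circ> \<sigma>"

text \<open>Oriented closed geodesics are periodic unit speed curves \<open>c\<close> in the torus. Once around
  \<open>c\<close>, of length \<open>L\<close>, closes up by the deck transformation \<open>g\<close>; another lift replaces \<open>g\<close>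
  by a conjugate, so the homology class of \<open>g\<close> is the class of the curve.\<close>

definition closed_geodesic :: "(real \<Rightarrow> complex set) \<Rightarrow> real \<Rightarrow> (int^2^2) set \<Rightarrow> bool" where
  "closed_geodesic c L g \<longleftrightarrow> 0 < L \<and> g \<in> carrier torus_group \<and>
     (\<exists>\<sigma>. is_lift \<sigma> c \<and> (\<exists>A\<in>g. \<forall>t. \<sigma> (t + L) = mob A (\<sigma> t)))"

definition simple_closed_geodesic :: "(real \<Rightarrow> complex set) \<Rightarrow> real \<Rightarrow> (int^2^2) set \<Rightarrow> bool" where
  "simple_closed_geodesic c L g \<longleftrightarrow> closed_geodesic c L g \<and> inj_on c {0..<L}"

text \<open>The fraction $p/q$ is represented by the pair \<open>(p, q)\<close>, whereas its geodesic has homology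
  class \<open>(q, p)\<close>.\<close>

definition is_gamma ::
  "((int^2^2) set set \<Rightarrow> int \<times> int) \<Rightarrow> int \<times> int \<Rightarrow> (real \<Rightarrow> complex set) \<Rightarrow> bool" where
  "is_gamma \<phi> x c \<longleftrightarrow>
     (\<exists>L g. simple_closed_geodesic c L g \<and> \<phi> (H1_class g) = (snd x, fst x))"


section \<open>Trios\<close>

definition hsegment :: "complex \<Rightarrow> complex \<Rightarrow> complex set" where
  "hsegment P Q = {z \<in> upper_half_plane. hdist P z + hdist z Q = hdist P Q}"

definition open_hsegment :: "complex \<Rightarrow> complex \<Rightarrow> complex set" where
  "open_hsegment P Q = hsegment P Q - {P, Q}"

definition open_htriangle :: "complex \<Rightarrow> complex \<Rightarrow> complex \<Rightarrow> complex set" where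
  "open_htriangle P Q R = (\<Union>W\<in>open_hsegment Q R. open_hsegment P W)"

text \<open>The angle at \<open>P\<close> from the side \<open>PQ\<close> to the side \<open>PR\<close> lies strictly between $0$ and $\pi$.
  (The Euclidean orientation of the three vertices would be the wrong notion here, as geodesics
  are not straight.)\<close>

definition counterclockwise :: "complex \<Rightarrow> complex \<Rightarrow> complex \<Rightarrow> bool" where
  "counterclockwise P Q R \<longleftrightarrow>
     (\<exists>\<sigma> \<tau> a b u v. unit_speed_geodesic UNIV \<sigma> \<and> unit_speed_geodesic UNIV \<tau> \<and>
        0 < a \<and> 0 < b \<and> \<sigma> 0 = P \<and> \<sigma> a = Q \<and> \<tau> 0 = P \<and> \<tau> b = R \<and>
        (\<sigma> has_vector_derivative u) (at 0) \<and> (\<tau> has_vector_derivative v) (at 0) \<and>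
        0 < Im (v / u))"

text \<open>A lift \<open>PQR\<close> of a complementary triangle of the three curves, with the sides \<open>PQ\<close>, \<open>QR\<close>,
  \<open>RP\<close> on the first, second and third curve. Complementary triangles are simply connected,
  hence are the injective images of the triangular components of the preimage of the complement
  in the upper half-plane.\<close>

definition complementary_triangle ::
  "(real \<Rightarrow> complex set) \<Rightarrow> (real \<Rightarrow> complex set) \<Rightarrow> (real \<Rightarrow> complex set) \<Rightarrow>
   complex \<Rightarrow> complex \<Rightarrow> complex \<Rightarrow> bool" where
  "complementary_triangle c c' c'' P Q R \<longleftrightarrow>
     P \<in> upper_half_plane \<and> Q \<in> upper_half_plane \<and> R \<in> upper_half_plane \<and>
     open_htriangle P Q R \<in>
       components {z \<in> upper_half_plane. orb z \<notin> range c \<union> range c' \<union> range c''} \<and>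
     orb ` hsegment P Q \<subseteq> range c \<and> orb ` hsegment Q R \<subseteq> range c' \<and>
     orb ` hsegment R P \<subseteq> range c''"

definition trio ::
  "(real \<Rightarrow> complex set) \<Rightarrow> (real \<Rightarrow> complex set) \<Rightarrow> (real \<Rightarrow> complex set) \<Rightarrow> bool" where
  "trio c c' c'' \<longleftrightarrow>
     (\<forall>d\<in>{c, c', c''}. \<exists>L g. simple_closed_geodesic d L g) \<and>
     card (range c \<inter> range c') = 1 \<and> card (range c' \<inter> range c'') = 1 \<and>
     card (range c \<inter> range c'') = 1 \<and>
     (\<forall>P Q R. complementary_triangle c c' c'' P Q R \<longrightarrow> counterclockwise P Q R)"


section \<open>Ordered Markov triples\<close>

text \<open>Fractions in lowest terms, including $1/0$, as pairs (numerator, denominator).\<close>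

definition is_fraction :: "int \<times> int \<Rightarrow> bool" where
  "is_fraction x \<longleftrightarrow> coprime (fst x) (snd x) \<and> (0 < snd x \<or> x = (1, 0))"

definition fraction_less :: "int \<times> int \<Rightarrow> int \<times> int \<Rightarrow> bool" where
  "fraction_less x y \<longleftrightarrow> fst x * snd y < fst y * snd x"

definition farey_neighbors :: "int \<times> int \<Rightarrow> int \<times> int \<Rightarrow> bool" where
  "farey_neighbors x y \<longleftrightarrow> \<bar>fst x * snd y - snd x * fst y\<bar> = 1"

definition farey_triple :: "int \<times> int \<Rightarrow> int \<times> int \<Rightarrow> int \<times> int \<Rightarrow> bool" where
  "farey_triple r x s \<longleftrightarrow>
     is_fraction r \<and> is_fraction x \<and> is_fraction s \<and>
     fraction_less r x \<and> fraction_less x s \<and>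
     farey_neighbors r x \<and> farey_neighbors x s \<and> farey_neighbors r s \<and>
     fst r + fst s = fst x \<and> snd r + snd s = snd x"

inductive markov_label :: "int \<times> int \<Rightarrow> int \<Rightarrow> bool" where
  minus_one: "markov_label (-1, 1) 1"
| zero: "markov_label (0, 1) 1"
| infinity: "markov_label (1, 0) 1"
| step: "\<lbrakk>0 < fst x; fst x \<le> snd x; farey_triple r x s;
     is_fraction t; farey_neighbors t r; farey_neighbors t s; t \<noteq> x;
     markov_label r k; markov_label s l; markov_label t m\<rbrakk>
    \<Longrightarrow> markov_label x (3 * k * l - m)"

definition markov_triple :: "int \<Rightarrow> int \<Rightarrow> int \<Rightarrow> bool" where
  "markov_triple x y z \<longleftrightarrow> 0 < x \<and> 0 < y \<and> 0 < z \<and> x\<^sup>2 + y\<^sup>2 + z\<^sup>2 = 3 * x * y * z"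

definition unit_interval_fraction :: "int \<times> int \<Rightarrow> bool" where
  "unit_interval_fraction x \<longleftrightarrow> is_fraction x \<and> 0 \<le> fst x \<and> fst x \<le> snd x"

definition ordered_markov_triple_at ::
  "int \<times> int \<Rightarrow> int \<times> int \<Rightarrow> int \<times> int \<Rightarrow> int \<Rightarrow> int \<Rightarrow> int \<Rightarrow> bool" where
  "ordered_markov_triple_at x1 x x2 n1 n n2 \<longleftrightarrow>
     markov_triple n1 n n2 \<and> farey_triple x1 x x2 \<and>
     unit_interval_fraction x1 \<and> unit_interval_fraction x \<and> unit_interval_fraction x2 \<and>
     markov_label x1 n1 \<and> markov_label x n \<and> markov_label x2 n2"

text \<open>The trio is listed in the order opposite to the triple.\<close>

definition corresponding_ordered_markov_triple ::
  "((int^2^2) set set \<Rightarrow> int \<times> int) \<Rightarrow>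
   (real \<Rightarrow> complex set) \<Rightarrow> (real \<Rightarrow> complex set) \<Rightarrow> (real \<Rightarrow> complex set) \<Rightarrow>
   int \<Rightarrow> int \<Rightarrow> int \<Rightarrow> bool" where
  "corresponding_ordered_markov_triple \<phi> c2 c c1 n1 n n2 \<longleftrightarrow>
     (\<exists>x1 x x2. ordered_markov_triple_at x1 x x2 n1 n n2 \<and>
        is_gamma \<phi> x1 c1 \<and> is_gamma \<phi> x c \<and> is_gamma \<phi> x2 c2)"


section \<open>Absolute twist\<close>

text \<open>Being a geodesic ray to the cusp means leaving every compact subset of the torus, since the
  cusp is its only end.\<close>

definition tends_to_cusp :: "(real \<Rightarrow> complex) \<Rightarrow> bool" where
  "tends_to_cusp \<rho> \<longleftrightarrow>
     (\<forall>K. compact K \<and> K \<subseteq> upper_half_plane \<longrightarrow> (\<forall>\<^sub>F t in at_top. orb (\<rho> t) \<notin> orb ` K))"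

text \<open>\<open>P\<close> is the foot on \<open>c\<close> of a simple orthogeodesic to the cusp in the completion of the
  complement of \<open>c\<close>. It starts in the direction \<open>\<i>\<close> (left side) or \<open>- \<i>\<close> (right side) relative
  to the velocity of \<open>c\<close>, and never meets \<open>c\<close> again.\<close>

definition cusp_orthogeodesic_foot ::
  "complex \<Rightarrow> (real \<Rightarrow> complex set) \<Rightarrow> complex set \<Rightarrow> bool" where
  "cusp_orthogeodesic_foot d c P \<longleftrightarrow>
     (\<exists>\<sigma> s v \<rho>. is_lift \<sigma> c \<and> c s = P \<and> (\<sigma> has_vector_derivative v) (at s) \<and>
        unit_speed_geodesic {0..} \<rho> \<and> \<rho> 0 = \<sigma> s \<and>
        (\<rho> has_vector_derivative d * v) (at 0 within {0..}) \<and>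
        inj_on (orb \<circ> \<rho>) {0..} \<and> (\<forall>t>0. orb (\<rho> t) \<notin> range c) \<and> tends_to_cusp \<rho>)"

definition left_foot :: "(real \<Rightarrow> complex set) \<Rightarrow> complex set" where
  "left_foot c = (THE P. cusp_orthogeodesic_foot \<i> c P)"

definition right_foot :: "(real \<Rightarrow> complex set) \<Rightarrow> complex set" where
  "right_foot c = (THE P. cusp_orthogeodesic_foot (- \<i>) c P)"

definition twist :: "(real \<Rightarrow> complex set) \<Rightarrow> real" where
  "twist c = (LEAST t. 0 \<le> t \<and> (\<exists>s. c s = left_foot c \<and> c (s + t) = right_foot c))"

end

theory Submission
  imports Defs
begin

text \<open>The torus has an orientation preserving involution, and its quotient is an orbifold whose group is
  generated by three half-turns \<open>A\<close>, \<open>B\<close>, \<open>C\<close> with \<open>C ** B ** A = shift 3\<close>. Such a triple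
  (\<open>markov_basis\<close>) belongs to every Farey triple: the lower left entries of the three matrices are the
  Markov labels, since they satisfy Markov's equation and since passing to a child in the Farey tree
  replaces one half-turn by a conjugate (\<open>labelled_basis_exists\<close>). The geodesic at the centre of the
  Farey triple is represented by the axis of \<open>shift 3 ** B\<close>, a half-circle of radius
  \<open>r = sqrt (9 - 4 / n\<^sup>2) / 2\<close>.

  That the axis represents this geodesic is the uniqueness of simple geodesics in their homology class
  (\<open>simple_geodesic_in_class\<close>). The holonomy of a simple closed geodesic is, up to conjugation, a
  cyclically reduced word of even length in the half-turns, and by ping-pong consecutive letters of the
  word are the sides of ideal triangles that a lift crosses; the lift cuts off the corner between
  them. Three kinds of corners and two parities of positions make six corners, and these are the six
  corners around the cusp. Lifts do not cross each other, so they cannot cut off all of these: the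
  outermost lifts would close up to a curve around the cusp (\<open>no_arcs_around_cusp\<close>). A missing corner
  makes the third letter occur at every other position (\<open>alternating_word\<close>), and then the homology
  class, which counts letters with alternating signs, determines the word.

  After moving the cusp to infinity, an orthogeodesic to the cusp is a vertical ray upwards from the
  top of a lift (\<open>foot_normal_form\<close>). The axis of \<open>shift 3 ** B\<close> is a widest lift
  (\<open>arc2_length\<close>), so the rays above it and its translates by multiples of 3 qualify. Conversely the
  top of any other lift that is not below one of these is close to a vertical line
  through \<open>line B\<close> or a translate of it, and the vertical ray from there meets its own image
  (\<open>ray_near_line\<close>). The translates by odd multiples of 3 are not in the group of the torus, but
  they are after composition with a half-turn \<open>R\<close> that reverses the axis. So the top of the axis
  is the left foot, and its image under \<open>R\<close> is the right foot. The fixed point of \<open>R\<close> is a point of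
  height \<open>1 / n1\<close> on a half-circle of radius \<open>r\<close>, at distance \<open>arcosh (n1 * r)\<close> from the top,
  and the right foot lies twice as far (\<open>twist_value\<close>). Since \<open>n1 < n\<close>, this is less
  than the length of the geodesic.\<close>

section \<open>Integral two-by-two matrices\<close>

definition mk :: "int \<Rightarrow> int \<Rightarrow> int \<Rightarrow> int \<Rightarrow> int^2^2" where
  "mk a b c d = vector [vector [a, b], vector [c, d]]"

definition adj :: "int^2^2 \<Rightarrow> int^2^2" where
  "adj A = mk (A$2$2) (- A$1$2) (- A$2$1) (A$1$1)"

lemma mk_entries [simp]:
  "mk a b c d $ 1 $ 1 = a" "mk a b c d $ 1 $ 2 = b" "mk a b c d $ 2 $ 1 = c" "mk a b c d $ 2 $ 2 = d"
  by (simp_all add: mk_def)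

lemma mult_entries [simp]:
  fixes A B :: "int^2^2"
  shows "(A ** B)$1$1 = A$1$1 * B$1$1 + A$1$2 * B$2$1" "(A ** B)$1$2 = A$1$1 * B$1$2 + A$1$2 * B$2$2"
    "(A ** B)$2$1 = A$2$1 * B$1$1 + A$2$2 * B$2$1" "(A ** B)$2$2 = A$2$1 * B$1$2 + A$2$2 * B$2$2"
  by (simp_all add: matrix_matrix_mult_def sum_2)

lemma one_entries [simp]:
  "(mat 1 :: int^2^2)$1$1 = 1" "(mat 1 :: int^2^2)$1$2 = 0"
  "(mat 1 :: int^2^2)$2$1 = 0" "(mat 1 :: int^2^2)$2$2 = 1"
  by (simp_all add: mat_def)

lemma mat2_eq_iff:
  "(A :: int^2^2) = B \<longleftrightarrow> A$1$1 = B$1$1 \<and> A$1$2 = B$1$2 \<and> A$2$1 = B$2$1 \<and> A$2$2 = B$2$2"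
  by (simp add: vec_eq_iff forall_2)

lemma adj_entries [simp]:
  "adj A $ 1 $ 1 = A$2$2" "adj A $ 1 $ 2 = - A$1$2" "adj A $ 2 $ 1 = - A$2$1" "adj A $ 2 $ 2 = A$1$1"
  by (simp_all add: adj_def)

lemma det_adj [simp]: "det (adj A) = det A"
  by (simp add: det_2 algebra_simps)

lemma det_uminus [simp]: "det (- A :: int^2^2) = det A"
  by (simp add: det_2)

lemma mult_adj: "det A = 1 \<Longrightarrow> A ** adj A = mat 1" "det A = 1 \<Longrightarrow> adj A ** A = mat 1"
  by (auto simp: mat2_eq_iff det_2 algebra_simps)

lemma adj_mult: "adj (A ** B) = adj B ** adj A"
  by (auto simp: mat2_eq_iff algebra_simps)

lemma adj_adj [simp]: "adj (adj A) = A"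
  by (auto simp: mat2_eq_iff)

lemma adj_uminus [simp]: "adj (- A) = - adj A"
  by (auto simp: mat2_eq_iff)

lemma mult_uminus [simp]: "(- A) ** B = - (A ** B)" "A ** (- B) = - (A ** B)"
  for A B :: "int^2^2"
  by (auto simp: mat2_eq_iff)

lemma adj_one [simp]: "adj (mat 1) = mat 1"
  by (auto simp: mat2_eq_iff)

lemma mult_assoc_adj:
  assumes "det A = 1"
  shows "A ** (adj A ** B) = B" "adj A ** (A ** B) = B"
  using assms by (simp_all add: matrix_mul_assoc mult_adj)

abbreviation trace2 :: "int^2^2 \<Rightarrow> int" where
  "trace2 A \<equiv> A$1$1 + A$2$2"

definition shift :: "int \<Rightarrow> int^2^2" where
  "shift k = mk 1 k 0 1"

lemma shift_entries [simp]:
  "shift k $ 1 $ 1 = 1" "shift k $ 1 $ 2 = k" "shift k $ 2 $ 1 = 0" "shift k $ 2 $ 2 = 1"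
  by (simp_all add: shift_def)

lemma det_shift [simp]: "det (shift k) = 1"
  by (simp add: det_2)

lemma shift_mult: "shift j ** shift k = shift (j + k)"
  by (simp add: mat2_eq_iff)

lemma shift_assoc: "shift j ** (shift k ** A) = shift (j + k) ** A"
  by (simp add: matrix_mul_assoc shift_mult)

lemma adj_shift [simp]: "adj (shift k) = shift (- k)"
  by (simp add: mat2_eq_iff)

lemma shift_0 [simp]: "shift 0 = mat 1"
  by (simp add: mat2_eq_iff)


section \<open>The modular group and the group of the torus\<close>

lemma SL2Z_simps:
  "carrier SL2Z = {A. det A = 1}" "\<one>\<^bsub>SL2Z\<^esub> = mat 1" "A \<otimes>\<^bsub>SL2Z\<^esub> B = A ** B"
  by (simp_all add: SL2Z_def)

lemma group_SL2Z: "group SL2Z"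
proof (rule groupI)
  fix A assume "A \<in> carrier SL2Z"
  then show "\<exists>B\<in>carrier SL2Z. B \<otimes>\<^bsub>SL2Z\<^esub> A = \<one>\<^bsub>SL2Z\<^esub>"
    by (intro bexI[of _ "adj A"]) (auto simp: SL2Z_simps mult_adj)
qed (auto simp: SL2Z_simps det_mul matrix_mul_assoc)

lemma inv_SL2Z: "det A = 1 \<Longrightarrow> inv\<^bsub>SL2Z\<^esub> A = adj A"
  using group.inv_equality[OF group_SL2Z, of "adj A" A] by (auto simp: SL2Z_simps mult_adj)

lemma normal_center: "center_SL2Z \<lhd> SL2Z"
proof (rule group.normal_invI[OF group_SL2Z])
  show "subgroup center_SL2Z SL2Z"
    by (rule group.subgroupI[OF group_SL2Z])
       (auto simp: center_SL2Z_def SL2Z_simps inv_SL2Z)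
next
  fix x h assume "x \<in> carrier SL2Z" "h \<in> center_SL2Z"
  then show "x \<otimes>\<^bsub>SL2Z\<^esub> h \<otimes>\<^bsub>SL2Z\<^esub> inv\<^bsub>SL2Z\<^esub> x \<in> center_SL2Z"
    by (auto simp: SL2Z_simps center_SL2Z_def inv_SL2Z mult_adj)
qed

lemma PSL_class_eq: "PSL_class A = {A, - A}"
  by (auto simp: PSL_class_def r_coset_def center_SL2Z_def SL2Z_simps)

lemma PSL_class_uminus [simp]: "PSL_class (- A) = PSL_class A"
  by (auto simp: PSL_class_eq)

lemma group_PSL2Z: "group PSL2Z"
  unfolding PSL2Z_def by (rule normal.factorgroup_is_group[OF normal_center])

lemma carrier_PSL2Z: "carrier PSL2Z = PSL_class ` {A. det A = 1}"
  by (auto simp: PSL2Z_def FactGroup_def RCOSETS_def PSL_class_def SL2Z_simps)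

lemma PSL_class_mult:
  assumes "det A = 1" "det B = 1"
  shows "PSL_class A \<otimes>\<^bsub>PSL2Z\<^esub> PSL_class B = PSL_class (A ** B)"
  using normal.rcos_sum[OF normal_center, of A B] assms
  by (simp add: PSL2Z_def FactGroup_def PSL_class_def SL2Z_simps)

lemma PSL_class_one: "PSL_class (mat 1) = \<one>\<^bsub>PSL2Z\<^esub>"
  by (auto simp: PSL2Z_def FactGroup_def PSL_class_eq center_SL2Z_def)

lemma PSL_class_inv:
  assumes "det A = 1"
  shows "inv\<^bsub>PSL2Z\<^esub> (PSL_class A) = PSL_class (adj A)"
  by (rule group.inv_equality[OF group_PSL2Z])
     (use assms in \<open>auto simp: PSL_class_mult mult_adj PSL_class_one carrier_PSL2Z\<close>)

definition torus_matrices :: "(int^2^2) set" where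
  "torus_matrices = {A. det A = 1 \<and> PSL_class A \<in> carrier torus_group}"

lemma torus_group_simps:
  "mult torus_group = mult PSL2Z" "one torus_group = one PSL2Z"
  "carrier torus_group = derived PSL2Z (carrier PSL2Z)"
  by (simp_all add: torus_group_def)

lemma subgroup_torus: "subgroup (carrier torus_group) PSL2Z"
  unfolding torus_group_simps by (rule group.derived_is_subgroup[OF group_PSL2Z]) simp

lemma group_torus: "group torus_group"
  using subgroup.subgroup_is_group[OF subgroup_torus group_PSL2Z]
  by (simp add: torus_group_def)

lemma torus_matrices_det: "A \<in> torus_matrices \<Longrightarrow> det A = 1"
  by (simp add: torus_matrices_def)

lemma torus_matrices_one: "mat 1 \<in> torus_matrices"
  using subgroup.one_closed[OF subgroup_torus] by (simp add: torus_matrices_def PSL_class_one)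

lemma torus_matrices_mult:
  "A \<in> torus_matrices \<Longrightarrow> B \<in> torus_matrices \<Longrightarrow> A ** B \<in> torus_matrices"
  using subgroup.m_closed[OF subgroup_torus, of "PSL_class A" "PSL_class B"]
  by (auto simp: torus_matrices_def det_mul PSL_class_mult)

lemma torus_matrices_adj: "A \<in> torus_matrices \<Longrightarrow> adj A \<in> torus_matrices"
  using subgroup.m_inv_closed[OF subgroup_torus, of "PSL_class A"]
  by (auto simp: torus_matrices_def PSL_class_inv)

lemma torus_matrices_uminus [simp]: "- A \<in> torus_matrices \<longleftrightarrow> A \<in> torus_matrices"
  by (auto simp: torus_matrices_def)

lemma torus_class_cases:
  assumes "g \<in> carrier torus_group" "A \<in> g"
  shows "A \<in> torus_matrices" "g = PSL_class A"
proof -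
  from assms(1) subgroup.subset[OF subgroup_torus] have "g \<in> PSL_class ` {A. det A = 1}"
    by (auto simp: carrier_PSL2Z)
  then obtain B where "det B = 1" "g = PSL_class B" by auto
  with assms show "A \<in> torus_matrices" "g = PSL_class A"
    by (auto simp: PSL_class_eq torus_matrices_def insert_commute)
qed

lemma orb_eq: "orb z = {mob A z | A. A \<in> torus_matrices}"
proof -
  have "A \<in> torus_matrices \<longleftrightarrow> (\<exists>g. g \<in> carrier torus_group \<and> A \<in> g)" for A
  proof
    assume "A \<in> torus_matrices"
    then show "\<exists>g. g \<in> carrier torus_group \<and> A \<in> g"
      by (intro exI[of _ "PSL_class A"]) (simp add: torus_matrices_def PSL_class_eq)
  qed (blast dest: torus_class_cases(1))
  then show ?thesis
    unfolding orb_def by blast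
qed

lemma torus_commutator:
  assumes "det A = 1" "det B = 1"
  shows "A ** B ** adj A ** adj B \<in> torus_matrices"
proof -
  have "PSL_class A \<otimes>\<^bsub>PSL2Z\<^esub> PSL_class B \<otimes>\<^bsub>PSL2Z\<^esub> inv\<^bsub>PSL2Z\<^esub> (PSL_class A)
        \<otimes>\<^bsub>PSL2Z\<^esub> inv\<^bsub>PSL2Z\<^esub> (PSL_class B) \<in> derived_set PSL2Z (carrier PSL2Z)"
    using assms by (auto simp: carrier_PSL2Z)
  then have "PSL_class (A ** B ** adj A ** adj B) \<in> carrier torus_group"
    using assms by (auto simp: torus_group_simps derived_def PSL_class_inv PSL_class_mult det_mul
        intro: generate.incl)
  then show ?thesis
    using assms by (simp add: torus_matrices_def det_mul)
qed

lemma torus_conj: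
  assumes "A \<in> torus_matrices" "det M = 1"
  shows "M ** A ** adj M \<in> torus_matrices"
proof -
  have "M ** A ** adj M ** adj A ** A = M ** A ** adj M"
    using mult_adj(2)[of A] assms by (simp flip: matrix_mul_assoc add: torus_matrices_det)
  then show ?thesis
    using torus_matrices_mult[OF torus_commutator[of M A] assms(1)] assms
    by (simp add: torus_matrices_det)
qed

abbreviation "alpha_mat \<equiv> mk 2 1 1 1"
abbreviation "beta_mat \<equiv> mk 2 (-1) (-1) 1"

text \<open>The sign is included because \<open>torus_matrices\<close> is closed under it; the factors are on the left
  for the sake of the induction rule.\<close>

inductive_set ab_words :: "(int^2^2) set" where
  one: "mat 1 \<in> ab_words"
| alpha: "A \<in> ab_words \<Longrightarrow> alpha_mat ** A \<in> ab_words"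
| alpha': "A \<in> ab_words \<Longrightarrow> adj alpha_mat ** A \<in> ab_words"
| beta: "A \<in> ab_words \<Longrightarrow> beta_mat ** A \<in> ab_words"
| beta': "A \<in> ab_words \<Longrightarrow> adj beta_mat ** A \<in> ab_words"
| minus: "A \<in> ab_words \<Longrightarrow> - A \<in> ab_words"

lemma det_alpha [simp]: "det alpha_mat = 1" and det_beta [simp]: "det beta_mat = 1"
  by (simp_all add: det_2)

lemma ab_words_det: "A \<in> ab_words \<Longrightarrow> det A = 1"
  by (induction rule: ab_words.induct) (simp_all add: det_mul)

lemma ab_words_mult: "A \<in> ab_words \<Longrightarrow> B \<in> ab_words \<Longrightarrow> A ** B \<in> ab_words"
proof (induction rule: ab_words.induct)
qed (auto intro: ab_words.intros simp flip: matrix_mul_assoc)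

lemma ab_words_gens:
  "alpha_mat \<in> ab_words" "adj alpha_mat \<in> ab_words" "beta_mat \<in> ab_words" "adj beta_mat \<in> ab_words"
  using ab_words.intros(2-5)[OF ab_words.one] by simp_all

lemma ab_words_adj: "A \<in> ab_words \<Longrightarrow> adj A \<in> ab_words"
  by (induction rule: ab_words.induct)
     (auto simp: adj_mult intro: ab_words.one ab_words.minus ab_words_mult ab_words_gens)

lemma ab_words_conj:
  assumes M: "det M = 1"
    and gens: "\<And>A. A \<in> {alpha_mat, adj alpha_mat, beta_mat, adj beta_mat} \<Longrightarrow> M ** A ** adj M \<in> ab_words"
    and A: "A \<in> ab_words"
  shows "M ** A ** adj M \<in> ab_words"
  using A
proof (induction rule: ab_words.induct)
  case one
  then show ?case using M by (simp add: mult_adj ab_words.one)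
next
  case (minus A)
  then show ?case by (simp add: ab_words.minus)
next
  have *: "M ** (B ** A) ** adj M = (M ** B ** adj M) ** (M ** A ** adj M)" for A B
    using M by (simp add: mult_assoc_adj flip: matrix_mul_assoc)
  {
    case (alpha A) then show ?case unfolding * by (metis ab_words_mult gens insertCI)
  next
    case (alpha' A) then show ?case unfolding * by (metis ab_words_mult gens insertCI)
  next
    case (beta A) then show ?case unfolding * by (metis ab_words_mult gens insertCI)
  next
    case (beta' A) then show ?case unfolding * by (metis ab_words_mult gens insertCI)
  }
qed

text \<open>Translations normalize the group generated by the two matrices. With Euclid's algorithm this makes it
  a normal subgroup with cyclic quotient, hence it contains all commutators.\<close>

lemma ab_words_shift_conj:
  assumes "A \<in> ab_words"
  shows "shift 1 ** A ** shift (- 1) \<in> ab_words" "shift (- 1) ** A ** shift 1 \<in> ab_words"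
proof -
  have 1: "shift 1 ** alpha_mat ** shift (- 1) = alpha_mat ** beta_mat"
    "shift 1 ** adj alpha_mat ** shift (- 1) = adj beta_mat ** adj alpha_mat"
    "shift 1 ** beta_mat ** shift (- 1) = adj alpha_mat"
    "shift 1 ** adj beta_mat ** shift (- 1) = alpha_mat"
    "shift (- 1) ** alpha_mat ** shift 1 = adj beta_mat"
    "shift (- 1) ** adj alpha_mat ** shift 1 = beta_mat"
    "shift (- 1) ** beta_mat ** shift 1 = beta_mat ** alpha_mat"
    "shift (- 1) ** adj beta_mat ** shift 1 = adj alpha_mat ** adj beta_mat"
    by (simp_all add: mat2_eq_iff)
  show "shift 1 ** A ** shift (- 1) \<in> ab_words" "shift (- 1) ** A ** shift 1 \<in> ab_words"
    using ab_words_conj[OF _ _ assms, of "shift 1"] ab_words_conj[OF _ _ assms, of "shift (-1)"]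
    by (force simp: 1 ab_words_gens ab_words_mult)+
qed

lemma ab_words_shift_conj_int:
  assumes "A \<in> ab_words"
  shows "shift k ** A ** shift (- k) \<in> ab_words"
proof (induction k rule: int_induct[where k = 0])
  case base
  then show ?case using assms by simp
next
  case (step1 i)
  have "shift (i + 1) ** A ** shift (- (i + 1))
        = shift 1 ** (shift i ** A ** shift (- i)) ** shift (- 1)"
    by (auto simp: mat2_eq_iff algebra_simps)
  then show ?case using ab_words_shift_conj(1)[OF step1.IH] by simp
next
  case (step2 i)
  have "shift (i - 1) ** A ** shift (- (i - 1))
        = shift (- 1) ** (shift i ** A ** shift (- i)) ** shift 1"
    by (auto simp: mat2_eq_iff algebra_simps)
  then show ?case using ab_words_shift_conj(2)[OF step2.IH] by simp
qed

text \<open>Euclid's algorithm on the first column: left multiplication by a translation reduces the upper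
  left entry modulo the lower left one, and the inversion swaps the two rows.\<close>

lemma SL2Z_coset:
  assumes "det M = 1"
  shows "\<exists>i. \<exists>A\<in>ab_words. M = shift i ** A"
  using assms
proof (induction "nat \<bar>M$2$1\<bar>" arbitrary: M rule: less_induct)
  case less
  show ?case
  proof (cases "M$2$1 = 0")
    case True
    with less.prems have "M$1$1 * M$2$2 = 1" by (simp add: det_2)
    then consider "M$1$1 = 1" "M$2$2 = 1" | "M$1$1 = -1" "M$2$2 = -1"
      by (metis zmult_eq_1_iff)
    then have "M = shift (M$1$2) ** mat 1 \<or> M = shift (- M$1$2) ** - mat 1"
      by cases (simp_all add: mat2_eq_iff True)
    then show ?thesis using ab_words.one ab_words.minus by blast
  next
    case False
    define c where "c = M$2$1"
    define k where "k = M$1$1 div c"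
    define N where "N = mk (M$2$1) (M$2$2) (k * c - M$1$1) (k * M$2$2 - M$1$2)"
    have "det N = 1" using less.prems by (simp add: N_def c_def det_2 algebra_simps)
    moreover have "N$2$1 = - (M$1$1 mod c)"
      by (simp add: N_def k_def minus_mod_eq_div_mult [symmetric] algebra_simps)
    with False have "nat \<bar>N$2$1\<bar> < nat \<bar>M$2$1\<bar>"
      by (simp add: c_def abs_mod_less)
    ultimately obtain i A where A: "A \<in> ab_words" "N = shift i ** A"
      using less.hyps by blast
    \<comment> \<open>The factor in the middle is the inversion, with rows \<open>(0, - 1)\<close> and \<open>(1, 0)\<close>.\<close>
    have "M = shift k ** (shift (-3) ** alpha_mat ** beta_mat) ** N"
      by (simp add: N_def mat2_eq_iff c_def algebra_simps)
    also have "\<dots> = shift (k - 3 + i) ** ((shift (- i) ** (alpha_mat ** beta_mat) ** shift i) ** A)"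
      unfolding A(2) by (simp add: mat2_eq_iff algebra_simps)
    finally have "M = shift (k - 3 + i) ** ((shift (- i) ** (alpha_mat ** beta_mat) ** shift i) ** A)" .
    moreover have "(shift (- i) ** (alpha_mat ** beta_mat) ** shift i) ** A \<in> ab_words"
      using ab_words_shift_conj_int[OF ab_words_mult[OF ab_words_gens(1,3)], of "- i"] A(1)
      by (simp add: ab_words_mult)
    ultimately show ?thesis by blast
  qed
qed

text \<open>Modulo \<open>ab_words\<close> both matrices are translations, and these commute.\<close>

lemma ab_words_commutator:
  assumes "det M = 1" "det N = 1"
  shows "M ** N ** adj M ** adj N \<in> ab_words"
proof -
  obtain i A where A: "A \<in> ab_words" "M = shift i ** A" using SL2Z_coset assms by blast
  obtain j B where B: "B \<in> ab_words" "N = shift j ** B" using SL2Z_coset assms by blast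
  have [simp]: "det A = 1" "det B = 1" using A B by (auto simp: ab_words_det)
  have "M ** N ** adj M ** adj N = (shift i ** A ** shift (- i)) **
      (shift (i + j) ** (B ** adj A) ** shift (- (i + j))) ** (shift j ** adj B ** shift (- j))"
    by (simp add: A(2) B(2) adj_mult shift_assoc flip: matrix_mul_assoc)
  also have "\<dots> \<in> ab_words"
    by (intro ab_words_mult[OF ab_words_mult] ab_words_shift_conj_int)
       (use A(1) B(1) in \<open>auto intro: ab_words_mult ab_words_adj\<close>)
  finally show ?thesis .
qed

lemma torus_matrices_eq: "torus_matrices = ab_words"
proof
  have "alpha_mat = shift 1 ** mk 0 (-1) 1 0 ** adj (shift 1) ** adj (mk 0 (-1) 1 0)"
    "beta_mat = shift (-1) ** mk 0 (-1) 1 0 ** adj (shift (-1)) ** adj (mk 0 (-1) 1 0)"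
    by (simp_all add: mat2_eq_iff)
  then have gens: "alpha_mat \<in> torus_matrices" "beta_mat \<in> torus_matrices"
    using torus_commutator[of "shift 1" "mk 0 (-1) 1 0"] torus_commutator[of "shift (-1)" "mk 0 (-1) 1 0"]
    by (simp_all add: det_2)
  show "ab_words \<subseteq> torus_matrices"
  proof
    fix A assume "A \<in> ab_words"
    then show "A \<in> torus_matrices"
      by induction (simp_all add: torus_matrices_one torus_matrices_mult torus_matrices_adj gens)
  qed
  let ?H = "PSL_class ` ab_words"
  have "subgroup ?H PSL2Z"
  proof (rule group.subgroupI[OF group_PSL2Z])
    show "?H \<subseteq> carrier PSL2Z" by (auto simp: carrier_PSL2Z ab_words_det)
    show "?H \<noteq> {}" using ab_words.one by blast
  qed (auto simp: PSL_class_inv PSL_class_mult ab_words_det intro!: imageI ab_words_mult ab_words_adj)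
  moreover have "derived_set PSL2Z (carrier PSL2Z) \<subseteq> ?H"
    by (auto simp: carrier_PSL2Z PSL_class_inv PSL_class_mult det_mul intro!: imageI ab_words_commutator)
  ultimately have "carrier torus_group \<subseteq> ?H"
    unfolding torus_group_simps derived_def
    using group.generate_subgroup_incl[OF group_PSL2Z] by blast
  then show "torus_matrices \<subseteq> ab_words"
    by (auto simp: torus_matrices_def PSL_class_eq doubleton_eq_iff dest!: subsetD intro: ab_words.minus)
qed

lemma torus_coset:
  assumes "det M = 1"
  shows "\<exists>i. \<exists>A\<in>torus_matrices. M = shift i ** A"
  using SL2Z_coset[OF assms] by (simp add: torus_matrices_eq)


section \<open>Torsion-freeness\<close>

text \<open>Modulo 2 and modulo 3 the elements of the group lie in the alternating subgroup of the
  symmetric group of degree three and in the quaternion group. This excludes the traces of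
  elliptic elements: traces prime to 3 belong to matrices that are \<open>\<plusminus>1\<close> modulo 3, for which
  trace \<open>\<plusminus>1\<close> is impossible modulo 9, and even traces to matrices that are 1 modulo 2, for which
  trace 0 is impossible modulo 4.\<close>

lemma torus_matrices_mod2:
  assumes "A \<in> torus_matrices"
  shows "even (A$2$1 - A$1$2)" "even (A$2$2 - A$1$1 - A$1$2)"
proof -
  have "A \<in> ab_words" using assms by (simp add: torus_matrices_eq)
  then have "even (A$2$1 - A$1$2) \<and> even (A$2$2 - A$1$1 - A$1$2)"
    by (induction rule: ab_words.induct) auto
  then show "even (A$2$1 - A$1$2)" "even (A$2$2 - A$1$1 - A$1$2)" by auto
qed

lemma torus_matrices_mod3:
  assumes "A \<in> torus_matrices"
  shows "(A$1$1 mod 3, A$1$2 mod 3, A$2$1 mod 3, A$2$2 mod 3) \<in>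
    {(1,0,0,1), (2,0,0,2), (0,2,1,0), (0,1,2,0), (1,1,1,2), (2,2,2,1), (1,2,2,2), (2,1,1,1)}"
    (is "_ \<in> ?Q")
proof -
  have red: "(2 * a + c) mod 3 = (2 * (a mod 3) + c mod 3) mod 3"
    "(a + c) mod 3 = (a mod 3 + c mod 3) mod 3"
    "(a + 2 * c) mod 3 = (a mod 3 + 2 * (c mod 3)) mod 3"
    "(a - c) mod 3 = (a mod 3 - c mod 3) mod 3"
    "(2 * a - c) mod 3 = (2 * (a mod 3) - c mod 3) mod 3"
    for a c :: int
    by (rule mod_add_cong mod_diff_cong; simp add: mod_mult_right_eq)+
  have red_minus: "(- a) mod 3 = (- (a mod 3)) mod 3" for a :: int
    by (simp add: mod_minus_eq)
  have a_step: "((2 * a + c) mod 3, (2 * b + d) mod 3, (a + c) mod 3, (b + d) mod 3) \<in> ?Q"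
    and a'_step: "((a - c) mod 3, (b - d) mod 3, (2 * c - a) mod 3, (2 * d - b) mod 3) \<in> ?Q"
    and b_step: "((2 * a - c) mod 3, (2 * b - d) mod 3, (c - a) mod 3, (d - b) mod 3) \<in> ?Q"
    and b'_step: "((a + c) mod 3, (b + d) mod 3, (a + 2 * c) mod 3, (b + 2 * d) mod 3) \<in> ?Q"
    and minus_step: "((- a) mod 3, (- b) mod 3, (- c) mod 3, (- d) mod 3) \<in> ?Q"
    if "(a mod 3, b mod 3, c mod 3, d mod 3) \<in> ?Q" for a b c d :: int
    using that
    unfolding red[of a c] red[of b d] red[of c a] red[of d b] red_minus[of a] red_minus[of b] red_minus[of c] red_minus[of d]
    by (simp_all only: insert_iff empty_iff prod.inject simp_thms) (elim disjE conjE; simp)+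
  have "A \<in> ab_words" using assms by (simp add: torus_matrices_eq)
  then show ?thesis
  proof (induction rule: ab_words.induct)
    case one
    then show ?case by simp
  next
    case (alpha A)
    from a_step[OF alpha.IH] show ?case by (simp del: insert_iff)
  next
    case (alpha' A)
    from a'_step[OF alpha'.IH] show ?case by (simp del: insert_iff add: algebra_simps)
  next
    case (beta A)
    from b_step[OF beta.IH] show ?case by (simp del: insert_iff)
  next
    case (beta' A)
    from b'_step[OF beta'.IH] show ?case by (simp del: insert_iff)
  next
    case (minus A)
    from minus_step[OF minus.IH] show ?case by (simp del: insert_iff)
  qed
qed

lemma torus_matrices_trace:
  assumes A: "A \<in> torus_matrices"
  shows "\<bar>trace2 A\<bar> \<ge> 2"
proof (rule ccontr)
  assume "\<not> \<bar>trace2 A\<bar> \<ge> 2"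
  then consider "trace2 A = 0" | "trace2 A = 1" | "trace2 A = -1" by linarith
  then show False
  proof cases
    case 1
    then have d: "A$2$2 = - A$1$1" by simp
    with torus_matrices_mod2[OF A] have "even (A$1$2)" "even (A$2$1)" by auto
    then obtain x y where xy: "A$1$2 = 2 * x" "A$2$1 = 2 * y" by (auto elim!: evenE)
    have "- (A$1$1)\<^sup>2 - 4 * (x * y) = 1"
      using torus_matrices_det[OF A] by (simp add: det_2 d xy power2_eq_square)
    then have "(A$1$1)\<^sup>2 mod 4 = 3" by presburger
    moreover have "(A$1$1)\<^sup>2 mod 4 = (A$1$1 mod 4)\<^sup>2 mod 4" by (simp add: power_mod)
    moreover have "A$1$1 mod 4 \<in> {0, 1, 2, 3}" by auto
    ultimately show False by auto
  next
    case 2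
    then have d: "A$2$2 = 1 - A$1$1" by simp
    have "A$2$2 mod 3 = (1 - A$1$1 mod 3) mod 3"
      by (simp add: d mod_simps)
    with torus_matrices_mod3[OF A] have *: "A$1$2 mod 3 = 0" "A$2$1 mod 3 = 0" "A$1$1 mod 3 = 2"
      by auto
    obtain x y z where xyz: "A$1$2 = 3 * x" "A$2$1 = 3 * y" "A$1$1 = 3 * z + 2"
      using mult_div_mod_eq[of 3 "A$1$2"] mult_div_mod_eq[of 3 "A$2$1"] mult_div_mod_eq[of 3 "A$1$1"]
      unfolding * by (metis add.right_neutral)
    have "(3 * z + 2) * (- 3 * z - 1) - 9 * (x * y) = 1"
      using torus_matrices_det[OF A] by (simp add: det_2 d xyz algebra_simps)
    then have "9 * (z\<^sup>2 + z + x * y) = - 3" by (simp add: algebra_simps power2_eq_square)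
    then show False by presburger
  next
    case 3
    then have d: "A$2$2 = - 1 - A$1$1" by simp
    have "A$2$2 mod 3 = (- 1 - A$1$1 mod 3) mod 3"
      by (simp add: d mod_simps)
    with torus_matrices_mod3[OF A] have *: "A$1$2 mod 3 = 0" "A$2$1 mod 3 = 0" "A$1$1 mod 3 = 1"
      by auto
    obtain x y z where xyz: "A$1$2 = 3 * x" "A$2$1 = 3 * y" "A$1$1 = 3 * z + 1"
      using mult_div_mod_eq[of 3 "A$1$2"] mult_div_mod_eq[of 3 "A$2$1"] mult_div_mod_eq[of 3 "A$1$1"]
      unfolding * by (metis add.right_neutral)
    have "(3 * z + 1) * (- 3 * z - 2) - 9 * (x * y) = 1"
      using torus_matrices_det[OF A] by (simp add: det_2 d xyz algebra_simps)
    then have "9 * (z\<^sup>2 + z + x * y) = - 3" by (simp add: algebra_simps power2_eq_square)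
    then show False by presburger
  qed
qed


section \<open>Homology classes of matrices\<close>

definition hclass :: "((int^2^2) set set \<Rightarrow> int \<times> int) \<Rightarrow> int^2^2 \<Rightarrow> int \<times> int" where
  "hclass \<phi> A = \<phi> (H1_class (PSL_class A))"

lemma normal_derived_torus: "derived torus_group (carrier torus_group) \<lhd> torus_group"
  by (rule group.derived_self_is_normal[OF group_torus])

lemma hclass_uminus [simp]: "hclass \<phi> (- A) = hclass \<phi> A"
  by (simp add: hclass_def)

lemma hclass_mult:
  assumes \<phi>: "H1_identification \<phi>" and A: "A \<in> torus_matrices" and B: "B \<in> torus_matrices"
  shows "hclass \<phi> (A ** B) = hclass \<phi> A + hclass \<phi> B"
proof -
  have hom: "\<phi> \<in> hom H1 (integer_group \<times>\<times> integer_group)"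
    using \<phi> by (auto simp: H1_identification_def iso_def)
  have AB: "PSL_class A \<in> carrier torus_group" "PSL_class B \<in> carrier torus_group"
    using A B by (auto simp: torus_matrices_def)
  then have in_H1: "H1_class (PSL_class A) \<in> carrier H1" "H1_class (PSL_class B) \<in> carrier H1"
    by (auto simp: H1_def H1_class_def FactGroup_def RCOSETS_def)
  have "H1_class (PSL_class (A ** B)) = H1_class (PSL_class A) \<otimes>\<^bsub>H1\<^esub> H1_class (PSL_class B)"
    using normal.rcos_sum[OF normal_derived_torus AB] A B
    by (simp add: H1_def H1_class_def FactGroup_def torus_group_simps PSL_class_mult torus_matrices_det)
  then have "\<phi> (H1_class (PSL_class (A ** B)))
      = \<phi> (H1_class (PSL_class A)) \<otimes>\<^bsub>integer_group \<times>\<times> integer_group\<^esub> \<phi> (H1_class (PSL_class B))"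
    using hom_mult[OF hom in_H1] by simp
  then show ?thesis
    by (cases "\<phi> (H1_class (PSL_class A))"; cases "\<phi> (H1_class (PSL_class B))")
       (simp add: hclass_def integer_group_def DirProd_def)
qed

lemma hclass_one:
  assumes "H1_identification \<phi>"
  shows "hclass \<phi> (mat 1) = 0"
  using hclass_mult[OF assms torus_matrices_one torus_matrices_one] by simp

lemma hclass_adj:
  assumes "H1_identification \<phi>" "A \<in> torus_matrices"
  shows "hclass \<phi> (adj A) = - hclass \<phi> A"
  using hclass_mult[OF assms torus_matrices_adj[OF assms(2)]] assms
  by (simp add: mult_adj torus_matrices_det hclass_one eq_neg_iff_add_eq_0 add.commute)

lemma hclass_gens:
  assumes "H1_identification \<phi>"
  shows "hclass \<phi> alpha_mat = (1, - 1)" "hclass \<phi> beta_mat = (0, 1)"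
  using assms by (simp_all add: H1_identification_def hclass_def gen_alpha_def gen_beta_def mk_def)

section \<open>The action on the upper half-plane\<close>

lemma mob_eq: "mob A z = (of_int (A$1$1) * z + of_int (A$1$2)) / (of_int (A$2$1) * z + of_int (A$2$2))"
  by (simp add: mob_def moebius_def)

lemma mob_denom_nonzero:
  fixes A :: "int^2^2"
  assumes "det A = 1" "0 < Im z"
  shows "of_int (A$2$1) * z + of_int (A$2$2) \<noteq> 0"
proof
  assume eq: "of_int (A$2$1) * z + of_int (A$2$2) = 0"
  then have "Im (of_int (A$2$1) * z + of_int (A$2$2)) = 0" by simp
  with assms have "A$2$1 = 0" by simp
  with eq have "A$2$2 = 0" by simp
  with \<open>A$2$1 = 0\<close> have "det A = 0" by (simp add: det_2)
  with assms show False by simp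
qed

lemma Im_mob:
  assumes "det A = 1"
  shows "Im (mob A z) = Im z / (cmod (of_int (A$2$1) * z + of_int (A$2$2)))\<^sup>2"
proof -
  have "real_of_int (A$1$1 * A$2$2 - A$1$2 * A$2$1) = 1"
    using assms by (simp add: det_2)
  then have d: "real_of_int (A$1$1) * A$2$2 - real_of_int (A$1$2) * A$2$1 = 1"
    by simp
  have "Im (mob A z) = Im z * (real_of_int (A$1$1) * A$2$2 - real_of_int (A$1$2) * A$2$1)
      / (cmod (of_int (A$2$1) * z + of_int (A$2$2)))\<^sup>2"
    by (simp add: mob_eq Im_divide cmod_def algebra_simps)
  then show ?thesis using d by simp
qed

lemma Im_mob_pos: "det A = 1 \<Longrightarrow> 0 < Im z \<Longrightarrow> 0 < Im (mob A z)"
  using mob_denom_nonzero[of A z] by (simp add: Im_mob)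

lemma mob_mult:
  assumes "det A = 1" "det B = 1" "0 < Im z"
  shows "mob (A ** B) z = mob A (mob B z)"
proof -
  have B: "of_int (B$2$1) * z + of_int (B$2$2) \<noteq> (0::complex)"
    using mob_denom_nonzero assms by blast
  define p where "p = of_int (B$1$1) * z + of_int (B$1$2)"
  define q where "q = of_int (B$2$1) * z + of_int (B$2$2)"
  have "q \<noteq> 0" using B by (simp add: q_def)
  have "mob (A ** B) z = (of_int (A$1$1) * p + of_int (A$1$2) * q) / (of_int (A$2$1) * p + of_int (A$2$2) * q)"
    by (simp add: mob_eq p_def q_def algebra_simps)
  also have "\<dots> = ((of_int (A$1$1) * (p / q) + of_int (A$1$2)) * q) / ((of_int (A$2$1) * (p / q) + of_int (A$2$2)) * q)"
    using \<open>q \<noteq> 0\<close> by (simp add: algebra_simps)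
  also have "\<dots> = (of_int (A$1$1) * (p / q) + of_int (A$1$2)) / (of_int (A$2$1) * (p / q) + of_int (A$2$2))"
    using \<open>q \<noteq> 0\<close> by (rule nonzero_mult_divide_mult_cancel_right)
  finally show ?thesis by (simp add: mob_eq p_def q_def)
qed

lemma mob_one [simp]: "mob (mat 1) z = z"
  by (simp add: mob_eq)

lemma mob_uminus [simp]: "mob (- A) z = mob A z"
proof -
  have "mob (- A) z = (- (of_int (A$1$1) * z + of_int (A$1$2))) / (- (of_int (A$2$1) * z + of_int (A$2$2)))"
    by (simp add: mob_eq algebra_simps)
  then show ?thesis unfolding mob_eq by (metis minus_divide_divide)
qed

lemma mob_adj:
  assumes "det A = 1" "0 < Im z"
  shows "mob (adj A) (mob A z) = z" "mob A (mob (adj A) z) = z"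
  using assms by (simp_all flip: mob_mult add: mult_adj)

lemma mob_shift [simp]: "mob (shift k) z = z + of_int k"
  by (simp add: mob_eq)

text \<open>The hyperbolic cosine of the distance, a rational function of the coordinates.\<close>

definition cdist :: "complex \<Rightarrow> complex \<Rightarrow> real" where
  "cdist z w = 1 + ((Re z - Re w)\<^sup>2 + (Im z - Im w)\<^sup>2) / (2 * Im z * Im w)"

lemma hdist_cdist: "hdist z w = arcosh (cdist z w)"
  by (simp add: hdist_def cdist_def cmod_def)

lemma cdist_ge_1: "0 < Im z \<Longrightarrow> 0 < Im w \<Longrightarrow> 1 \<le> cdist z w"
  by (simp add: cdist_def)

lemma cosh_hdist: "0 < Im z \<Longrightarrow> 0 < Im w \<Longrightarrow> cosh (hdist z w) = cdist z w"
  by (simp add: hdist_cdist cosh_arcosh_real cdist_ge_1)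

lemma hdist_eq_abs_iff:
  assumes "0 < Im z" "0 < Im w"
  shows "hdist z w = \<bar>t\<bar> \<longleftrightarrow> cdist z w = cosh t"
proof
  assume "hdist z w = \<bar>t\<bar>"
  then show "cdist z w = cosh t" using cosh_hdist[OF assms] by simp
next
  assume "cdist z w = cosh t"
  then show "hdist z w = \<bar>t\<bar>"
    unfolding hdist_cdist by (metis abs_ge_zero arcosh_cosh_real cosh_real_abs)
qed

lemma cdist_mob:
  assumes "det A = 1" "0 < Im z" "0 < Im w"
  shows "cdist (mob A z) (mob A w) = cdist z w"
proof -
  define p where "p = of_int (A$2$1) * z + of_int (A$2$2)"
  define q where "q = of_int (A$2$1) * w + of_int (A$2$2)"
  have nz: "p \<noteq> 0" "q \<noteq> 0" using mob_denom_nonzero assms by (auto simp: p_def q_def)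
  have "of_int (A$1$1 * A$2$2 - A$1$2 * A$2$1) = (1 :: complex)"
    using assms by (simp add: det_2)
  then have d: "of_int (A$1$1) * of_int (A$2$2) - of_int (A$1$2) * of_int (A$2$1) = (1 :: complex)"
    by simp
  have "mob A z - mob A w = ((of_int (A$1$1) * z + of_int (A$1$2)) * q
      - (of_int (A$1$1) * w + of_int (A$1$2)) * p) / (p * q)"
    using nz by (simp add: mob_eq divide_simps flip: p_def q_def)
  also have "(of_int (A$1$1) * z + of_int (A$1$2)) * q - (of_int (A$1$1) * w + of_int (A$1$2)) * p
     = (of_int (A$1$1) * of_int (A$2$2) - of_int (A$1$2) * of_int (A$2$1)) * (z - w)"
    by (simp add: p_def q_def algebra_simps)
  finally have diff: "mob A z - mob A w = (z - w) / (p * q)"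
    using d by simp
  have cd: "cdist u v = 1 + (cmod (u - v))\<^sup>2 / (2 * Im u * Im v)" for u v
    by (simp add: cdist_def cmod_def)
  show ?thesis
    unfolding cd diff using nz assms
    by (simp add: Im_mob norm_divide norm_mult power_divide power_mult_distrib flip: p_def q_def)
qed

lemma hdist_mob:
  assumes "det A = 1" "0 < Im z" "0 < Im w"
  shows "hdist (mob A z) (mob A w) = hdist z w"
  using cdist_mob[OF assms] by (simp add: hdist_cdist)

lemma unit_speed_mob:
  assumes "det A = 1" "unit_speed_geodesic I \<sigma>"
  shows "unit_speed_geodesic I (mob A \<circ> \<sigma>)"
  using assms by (auto simp: unit_speed_geodesic_def upper_half_plane_def Im_mob_pos hdist_mob)


section \<open>Geodesics of the half-plane\<close>

text \<open>The unit speed parametrizations of the geodesics. A half-circle is traversed to the right and is at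
  its top at time 0.\<close>

definition semicircle :: "real \<Rightarrow> real \<Rightarrow> real \<Rightarrow> complex" where
  "semicircle x r s = Complex (x + r * tanh s) (r / cosh s)"

definition vertical :: "real \<Rightarrow> real \<Rightarrow> complex" where
  "vertical x s = Complex x (exp s)"

lemma semicircle_simps [simp]:
  "Re (semicircle x r s) = x + r * tanh s" "Im (semicircle x r s) = r / cosh s"
  by (simp_all add: semicircle_def)

lemma vertical_simps [simp]: "Re (vertical x s) = x" "Im (vertical x s) = exp s"
  by (simp_all add: vertical_def)

lemma tanh_cosh: "tanh s = sinh s / cosh (s :: real)"
  by (simp add: tanh_def)

lemma cosh_square: "(cosh s)\<^sup>2 = 1 + (sinh (s :: real))\<^sup>2"
  using cosh_square_eq[of s] by simp

lemma cosh_nz [simp]: "cosh (s :: real) \<noteq> 0"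
  using cosh_real_pos[of s] by linarith

lemma semicircle_norm: "(Re (semicircle x r s) - x)\<^sup>2 + (Im (semicircle x r s))\<^sup>2 = r\<^sup>2"
proof -
  have "(r * tanh s)\<^sup>2 + (r / cosh s)\<^sup>2 = r\<^sup>2 * ((sinh s)\<^sup>2 + 1) / (cosh s)\<^sup>2"
    by (simp add: tanh_cosh power_mult_distrib power_divide add_divide_distrib distrib_left)
  also have "\<dots> = r\<^sup>2" by (simp add: cosh_square[of s, symmetric] add.commute[of _ 1])
  finally show ?thesis by simp
qed

lemma cdist_semicircle_point:
  assumes r: "0 < r" and z: "0 < Im z"
  shows "cdist z (semicircle x r s)
    = (((Re z - x)\<^sup>2 + (Im z)\<^sup>2 + r\<^sup>2) * cosh s - 2 * r * (Re z - x) * sinh s) / (2 * r * Im z)"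
proof -
  let ?w = "semicircle x r s"
  have "(Re z - Re ?w)\<^sup>2 + (Im z - Im ?w)\<^sup>2 + 2 * Im z * Im ?w
      = (Re z - x)\<^sup>2 + (Im z)\<^sup>2 - 2 * (Re z - x) * (Re ?w - x) + ((Re ?w - x)\<^sup>2 + (Im ?w)\<^sup>2)"
    by (simp add: power2_eq_square algebra_simps del: semicircle_simps)
  also have "\<dots> = (Re z - x)\<^sup>2 + (Im z)\<^sup>2 + r\<^sup>2 - 2 * (Re z - x) * (r * tanh s)"
    unfolding semicircle_norm by simp
  finally have *: "(Re z - Re ?w)\<^sup>2 + (Im z - Im ?w)\<^sup>2 + 2 * Im z * Im ?w
      = (Re z - x)\<^sup>2 + (Im z)\<^sup>2 + r\<^sup>2 - 2 * (Re z - x) * (r * tanh s)" .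
  have "cdist z ?w = ((Re z - Re ?w)\<^sup>2 + (Im z - Im ?w)\<^sup>2 + 2 * Im z * Im ?w) / (2 * Im z * Im ?w)"
    using z r by (simp add: cdist_def add_divide_distrib del: semicircle_simps)
       (simp add: field_simps)
  also have "\<dots> = ((Re z - x)\<^sup>2 + (Im z)\<^sup>2 + r\<^sup>2 - 2 * (Re z - x) * (r * tanh s)) * cosh s / (2 * r * Im z)"
    unfolding * using z r by (simp add: field_simps)
  also have "((Re z - x)\<^sup>2 + (Im z)\<^sup>2 + r\<^sup>2 - 2 * (Re z - x) * (r * tanh s)) * cosh s
      = ((Re z - x)\<^sup>2 + (Im z)\<^sup>2 + r\<^sup>2) * cosh s - 2 * r * (Re z - x) * (tanh s * cosh s)"
    by (simp add: algebra_simps)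
  also have "tanh s * cosh s = sinh s" by (simp add: tanh_cosh)
  finally show ?thesis .
qed

lemma cdist_semicircle:
  assumes "0 < r"
  shows "cdist (semicircle x r s) (semicircle x r t) = cosh (s - t)"
proof -
  have "cdist (semicircle x r s) (semicircle x r t)
    = ((r\<^sup>2 + r\<^sup>2) * cosh t - 2 * r * (r * tanh s) * sinh t) / (2 * r * (r / cosh s))"
    using cdist_semicircle_point[OF assms, of "semicircle x r s" x t] assms semicircle_norm[of x r s]
    by simp
  also have "\<dots> = cosh s * cosh t - sinh s * sinh t"
    using assms by (simp add: field_simps tanh_cosh power2_eq_square)
  finally show ?thesis by (simp add: cosh_diff)
qed

text \<open>Points at prescribed signed distances from two points of the half-circle: both distance
  equations are linear in the two unknowns \<open>P\<close> and \<open>Q\<close> below.\<close>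

lemma semicircle_unique:
  assumes r: "0 < r" and z: "0 < Im z" and ne: "s1 \<noteq> s2"
    and d1: "cdist z (semicircle x r s1) = cosh (u - s1)"
    and d2: "cdist z (semicircle x r s2) = cosh (u - s2)"
  shows "z = semicircle x r u"
proof -
  define P where "P = ((Re z - x)\<^sup>2 + (Im z)\<^sup>2 + r\<^sup>2) / (2 * r * Im z) - cosh u"
  define Q where "Q = (Re z - x) / Im z - sinh u"
  have lin: "P * cosh s - Q * sinh s = 0" if "cdist z (semicircle x r s) = cosh (u - s)" for s
  proof -
    have "cdist z (semicircle x r s) = (P + cosh u) * cosh s - (Q + sinh u) * sinh s"
      unfolding cdist_semicircle_point[OF r z] P_def Q_def using r z
      by (simp add: field_simps)
    with that show ?thesis by (simp add: cosh_diff algebra_simps)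
  qed
  have "P * sinh (s2 - s1) = (P * cosh s1 - Q * sinh s1) * sinh s2 - (P * cosh s2 - Q * sinh s2) * sinh s1"
    "Q * sinh (s2 - s1) = (P * cosh s1 - Q * sinh s1) * cosh s2 - (P * cosh s2 - Q * sinh s2) * cosh s1"
    by (simp_all add: sinh_diff algebra_simps)
  then have "P * sinh (s2 - s1) = 0" "Q * sinh (s2 - s1) = 0"
    using lin[OF d1] lin[OF d2] by simp_all
  with ne have "P = 0" "Q = 0" by auto
  then have X: "Re z - x = Im z * sinh u" and N: "(Re z - x)\<^sup>2 + (Im z)\<^sup>2 + r\<^sup>2 = 2 * r * Im z * cosh u"
    using r z by (auto simp: P_def Q_def field_simps)
  have "(Im z * cosh u - r)\<^sup>2 = (Im z)\<^sup>2 * (cosh u)\<^sup>2 + r\<^sup>2 - 2 * r * Im z * cosh u"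
    by (simp add: power2_eq_square algebra_simps)
  also have "\<dots> = 0" using N unfolding X cosh_square by (simp add: power2_eq_square algebra_simps)
  finally have y: "Im z = r / cosh u" by (simp add: field_simps)
  show ?thesis
    using X y by (simp add: complex_eq_iff tanh_cosh)
qed

lemma cdist_vertical_point:
  assumes "0 < Im z"
  shows "cdist z (vertical x s) = ((Re z - x)\<^sup>2 + (Im z)\<^sup>2 + (exp s)\<^sup>2) / (2 * Im z * exp s)"
  using assms by (simp add: cdist_def field_simps power2_eq_square)

lemma cdist_vertical: "cdist (vertical x s) (vertical x t) = cosh (s - t)"
proof -
  have "cdist (vertical x s) (vertical x t) = ((exp s)\<^sup>2 + (exp t)\<^sup>2) / (2 * exp s * exp t)"
    by (simp add: cdist_vertical_point)
  also have "\<dots> = (exp s / exp t + exp t / exp s) / 2"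
    by (simp add: field_simps power2_eq_square)
  finally show ?thesis
    by (simp add: cosh_def exp_diff exp_minus field_simps)
qed

lemma vertical_unique:
  assumes z: "0 < Im z" and ne: "s1 \<noteq> s2"
    and d1: "cdist z (vertical x s1) = cosh (u - s1)"
    and d2: "cdist z (vertical x s2) = cosh (u - s2)"
  shows "z = vertical x u"
proof -
  have *: "(Re z - x)\<^sup>2 + (Im z)\<^sup>2 + (exp s)\<^sup>2 = Im z * (exp u + (exp s)\<^sup>2 * exp (- u))"
    if "cdist z (vertical x s) = cosh (u - s)" for s
  proof -
    have "cosh (u - s) * (2 * exp s) = exp u + (exp s)\<^sup>2 * exp (- u)"
      by (simp add: cosh_def exp_diff exp_minus field_simps power2_eq_square)
    with that z show ?thesis
      by (simp add: cdist_vertical_point field_simps)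
  qed
  have "(exp s1)\<^sup>2 - (exp s2)\<^sup>2 = Im z * exp (- u) * ((exp s1)\<^sup>2 - (exp s2)\<^sup>2)"
    using *[OF d1] *[OF d2] by (simp add: algebra_simps)
  moreover have "(exp s1)\<^sup>2 \<noteq> (exp s2)\<^sup>2" using ne by (simp add: power2_eq_iff_nonneg)
  ultimately have "Im z * exp (- u) = 1" by simp
  then have y: "Im z = exp u" by (simp add: exp_minus field_simps)
  have "exp u * ((exp s1)\<^sup>2 * exp (- u)) = (exp s1)\<^sup>2" by (simp add: exp_minus)
  moreover have "(Re z - x)\<^sup>2 + (exp u)\<^sup>2 + (exp s1)\<^sup>2 = exp u * exp u + exp u * ((exp s1)\<^sup>2 * exp (- u))"
    using *[OF d1] unfolding y distrib_left .
  ultimately have "(Re z - x)\<^sup>2 = 0"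
    by (simp only: power2_eq_square[of "exp u"])
  with y show ?thesis by (simp add: complex_eq_iff)
qed

lemma unit_speed_Im: "unit_speed_geodesic I \<sigma> \<Longrightarrow> t \<in> I \<Longrightarrow> 0 < Im (\<sigma> t)"
  by (simp add: unit_speed_geodesic_def upper_half_plane_def)

lemma unit_speed_cdist:
  assumes "unit_speed_geodesic I \<sigma>" "s \<in> I" "t \<in> I"
  shows "cdist (\<sigma> s) (\<sigma> t) = cosh (s - t)"
  using assms hdist_eq_abs_iff[of "\<sigma> s" "\<sigma> t" "s - t"] unit_speed_Im[OF assms(1)]
  by (auto simp: unit_speed_geodesic_def)

lemma unit_speed_iff:
  "unit_speed_geodesic I \<sigma> \<longleftrightarrow>
     (\<forall>t\<in>I. 0 < Im (\<sigma> t)) \<and> (\<forall>s\<in>I. \<forall>t\<in>I. cdist (\<sigma> s) (\<sigma> t) = cosh (s - t))"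
proof
  assume *: "unit_speed_geodesic I \<sigma>"
  then show "(\<forall>t\<in>I. 0 < Im (\<sigma> t)) \<and> (\<forall>s\<in>I. \<forall>t\<in>I. cdist (\<sigma> s) (\<sigma> t) = cosh (s - t))"
    using unit_speed_Im unit_speed_cdist by blast
next
  assume "(\<forall>t\<in>I. 0 < Im (\<sigma> t)) \<and> (\<forall>s\<in>I. \<forall>t\<in>I. cdist (\<sigma> s) (\<sigma> t) = cosh (s - t))"
  then show "unit_speed_geodesic I \<sigma>"
    unfolding unit_speed_geodesic_def upper_half_plane_def by (auto simp: hdist_eq_abs_iff)
qed

lemma circle_point:
  assumes "0 < Im z" "0 < r" "(Re z - x)\<^sup>2 + (Im z)\<^sup>2 = r\<^sup>2"
  shows "\<exists>s. z = semicircle x r s"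
proof -
  define s where "s = arsinh ((Re z - x) / Im z)"
  have sh: "sinh s = (Re z - x) / Im z" by (simp add: s_def)
  have "(cosh s)\<^sup>2 = ((Im z)\<^sup>2 + (Re z - x)\<^sup>2) / (Im z)\<^sup>2"
    using assms unfolding cosh_square sh by (simp add: power_divide add_divide_distrib)
  also have "\<dots> = (r / Im z)\<^sup>2"
    using assms(3) by (simp add: power_divide add.commute)
  finally have "cosh s = r / Im z"
    using assms by (simp add: power2_eq_iff_nonneg cosh_real_nonneg)
  then have "z = semicircle x r s"
    using assms sh by (simp add: complex_eq_iff tanh_cosh)
  then show ?thesis ..
qed

text \<open>Two points at distance one lie on a vertical line or a half-circle, and a point at distances
  from them as on that curve lies on it.\<close>

lemma unit_speed_cases:
  assumes \<sigma>: "unit_speed_geodesic I \<sigma>" and I: "0 \<in> I" "1 \<in> I"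
  obtains (vertical) x a e where "e \<in> {1, -1}" "\<And>t. t \<in> I \<Longrightarrow> \<sigma> t = vertical x (e * t + a)"
  | (semicircle) x r a e where "e \<in> {1, -1}" "0 < r" "\<And>t. t \<in> I \<Longrightarrow> \<sigma> t = semicircle x r (e * t + a)"
proof -
  have Im: "0 < Im (\<sigma> t)" if "t \<in> I" for t using unit_speed_Im \<sigma> that by blast
  have cd: "cdist (\<sigma> s) (\<sigma> t) = cosh (s - t)" if "s \<in> I" "t \<in> I" for s t
    using unit_speed_cdist \<sigma> that by blast
  have ee: "e \<in> {1, -1 :: real}" if "cosh e = cosh 1" for e
    using that by (metis abs_1 abs_eq_iff arcosh_cosh_real abs_ge_zero cosh_real_abs insertCI)
  have cosh_e: "cosh (e * t) = cosh t" if "e \<in> {1, -1}" for e t :: real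
    using that by auto
  show ?thesis
  proof (cases "Re (\<sigma> 0) = Re (\<sigma> 1)")
    case True
    define x where "x = Re (\<sigma> 0)"
    define a where "a = ln (Im (\<sigma> 0))"
    define b where "b = ln (Im (\<sigma> 1))"
    have z: "\<sigma> 0 = vertical x a" "\<sigma> 1 = vertical x b"
      using Im I True by (simp_all add: complex_eq_iff x_def a_def b_def)
    define e where "e = b - a"
    have "cosh e = cosh 1" using cd[OF I(2,1)] by (simp add: z cdist_vertical e_def)
    then have e: "e \<in> {1, -1}" by (rule ee)
    have "\<sigma> t = vertical x (e * t + a)" if t: "t \<in> I" for t
    proof (rule vertical_unique[of _ a b])
      show "0 < Im (\<sigma> t)" using Im t by blast
      show "a \<noteq> b" using e e_def by auto
      show "cdist (\<sigma> t) (vertical x a) = cosh (e * t + a - a)"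
        using cd[OF t I(1)] cosh_e[OF e] by (simp add: z)
      have "e * t + a - b = e * (t - 1)" by (simp add: e_def algebra_simps)
      then show "cdist (\<sigma> t) (vertical x b) = cosh (e * t + a - b)"
        using cd[OF t I(2)] cosh_e[OF e] by (simp add: z)
    qed
    with e vertical show thesis by blast
  next
    case False
    define x where "x = ((Re (\<sigma> 0))\<^sup>2 + (Im (\<sigma> 0))\<^sup>2 - (Re (\<sigma> 1))\<^sup>2 - (Im (\<sigma> 1))\<^sup>2)
      / (2 * (Re (\<sigma> 0) - Re (\<sigma> 1)))"
    define r where "r = sqrt ((Re (\<sigma> 0) - x)\<^sup>2 + (Im (\<sigma> 0))\<^sup>2)"
    have "0 < (Re (\<sigma> 0) - x)\<^sup>2 + (Im (\<sigma> 0))\<^sup>2"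
      using Im[OF I(1)] by (simp add: add_nonneg_pos)
    then have r: "0 < r" and r0: "(Re (\<sigma> 0) - x)\<^sup>2 + (Im (\<sigma> 0))\<^sup>2 = r\<^sup>2"
      by (simp_all add: r_def)
    have "2 * x * (Re (\<sigma> 0) - Re (\<sigma> 1))
      = (Re (\<sigma> 0))\<^sup>2 + (Im (\<sigma> 0))\<^sup>2 - (Re (\<sigma> 1))\<^sup>2 - (Im (\<sigma> 1))\<^sup>2"
    proof -
      have "2 * (n / (2 * d)) * d = n" if "d \<noteq> 0" for n d :: real using that by simp
      then show ?thesis using False unfolding x_def by (metis right_minus_eq)
    qed
    then have r1: "(Re (\<sigma> 1) - x)\<^sup>2 + (Im (\<sigma> 1))\<^sup>2 = r\<^sup>2"
      using r0 by (simp add: power2_eq_square algebra_simps)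
    obtain a b where z: "\<sigma> 0 = semicircle x r a" "\<sigma> 1 = semicircle x r b"
      using circle_point[OF Im[OF I(1)] r r0] circle_point[OF Im[OF I(2)] r r1] by blast
    define e where "e = b - a"
    have "cosh e = cosh 1" using cd[OF I(2,1)] r by (simp add: z cdist_semicircle e_def)
    then have e: "e \<in> {1, -1}" by (rule ee)
    have "\<sigma> t = semicircle x r (e * t + a)" if t: "t \<in> I" for t
    proof (rule semicircle_unique[OF r, of _ a b])
      show "0 < Im (\<sigma> t)" using Im t by blast
      show "a \<noteq> b" using e e_def by auto
      show "cdist (\<sigma> t) (semicircle x r a) = cosh (e * t + a - a)"
        using cd[OF t I(1)] cosh_e[OF e] by (simp add: z)
      have "e * t + a - b = e * (t - 1)" by (simp add: e_def algebra_simps)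
      then show "cdist (\<sigma> t) (semicircle x r b) = cosh (e * t + a - b)"
        using cd[OF t I(2)] cosh_e[OF e] by (simp add: z)
    qed
    with e r semicircle show thesis by blast
  qed
qed

lemma cosh_sign_diff:
  assumes "e \<in> {1, -1 :: real}"
  shows "cosh (e * u + a - (e * s + a)) = cosh (u - s)"
proof -
  have "e * u + a - (e * s + a) = e * (u - s)" by (simp add: algebra_simps)
  then show ?thesis using assms cosh_minus[of "u - s"] by auto
qed

lemma unit_speed_vertical:
  assumes "e \<in> {1, -1}"
  shows "unit_speed_geodesic I (\<lambda>t. vertical x (e * t + a))"
  using assms by (simp add: unit_speed_iff cdist_vertical cosh_sign_diff[OF assms(1), of _ 0, unfolded add_0_right] del: insert_iff cosh_real_eq_iff)

lemma unit_speed_agree: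
  assumes \<sigma>: "unit_speed_geodesic UNIV \<sigma>" and \<tau>: "unit_speed_geodesic UNIV \<tau>"
    and eq: "\<sigma> s = \<tau> s" "\<sigma> t = \<tau> t" "s \<noteq> t"
  shows "\<sigma> = \<tau>"
proof
  fix u
  have d: "cdist (\<tau> u) (\<sigma> s) = cosh (u - s)" "cdist (\<tau> u) (\<sigma> t) = cosh (u - t)" "0 < Im (\<tau> u)"
    using unit_speed_cdist[OF \<tau>] unit_speed_Im[OF \<tau>] eq by simp_all
  have "\<tau> u = \<sigma> u"
  proof (cases rule: unit_speed_cases[OF \<sigma> UNIV_I UNIV_I])
    case (1 x a e) note vertical = this
    have "\<tau> u = vertical x (e * u + a)"
      by (rule vertical_unique[of _ "e * s + a" "e * t + a"])
         (use d eq(3) vertical in \<open>auto simp: cosh_sign_diff[OF vertical(1)]\<close>)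
    then show ?thesis using vertical by simp
  next
    case (2 x r a e) note semicircle = this
    have "\<tau> u = semicircle x r (e * u + a)"
      by (rule semicircle_unique[of _ _ "e * s + a" "e * t + a"])
         (use d eq(3) semicircle in \<open>auto simp: cosh_sign_diff[OF semicircle(1)]\<close>)
    then show ?thesis using semicircle by simp
  qed
  then show "\<sigma> u = \<tau> u" ..
qed


section \<open>Axes of hyperbolic matrices\<close>

definition axis :: "int^2^2 \<Rightarrow> real \<Rightarrow> (real \<Rightarrow> complex) \<Rightarrow> bool" where
  "axis A L \<sigma> \<longleftrightarrow> det A = 1 \<and> 0 < L \<and> unit_speed_geodesic UNIV \<sigma> \<and> (\<forall>t. \<sigma> (t + L) = mob A (\<sigma> t))"

lemma axis_mob:
  assumes "axis A L \<sigma>" "det M = 1"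
  shows "axis (M ** A ** adj M) L (mob M \<circ> \<sigma>)"
proof -
  have Im: "0 < Im (\<sigma> t)" for t
    using assms(1) unit_speed_Im by (auto simp: axis_def)
  have "mob (M ** A ** adj M) (mob M (\<sigma> t)) = mob M (mob A (\<sigma> t))" for t
    using assms Im by (simp add: axis_def mob_mult det_mul Im_mob_pos mob_adj)
  with assms show ?thesis
    by (auto simp: axis_def det_mul unit_speed_mob)
qed

lemma axis_uminus [simp]: "axis (- A) L \<sigma> \<longleftrightarrow> axis A L \<sigma>"
  by (simp add: axis_def)

text \<open>A vertical axis is excluded: the lower left entry would vanish, so that the diagonal entries were
  \<open>\<plusminus>1\<close> and \<open>L\<close> zero. On a half-circle the equation for \<open>\<sigma> (t + L)\<close>, compared at a few
  times, determines everything: the centre and the radius are those of the fixed points,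
  and the last fact gives the direction \<open>e\<close>.\<close>

lemma axis_semicircle:
  assumes "axis A L \<sigma>"
  obtains x r e a where "e \<in> {1, -1}" "0 < r" "\<And>t. \<sigma> t = semicircle x r (e * t + a)"
    "A$2$1 \<noteq> 0" "2 * real_of_int (A$2$1) * x = A$1$1 - A$2$2"
    "4 * (real_of_int (A$2$1))\<^sup>2 * r\<^sup>2 = (real_of_int (trace2 A))\<^sup>2 - 4"
    "\<bar>real_of_int (trace2 A)\<bar> = 2 * cosh (L / 2)" "0 < e * real_of_int (A$2$1) * trace2 A"
proof -
  have A: "det A = 1" "0 < L" "unit_speed_geodesic UNIV \<sigma>" and step: "\<And>t. \<sigma> (t + L) = mob A (\<sigma> t)"
    using assms by (auto simp: axis_def)
  define c where "c = real_of_int (A$2$1)"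
  define d where "d = real_of_int (A$2$2)"
  define a0 where "a0 = real_of_int (A$1$1)"
  define b0 where "b0 = real_of_int (A$1$2)"
  have "real_of_int (A$1$1 * A$2$2 - A$1$2 * A$2$1) = 1"
    using A by (simp add: det_2)
  then have det: "a0 * d - b0 * c = 1" by (simp add: a0_def b0_def c_def d_def)
  have norm: "(cmod (of_int (A$2$1) * z + of_int (A$2$2)))\<^sup>2 = (c * Re z + d)\<^sup>2 + (c * Im z)\<^sup>2" for z
    by (simp add: cmod_def c_def d_def)
  have Im_pos: "0 < Im (\<sigma> t)" for t using A unit_speed_Im by blast
  have den: "0 < (c * Re (\<sigma> t) + d)\<^sup>2 + (c * Im (\<sigma> t))\<^sup>2" for t
    using mob_denom_nonzero[OF A(1) Im_pos[of t]] unfolding norm[symmetric] by simp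
  have Im_step: "Im (\<sigma> (t + L)) * ((c * Re (\<sigma> t) + d)\<^sup>2 + (c * Im (\<sigma> t))\<^sup>2) = Im (\<sigma> t)" for t
    unfolding step Im_mob[OF A(1)] norm using less_imp_neq[OF den[of t]] by (metis nonzero_divide_eq_eq)
  have Re_step: "Re (\<sigma> (t + L)) * ((c * Re (\<sigma> t) + d)\<^sup>2 + (c * Im (\<sigma> t))\<^sup>2)
      = (a0 * Re (\<sigma> t) + b0) * (c * Re (\<sigma> t) + d) + a0 * c * (Im (\<sigma> t))\<^sup>2" for t
  proof -
    have "Re (mob A z) = ((a0 * Re z + b0) * (c * Re z + d) + a0 * c * (Im z)\<^sup>2)
      / ((c * Re z + d)\<^sup>2 + (c * Im z)\<^sup>2)" for z
      by (simp add: mob_eq Re_divide a0_def b0_def c_def d_def power2_eq_square algebra_simps)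
    then show ?thesis unfolding step using den[of t] by simp
  qed
  show ?thesis
  proof (cases rule: unit_speed_cases[OF A(3) UNIV_I UNIV_I])
    case (1 x a e)
    have *: "(c * x + d)\<^sup>2 + c\<^sup>2 * (exp (e * t + a))\<^sup>2 = exp (- (e * L))" for t
    proof -
      have "exp (e * t + a) * (exp (e * L) * ((c * x + d)\<^sup>2 + c\<^sup>2 * (exp (e * t + a))\<^sup>2)) = exp (e * t + a) * 1"
        using Im_step[of t] by (simp add: 1 power_mult_distrib distrib_left exp_add mult_ac)
      then have "exp (e * L) * ((c * x + d)\<^sup>2 + c\<^sup>2 * (exp (e * t + a))\<^sup>2) = 1"
        by (subst (asm) mult_cancel_left) simp
      then show ?thesis by (simp add: exp_minus field_simps)
    qed
    have "c\<^sup>2 * (exp (e * 0 + a))\<^sup>2 = c\<^sup>2 * (exp (e * 1 + a))\<^sup>2" using *[of 0] *[of 1] by linarith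
    moreover have "(exp (e * 0 + a))\<^sup>2 \<noteq> (exp (e * 1 + a))\<^sup>2" using 1(1) by (auto simp: power2_eq_iff_nonneg)
    ultimately have c: "c = 0" by auto
    then have "A$1$1 * A$2$2 = 1" using A(1) by (simp add: c_def det_2)
    then have "A$2$2 = 1 \<or> A$2$2 = -1" by (metis zmult_eq_1_iff)
    then have "d\<^sup>2 = 1" by (auto simp: d_def)
    then have "exp (- (e * L)) = 1" using *[of 0] by (simp add: c)
    then show ?thesis using 1(1) A(2) by auto
  next
    case (2 x r a e)
    define p where "p = c * x + d"
    have r: "r \<noteq> 0" using 2 by simp
    define K where "K s = p\<^sup>2 + c\<^sup>2 * r\<^sup>2 + 2 * p * c * r * tanh s" for s
    have quad: "(c * Re (semicircle x r s) + d)\<^sup>2 + (c * Im (semicircle x r s))\<^sup>2 = K s" for s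
    proof -
      have "(c * Re (semicircle x r s) + d)\<^sup>2 + (c * Im (semicircle x r s))\<^sup>2
        = p\<^sup>2 + 2 * p * c * (Re (semicircle x r s) - x)
          + c\<^sup>2 * ((Re (semicircle x r s) - x)\<^sup>2 + (Im (semicircle x r s))\<^sup>2)"
        by (simp add: p_def power2_eq_square algebra_simps del: semicircle_simps)
      then show ?thesis unfolding semicircle_norm K_def by (simp add: algebra_simps)
    qed
    have ss: "\<sigma> ((s - a) / e) = semicircle x r s" "\<sigma> ((s - a) / e + L) = semicircle x r (s + e * L)" for s
      using 2 by (auto simp: algebra_simps)
    have K: "K s * cosh s = cosh (s + e * L)" for s
      using Im_step[of "(s - a) / e"] unfolding ss quad using r by (simp add: field_simps)
    have Re: "(c * x - a0) * cosh (s + e * L) + c * r * sinh (s + e * L) + p * cosh s + c * r * sinh s = 0" for s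
    proof -
      let ?z = "semicircle x r s"
      have "c * (Re (semicircle x r (s + e * L)) * K s)
          = c * ((a0 * Re ?z + b0) * (c * Re ?z + d) + a0 * c * (Im ?z)\<^sup>2)"
        using Re_step[of "(s - a) / e"] unfolding ss quad by simp
      also have "\<dots> = a0 * ((c * Re ?z + d)\<^sup>2 + (c * Im ?z)\<^sup>2) - (a0 * d - b0 * c) * (c * Re ?z + d)"
        by (simp add: power2_eq_square algebra_simps del: semicircle_simps)
      also have "\<dots> = a0 * K s - (p + c * r * tanh s)"
        unfolding quad det by (simp add: p_def algebra_simps)
      finally have "c * (x + r * tanh (s + e * L)) * (K s * cosh s) = (a0 * K s - (p + c * r * tanh s)) * cosh s"
        by (metis mult.assoc semicircle_simps(1))
      then have "c * x * cosh (s + e * L) + c * r * (tanh (s + e * L) * cosh (s + e * L))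
        = a0 * cosh (s + e * L) - (p * cosh s + c * r * (tanh s * cosh s))"
        unfolding K[symmetric] by (simp add: algebra_simps)
      moreover have "tanh u * cosh u = sinh u" for u :: real by (simp add: tanh_cosh)
      ultimately show ?thesis by (simp add: algebra_simps)
    qed
    have cL: "cosh (e * L) = cosh L" "sinh (e * L) = e * sinh L" using 2(1) by auto
    have R0: "(c * x - a0) * cosh L + c * r * (e * sinh L) + p = 0"
      using Re[of 0] by (simp add: cL)
    have R1: "c * x - a0 + p * cosh L - c * r * (e * sinh L) = 0"
      using Re[of "- (e * L)"] by (simp add: cL)
    have "(c * x - a0 + p) * (1 + cosh L) = 0"
      using R0 R1 by (simp add: algebra_simps)
    moreover have "1 + cosh L > 0" using cosh_real_pos[of L] by linarith
    ultimately have p: "p = a0 - c * x" by simp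
    then have tr: "2 * p = a0 + d" and x: "2 * c * x = a0 - d" by (simp_all add: p_def algebra_simps)
    have K0: "p\<^sup>2 + c\<^sup>2 * r\<^sup>2 = cosh L" using K[of 0] by (simp add: K_def cL)
    have "K 1 * cosh 1 = (p\<^sup>2 + c\<^sup>2 * r\<^sup>2) * cosh 1 + 2 * p * c * r * sinh 1"
      by (simp add: K_def tanh_cosh distrib_right)
    moreover have "cosh (1 + e * L) = cosh 1 * cosh L + sinh 1 * (e * sinh L)"
      by (simp add: cosh_add cL)
    ultimately have "sinh 1 * (2 * p * c * r) = sinh 1 * (e * sinh L)"
      using K[of 1] unfolding K0 by (simp add: algebra_simps)
    moreover have "sinh (1::real) \<noteq> 0" by simp
    ultimately have pc: "2 * p * c * r = e * sinh L" by (metis mult_cancel_left)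
    have sL: "0 < sinh L" using A(2) by simp
    have ee: "e * e = 1" using 2(1) by auto
    have "2 * (e * p * c) * r = (e * e) * sinh L" using pc by (simp add: algebra_simps)
    then have "2 * (e * p * c) * r = sinh L" using ee by simp
    then have "0 < (e * p * c) * r" using sL by linarith
    then have epc: "0 < e * p * c" using 2(2) by (simp add: zero_less_mult_iff)
    then have c: "c \<noteq> 0" and p0: "p \<noteq> 0" by auto
    have "p * (cosh L - 1) = p * (2 * c\<^sup>2 * r\<^sup>2)"
    proof -
      have "p * (cosh L - 1) = c * r * (e * sinh L)" proof -
        have a0: "a0 = p + c * x" using p by simp
        show ?thesis using R0 unfolding a0 by (simp add: algebra_simps)
      qed
      also have "\<dots> = p * (2 * c\<^sup>2 * r\<^sup>2)" unfolding pc[symmetric] by (simp add: power2_eq_square)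
      finally show ?thesis .
    qed
    with p0 have c2: "2 * c\<^sup>2 * r\<^sup>2 = cosh L - 1" by simp
    with K0 have p2: "2 * p\<^sup>2 = cosh L + 1" by linarith
    have "cosh L = 2 * (cosh (L / 2))\<^sup>2 - 1" using cosh_double_cosh[of "L / 2"] by simp
    with p2 have "p\<^sup>2 = (cosh (L / 2))\<^sup>2" by simp
    then have "\<bar>p\<bar> = cosh (L / 2)" by (metis abs_of_pos cosh_real_pos power2_eq_iff_nonneg abs_ge_zero power2_abs)
    then have len: "\<bar>a0 + d\<bar> = 2 * cosh (L / 2)" unfolding tr[symmetric] by (simp add: abs_mult)
    show ?thesis
    proof (rule that[OF 2(1,2)])
      show "\<sigma> t = semicircle x r (e * t + a)" for t using 2 by simp
      show "A$2$1 \<noteq> 0" using c by (simp add: c_def)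
      show "2 * real_of_int (A$2$1) * x = A$1$1 - A$2$2" using x by (simp add: a0_def c_def d_def)
      show "4 * (real_of_int (A$2$1))\<^sup>2 * r\<^sup>2 = (real_of_int (trace2 A))\<^sup>2 - 4"
        using c2 p2 tr[symmetric] by (simp add: a0_def c_def d_def power2_eq_square)
      show "\<bar>real_of_int (trace2 A)\<bar> = 2 * cosh (L / 2)" using len by (simp add: a0_def d_def)
      show "0 < e * real_of_int (A$2$1) * trace2 A"
        using epc tr[symmetric] by (simp add: a0_def c_def d_def mult_ac)
    qed
  qed
qed

lemma axis_range:
  assumes "e \<in> {1, -1}" "0 < r" "\<And>t. \<sigma> t = semicircle x r (e * t + a)"
  shows "range \<sigma> = {z. 0 < Im z \<and> (Re z - x)\<^sup>2 + (Im z)\<^sup>2 = r\<^sup>2}"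
proof -
  have "\<sigma> (e * (s - a)) = semicircle x r s" for s
    using assms(1) by (auto simp: assms(3))
  then have "semicircle x r s \<in> range \<sigma>" for s by (metis rangeI)
  moreover have "Im (semicircle x r s) > 0" for s using assms(2) cosh_real_pos[of s] by simp
  ultimately show ?thesis
    using circle_point[OF _ assms(2)] semicircle_norm assms(3) by (auto simp del: semicircle_simps) blast+
qed

text \<open>The centre, the radius and the direction can be read off the matrix.\<close>

lemma axis_unique:
  assumes "axis A L \<sigma>" "axis A L' \<tau>"
  obtains k where "\<And>t. \<tau> t = \<sigma> (t + k)"
proof -
  obtain x r e a where 1: "e \<in> {1, -1}" "0 < r" "\<And>t. \<sigma> t = semicircle x r (e * t + a)"
    "A$2$1 \<noteq> 0" "2 * real_of_int (A$2$1) * x = A$1$1 - A$2$2"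
    "4 * (real_of_int (A$2$1))\<^sup>2 * r\<^sup>2 = (real_of_int (trace2 A))\<^sup>2 - 4"
    "0 < e * real_of_int (A$2$1) * trace2 A"
    using axis_semicircle[OF assms(1)] by metis
  obtain x' r' e' a' where 2: "e' \<in> {1, -1}" "0 < r'" "\<And>t. \<tau> t = semicircle x' r' (e' * t + a')"
    "2 * real_of_int (A$2$1) * x' = A$1$1 - A$2$2"
    "4 * (real_of_int (A$2$1))\<^sup>2 * r'\<^sup>2 = (real_of_int (trace2 A))\<^sup>2 - 4"
    "0 < e' * real_of_int (A$2$1) * trace2 A"
    using axis_semicircle[OF assms(2)] by metis
  have "2 * real_of_int (A$2$1) * x = 2 * real_of_int (A$2$1) * x'" using 1(5) 2(4) by simp
  then have x: "x' = x" using 1(4) by simp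
  have "4 * (real_of_int (A$2$1))\<^sup>2 * r\<^sup>2 = 4 * (real_of_int (A$2$1))\<^sup>2 * r'\<^sup>2" using 1(6) 2(5) by simp
  then have "r\<^sup>2 = r'\<^sup>2" using 1(4) by simp
  then have r: "r' = r" using 1(2) 2(2) by simp
  define u where "u = real_of_int (A$2$1) * trace2 A"
  have "0 < e * u" "0 < e' * u" using 1(7) 2(6) by (simp_all only: u_def mult.assoc)
  then have e: "e' = e" using 1(1) 2(1) by auto
  have "e * (t + e * (a' - a)) + a = e * t + a'" for t using 1(1) by (auto simp: algebra_simps)
  then have "\<tau> t = \<sigma> (t + e * (a' - a))" for t by (simp add: 1(3) 2(3) x r e)
  then show thesis by (rule that)
qed

lemma axis_reverse:
  assumes "axis A L \<sigma>"
  shows "axis (adj A) L (\<lambda>t. \<sigma> (- t))"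
proof -
  have A: "det A = 1" "0 < L" "unit_speed_geodesic UNIV \<sigma>" and step: "\<And>t. \<sigma> (t + L) = mob A (\<sigma> t)"
    using assms by (auto simp: axis_def)
  have "0 < Im (\<sigma> t)" for t using A unit_speed_Im by blast
  then have "\<sigma> (- (t + L)) = mob (adj A) (\<sigma> (- t))" for t
    using step[of "- t - L"] mob_adj(1)[OF A(1)] by simp
  moreover have "unit_speed_geodesic UNIV (\<lambda>t. \<sigma> (- t))"
    using A(3) by (auto simp: unit_speed_geodesic_def abs_minus_commute)
  ultimately show ?thesis using A by (simp add: axis_def)
qed

lemma rational_square_int:
  assumes "q \<in> \<rat>" "(q :: real)\<^sup>2 = of_int n"
  obtains k :: int where "q = of_int k"
proof -
  obtain u v :: int where uv: "q = u / v" "v > 0" "coprime u v"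
    using assms(1) by (metis Rats_cases')
  have "real_of_int (u\<^sup>2) = real_of_int (n * v\<^sup>2)"
    using assms(2) uv by (simp add: power_divide field_simps)
  then have "u\<^sup>2 = n * v\<^sup>2" by linarith
  then have "v dvd u\<^sup>2" by (simp add: power2_eq_square)
  moreover have "coprime v (u\<^sup>2)" using uv(3) by (simp add: coprime_commute)
  ultimately have "is_unit v" by (metis coprime_self coprime_divisors dvd_refl)
  with uv(2) have "v = 1" by auto
  with uv(1) that show thesis by simp
qed

text \<open>Otherwise the discriminant would be a nonzero square, but no such square is four below another square.\<close>

lemma axis_ends_irrational:
  assumes tr: "4 * (real_of_int c)\<^sup>2 * r\<^sup>2 = (real_of_int t)\<^sup>2 - 4" and c: "c \<noteq> 0" and r: "0 < r"
    and x: "2 * real_of_int c * x = of_int m"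
  shows "x + r \<notin> \<rat>" "x - r \<notin> \<rat>"
proof -
  have "x = of_int m / (2 * of_int c)" using x c by (simp add: field_simps)
  then have xq: "x \<in> \<rat>" by simp
  have "r \<notin> \<rat>"
  proof
    assume "r \<in> \<rat>"
    then have "2 * of_int c * r \<in> \<rat>" by simp
    moreover have sq: "(2 * of_int c * r)\<^sup>2 = of_int (t\<^sup>2 - 4)"
      using tr by (simp add: power_mult_distrib)
    ultimately obtain k where k: "2 * of_int c * r = of_int k" by (rule rational_square_int)
    with sq have "real_of_int (k\<^sup>2) = of_int (t\<^sup>2 - 4)" by simp
    then have kt: "k\<^sup>2 = t\<^sup>2 - 4" by linarith
    have "k \<noteq> 0" using k c r by auto
    have eq: "(\<bar>t\<bar> - \<bar>k\<bar>) * (\<bar>t\<bar> + \<bar>k\<bar>) = 4" using kt by (simp add: algebra_simps power2_eq_square flip: abs_mult)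
    have "\<bar>k\<bar> \<ge> 1" using \<open>k \<noteq> 0\<close> by linarith
    have pos: "\<bar>t\<bar> - \<bar>k\<bar> > 0"
    proof (rule ccontr)
      assume "\<not> ?thesis"
      then have "(\<bar>t\<bar> - \<bar>k\<bar>) * (\<bar>t\<bar> + \<bar>k\<bar>) \<le> 0" by (intro mult_nonpos_nonneg) auto
      with eq show False by simp
    qed
    then obtain d where d: "\<bar>t\<bar> = \<bar>k\<bar> + d" "d \<ge> 1" by (metis add.commute diff_add_cancel int_one_le_iff_zero_less)
    with eq have "d * (2 * \<bar>k\<bar> + d) = 4" by (simp add: algebra_simps)
    moreover have "d = 1 \<or> d \<ge> 2" using d by linarith
    moreover have "d * (2 * \<bar>k\<bar> + d) \<ge> 2 * (2 * 1 + 2)" if "d \<ge> 2"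
      using that \<open>\<bar>k\<bar> \<ge> 1\<close> by (intro mult_mono) auto
    ultimately have "2 * \<bar>k\<bar> + 1 = 4" by auto
    then show False by presburger
  qed
  show "x + r \<notin> \<rat>"
  proof
    assume "x + r \<in> \<rat>"
    then have "x + r - x \<in> \<rat>" using xq by (rule Rats_diff)
    with \<open>r \<notin> \<rat>\<close> show False by simp
  qed
  show "x - r \<notin> \<rat>"
  proof
    assume "x - r \<in> \<rat>"
    with xq have "x - (x - r) \<in> \<rat>" by (rule Rats_diff)
    with \<open>r \<notin> \<rat>\<close> show False by simp
  qed
qed

section \<open>Lifts of simple closed geodesics\<close>

lemma orb_eq_iff:
  assumes "0 < Im z" "0 < Im w"
  shows "orb z = orb w \<longleftrightarrow> (\<exists>A\<in>torus_matrices. w = mob A z)"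
proof
  assume "orb z = orb w"
  moreover have "w \<in> orb w" using torus_matrices_one by (force simp: orb_eq)
  ultimately show "\<exists>A\<in>torus_matrices. w = mob A z" by (auto simp: orb_eq)
next
  assume "\<exists>A\<in>torus_matrices. w = mob A z"
  then obtain A where A: "A \<in> torus_matrices" "w = mob A z" by blast
  have 1: "mob B w = mob (B ** A) z" if "B \<in> torus_matrices" for B
    using that A assms by (simp add: mob_mult torus_matrices_det)
  have 2: "mob B z = mob (B ** adj A) w" if "B \<in> torus_matrices" for B
    using that A assms by (simp add: mob_mult mob_adj torus_matrices_det Im_mob_pos)
  show "orb z = orb w"
    unfolding orb_eq using 1 2 A(1) torus_matrices_mult torus_matrices_adj by blast
qed

lemma orb_mob: "A \<in> torus_matrices \<Longrightarrow> 0 < Im z \<Longrightarrow> orb (mob A z) = orb z"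
  using orb_eq_iff[of z "mob A z"] by (auto simp: Im_mob_pos torus_matrices_det)

text \<open>A fixed point makes the absolute value of the trace at most 2, and equality forces the lower left
  entry to vanish.\<close>

lemma torus_action_free:
  assumes A: "A \<in> torus_matrices" and z: "0 < Im z" and fix_z: "mob A z = z"
  shows "A = mat 1 \<or> A = - mat 1"
proof -
  have det: "det A = 1" using A by (rule torus_matrices_det)
  have nz: "of_int (A$2$1) * z + of_int (A$2$2) \<noteq> 0" using mob_denom_nonzero det z by blast
  have eq: "of_int (A$1$1) * z + of_int (A$1$2) = z * (of_int (A$2$1) * z + of_int (A$2$2))"
    using fix_z nz by (simp add: mob_eq field_simps)
  then have "Im (of_int (A$1$1) * z + of_int (A$1$2)) = Im (z * (of_int (A$2$1) * z + of_int (A$2$2)))"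
    by simp
  then have "Im z * A$1$1 = Im z * (2 * A$2$1 * Re z + A$2$2)" by (simp add: algebra_simps)
  with z have re: "real_of_int (A$1$1) = 2 * A$2$1 * Re z + A$2$2" by simp
  have "Re (of_int (A$1$1) * z + of_int (A$1$2)) = Re (z * (of_int (A$2$1) * z + of_int (A$2$2)))"
    using eq by simp
  then have b: "real_of_int (A$1$2) = - A$2$1 * ((Re z)\<^sup>2 + (Im z)\<^sup>2)"
    using re by (simp add: algebra_simps power2_eq_square)
  have "real_of_int (A$1$1 * A$2$2 - A$1$2 * A$2$1) = 1" using det by (simp add: det_2)
  then have d: "real_of_int (A$1$1) * A$2$2 - real_of_int (A$1$2) * A$2$1 = 1" by simp
  have t: "real_of_int (trace2 A) = 2 * (A$2$1 * Re z + A$2$2)"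
    using re by simp
  have "(A$2$1 * Re z + A$2$2)\<^sup>2 = 1 - (A$2$1 * Im z)\<^sup>2"
    using d unfolding b re by (simp add: algebra_simps power2_eq_square)
  then have "(real_of_int (trace2 A))\<^sup>2 = 4 - 4 * (A$2$1 * Im z)\<^sup>2"
    unfolding t power_mult_distrib by simp
  moreover have "(real_of_int (trace2 A))\<^sup>2 \<ge> 2\<^sup>2"
    using torus_matrices_trace[OF A] by (intro power2_le_iff_abs_le[THEN iffD2, of _ 2] abs_le_square_iff[THEN iffD1]) linarith
  ultimately have c: "A$2$1 = 0" using z by (auto simp: mult_le_0_iff)
  with b re have "A$1$2 = 0" "A$1$1 = A$2$2" by simp_all
  with c det show ?thesis by (auto simp: det_2 mat2_eq_iff zmult_eq_1_iff)
qed

definition simple_lift :: "int^2^2 \<Rightarrow> real \<Rightarrow> (real \<Rightarrow> complex) \<Rightarrow> bool" where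
  "simple_lift A L \<sigma> \<longleftrightarrow> A \<in> torus_matrices \<and> axis A L \<sigma> \<and> inj_on (orb \<circ> \<sigma>) {0..<L}"

lemma simple_closed_geodesic_lift:
  assumes "simple_closed_geodesic c L g"
  obtains \<sigma> A where "simple_lift A L \<sigma>" "c = orb \<circ> \<sigma>" "g = PSL_class A"
proof -
  from assms obtain \<sigma> A where *: "is_lift \<sigma> c" "A \<in> g" "\<forall>t. \<sigma> (t + L) = mob A (\<sigma> t)"
    "g \<in> carrier torus_group" "0 < L" "inj_on c {0..<L}"
    by (auto simp: simple_closed_geodesic_def closed_geodesic_def)
  then show thesis
    using that[of A \<sigma>] torus_class_cases[of g A]
    by (auto simp: is_lift_def simple_lift_def axis_def torus_matrices_det)
qed

lemma axis_Im: "axis A L \<sigma> \<Longrightarrow> 0 < Im (\<sigma> t)"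
  using unit_speed_Im by (auto simp: axis_def)

lemma simple_lift_mob:
  assumes "simple_lift A L \<sigma>" "M \<in> torus_matrices"
  shows "simple_lift (M ** A ** adj M) L (mob M \<circ> \<sigma>)" "orb \<circ> (mob M \<circ> \<sigma>) = orb \<circ> \<sigma>"
proof -
  have Im: "0 < Im (\<sigma> t)" for t using assms axis_Im by (auto simp: simple_lift_def)
  then show o: "orb \<circ> (mob M \<circ> \<sigma>) = orb \<circ> \<sigma>"
    using assms(2) by (auto simp: fun_eq_iff orb_mob)
  show "simple_lift (M ** A ** adj M) L (mob M \<circ> \<sigma>)"
    using assms axis_mob unfolding simple_lift_def o
    by (auto simp: torus_conj torus_matrices_det)
qed

lemma axis_int_power:
  assumes "A \<in> torus_matrices" "axis A L \<sigma>"
  shows "\<exists>B\<in>torus_matrices. \<forall>t. \<sigma> (t + of_int k * L) = mob B (\<sigma> t)"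
proof -
  have det: "det A = 1" and step: "\<And>t. \<sigma> (t + L) = mob A (\<sigma> t)" and Im: "\<And>t. 0 < Im (\<sigma> t)"
    using assms axis_Im by (auto simp: axis_def)
  have bwd: "\<sigma> (t - L) = mob (adj A) (\<sigma> t)" for t
    using step[of "t - L"] mob_adj(1)[OF det Im] by simp
  show ?thesis
  proof (induction k rule: int_induct[where k = 0])
    case base
    show ?case using torus_matrices_one by force
  next
    case (step1 i)
    then obtain B where B: "B \<in> torus_matrices" "\<And>t. \<sigma> (t + of_int i * L) = mob B (\<sigma> t)" by blast
    have "\<sigma> (t + of_int (i + 1) * L) = mob (A ** B) (\<sigma> t)" for t
      using step[of "t + of_int i * L"] B det Im
      by (simp add: mob_mult torus_matrices_det algebra_simps)
    then show ?case using B(1) assms(1) torus_matrices_mult by blast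
  next
    case (step2 i)
    then obtain B where B: "B \<in> torus_matrices" "\<And>t. \<sigma> (t + of_int i * L) = mob B (\<sigma> t)" by blast
    have "\<sigma> (t + of_int (i - 1) * L) = mob (adj A ** B) (\<sigma> t)" for t
      using bwd[of "t + of_int i * L"] B det Im
      by (simp add: mob_mult torus_matrices_det algebra_simps)
    then show ?case using B(1) assms(1) torus_matrices_mult torus_matrices_adj by blast
  qed
qed

lemma simple_lift_period:
  assumes \<sigma>: "simple_lift A L \<sigma>" and eq: "orb (\<sigma> s) = orb (\<sigma> t)"
  obtains k :: int where "t = s + of_int k * L"
proof -
  have L: "0 < L" and AX: "axis A L \<sigma>" "A \<in> torus_matrices" using \<sigma> by (auto simp: simple_lift_def axis_def)
  have per: "orb (\<sigma> (t + of_int k * L)) = orb (\<sigma> t)" for t k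
    using axis_int_power[OF AX(2,1), of k] axis_Im[OF AX(1)] by (auto simp: orb_mob)
  define i where "i = \<lfloor>s / L\<rfloor>"
  define j where "j = \<lfloor>t / L\<rfloor>"
  have range: "s - of_int i * L \<in> {0..<L}" "t - of_int j * L \<in> {0..<L}"
    using L floor_divide_lower[OF L] floor_divide_upper[OF L] by (auto simp: i_def j_def algebra_simps)
  have "orb (\<sigma> (s - of_int i * L)) = orb (\<sigma> (t - of_int j * L))"
    using per[of s "- i"] per[of t "- j"] eq by simp
  with range \<sigma> have "s - of_int i * L = t - of_int j * L"
    by (auto simp: simple_lift_def inj_on_def)
  then have "t = s + of_int (j - i) * L" by (simp add: algebra_simps)
  then show thesis by (rule that)
qed

text \<open>Since the curve is simple, the parameters of a common point differ by a multiple of the period. Then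
  \<open>M\<close> agrees at a point with a power of the holonomy, hence everywhere, as the action is free.\<close>

lemma simple_lift_meet:
  assumes \<sigma>: "simple_lift A L \<sigma>" and M: "M \<in> torus_matrices" and eq: "mob M (\<sigma> s) = \<sigma> t"
  obtains k :: int where "\<And>u. mob M (\<sigma> u) = \<sigma> (u + of_int k * L)"
proof -
  have AX: "axis A L \<sigma>" "A \<in> torus_matrices" using \<sigma> by (auto simp: simple_lift_def)
  note Im = axis_Im[OF AX(1)]
  have "orb (\<sigma> s) = orb (\<sigma> t)" using orb_mob[OF M Im[of s]] eq by simp
  then obtain k :: int where k: "t = s + of_int k * L" using simple_lift_period[OF \<sigma>] by blast
  obtain B where B: "B \<in> torus_matrices" "\<And>t. \<sigma> (t + of_int k * L) = mob B (\<sigma> t)"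
    using axis_int_power[OF AX(2,1)] by blast
  have "mob (adj B ** M) (\<sigma> s) = \<sigma> s"
    using eq M B Im by (simp add: k mob_mult mob_adj torus_matrices_det)
  then have "adj B ** M = mat 1 \<or> adj B ** M = - mat 1"
    using torus_action_free Im M B(1) torus_matrices_mult torus_matrices_adj by blast
  then have "mob (adj B ** M) (\<sigma> u) = \<sigma> u" for u by (auto simp: mob_uminus)
  then have "mob (adj B) (mob M (\<sigma> u)) = \<sigma> u" for u
    using M B Im by (simp add: mob_mult torus_matrices_det)
  then have "mob M (\<sigma> u) = mob B (\<sigma> u)" for u
    using M B Im by (metis mob_adj(2) Im_mob_pos torus_matrices_det)
  with B(2) that show thesis by metis
qed

text \<open>At every parameter one of countably many elements carries one lift to the other, so two parameters share
  such an element, and a geodesic is determined by two points.\<close>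

lemma lift_unique:
  assumes \<sigma>: "unit_speed_geodesic UNIV \<sigma>" and \<tau>: "unit_speed_geodesic UNIV \<tau>"
    and eq: "orb \<circ> \<sigma> = orb \<circ> \<tau>"
  obtains M where "M \<in> torus_matrices" "\<tau> = mob M \<circ> \<sigma>"
proof -
  have "\<exists>A\<in>torus_matrices. \<tau> t = mob A (\<sigma> t)" for t
    using orb_eq_iff[of "\<sigma> t" "\<tau> t"] unit_speed_Im[OF \<sigma>] unit_speed_Im[OF \<tau>] eq
    by (auto simp: fun_eq_iff)
  then obtain F where F: "\<And>t. F t \<in> torus_matrices" "\<And>t. \<tau> t = mob (F t) (\<sigma> t)" by metis
  define code where "code A = (A$1$1, A$1$2, A$2$1, A$2$2)" for A :: "int^2^2"
  have "\<not> inj (code \<circ> F)"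
  proof
    assume "inj (code \<circ> F)"
    then have "countable (UNIV :: real set)" using countableI' by blast
    then show False using uncountable_UNIV_real by blast
  qed
  then obtain s t where st: "s \<noteq> t" "code (F s) = code (F t)" by (auto simp: inj_def)
  then have "F s = F t" by (simp add: code_def mat2_eq_iff)
  with F st(1) have "\<tau> = mob (F s) \<circ> \<sigma>"
    by (intro unit_speed_agree[OF \<tau> unit_speed_mob[OF _ \<sigma>], of _ s t]) (auto simp: torus_matrices_det)
  with F(1) that show thesis by blast
qed


section \<open>Half-circles with given end points\<close>

text \<open>By Thales' theorem this is the half-circle over the segment between \<open>p\<close> and \<open>q\<close>. The ends may
  come in either order, so that the action of matrices needs no case distinction.\<close>

definition geo :: "real \<Rightarrow> real \<Rightarrow> complex set" where
  "geo p q = {z. 0 < Im z \<and> (Re z - p) * (Re z - q) + (Im z)\<^sup>2 = 0}"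

text \<open>The action on the boundary. At the pole, where \<open>rden\<close> vanishes, the value is the default 0, so
  the pole is excluded wherever this is used.\<close>

definition rmob :: "int^2^2 \<Rightarrow> real \<Rightarrow> real" where
  "rmob A x = (of_int (A$1$1) * x + of_int (A$1$2)) / (of_int (A$2$1) * x + of_int (A$2$2))"

lemma geo_commute: "geo p q = geo q p"
  by (simp add: geo_def mult.commute)

lemma geo_center: "0 < r \<Longrightarrow> geo (x - r) (x + r) = {z. 0 < Im z \<and> (Re z - x)\<^sup>2 + (Im z)\<^sup>2 = r\<^sup>2}"
  by (auto simp: geo_def power2_eq_square algebra_simps)

lemma geo_inj:
  assumes "p < q" "p' < q'" "geo p q = geo p' q'"
  shows "p = p'" "q = q'"
proof -
  define h where "h = (q - p) / 2"
  define m where "m = (p + q) / 2"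
  have pq: "p = m - h" "q = m + h" "0 < h" using assms by (auto simp: m_def h_def field_simps)
  have "Complex m h \<in> geo p q" "Complex (m + h * 3 / 5) (h * 4 / 5) \<in> geo p q"
    using pq by (auto simp: geo_def field_simps power2_eq_square)
  then have "(m - p') * (m - q') + h\<^sup>2 = 0" "(m + h * 3 / 5 - p') * (m + h * 3 / 5 - q') + (h * 4 / 5)\<^sup>2 = 0"
    unfolding assms(3) by (auto simp: geo_def)
  then have 1: "m\<^sup>2 - m * (p' + q') + p' * q' + h\<^sup>2 = 0" and "h * (2 * m - (p' + q')) = 0"
    by (simp_all add: algebra_simps power2_eq_square)
  with pq(3) have 2: "2 * m = p' + q'" by simp
  have "((q' - p') / 2)\<^sup>2 = ((p' + q') / 2)\<^sup>2 - p' * q'"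
    by (simp add: power2_eq_square field_simps)
  also have "\<dots> = h\<^sup>2" using 1 unfolding 2[symmetric] by (simp add: power2_eq_square)
  finally have "(q' - p') / 2 = h" using assms(2) pq(3) by (simp add: power2_eq_iff_nonneg)
  with 2 pq show "p = p'" "q = q'" by auto
qed

abbreviation rden :: "int^2^2 \<Rightarrow> real \<Rightarrow> real" where
  "rden A x \<equiv> of_int (A$2$1) * x + of_int (A$2$2)"

lemma geo_mob:
  assumes det: "det A = 1" and p: "rden A p \<noteq> 0" and q: "rden A q \<noteq> 0"
  shows "mob A ` geo p q = geo (rmob A p) (rmob A q)"
proof -
  have sub: "mob B z \<in> geo (rmob B p) (rmob B q)"
    if B: "det B = 1" "rden B p \<noteq> 0" "rden B q \<noteq> 0" and z: "z \<in> geo p q"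
    for B :: "int^2^2" and z and p q :: real
  proof -
    have Im: "0 < Im z" using z by (simp add: geo_def)
    define w where "w = of_int (B$2$1) * z + of_int (B$2$2)"
    have w: "w \<noteq> 0" using mob_denom_nonzero B Im by (auto simp: w_def)
    have "of_int (B$1$1 * B$2$2 - B$1$2 * B$2$1) = (1 :: complex)" using B by (simp add: det_2)
    then have d: "of_int (B$1$1) * of_int (B$2$2) - of_int (B$1$2) * of_int (B$2$1) = (1 :: complex)" by simp
    have diff: "mob B z - of_real (rmob B y) = (z - of_real y) / (w * of_real (rden B y))"
      if y: "rden B y \<noteq> 0" for y :: real
    proof -
      define e where "e = (of_real (rden B y) :: complex)"
      have e: "e \<noteq> 0" using y unfolding e_def by (metis of_real_eq_0_iff)
      have "mob B z = (of_int (B$1$1) * z + of_int (B$1$2)) / w" by (simp add: mob_eq w_def)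
      moreover have "of_real (rmob B y) = (of_int (B$1$1) * of_real y + of_int (B$1$2)) / e"
        by (simp add: rmob_def e_def)
      ultimately have "mob B z - of_real (rmob B y) = ((of_int (B$1$1) * z + of_int (B$1$2)) * e
         - (of_int (B$1$1) * of_real y + of_int (B$1$2)) * w) / (w * e)"
        using diff_frac_eq[OF w e] by simp
      also have "(of_int (B$1$1) * z + of_int (B$1$2)) * e
         - (of_int (B$1$1) * of_real y + of_int (B$1$2)) * w
         = (of_int (B$1$1) * of_int (B$2$2) - of_int (B$1$2) * of_int (B$2$1)) * (z - of_real y)"
        by (simp add: w_def e_def algebra_simps)
      finally show ?thesis using d by (simp add: e_def)
    qed
    have form: "(Re u - y) * (Re u - y') + (Im u)\<^sup>2 = Re ((u - of_real y) * cnj (u - of_real y'))" for u y y'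
      by (simp add: power2_eq_square algebra_simps)
    have quot: "Re ((u / (w * of_real a)) * cnj (v / (w * of_real b))) = Re (u * cnj v) / ((cmod w)\<^sup>2 * (a * b))"
      for u v and a b :: real
    proof -
      have "(u / (w * of_real a)) * cnj (v / (w * of_real b)) = (u * cnj v) / of_real ((cmod w)\<^sup>2 * (a * b))"
        by (simp add: complex_norm_square mult_ac del: of_real_power)
      then show ?thesis by (simp only: Re_divide_of_real)
    qed
    have "Re ((z - of_real p) * cnj (z - of_real q)) = 0"
      using z unfolding form[symmetric] by (simp add: geo_def)
    then have "Re ((mob B z - of_real (rmob B p)) * cnj (mob B z - of_real (rmob B q))) = 0"
      unfolding diff[OF B(2)] diff[OF B(3)] quot by simp
    then show ?thesis
      unfolding geo_def mem_Collect_eq form using Im_mob_pos[OF B(1) Im] by simp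
  qed
  have det': "real_of_int (A$1$1) * A$2$2 - real_of_int (A$1$2) * A$2$1 = 1"
  proof -
    have "real_of_int (A$1$1 * A$2$2 - A$1$2 * A$2$1) = 1" using det by (simp add: det_2)
    then show ?thesis by simp
  qed
  have bwd: "rden (adj A) (rmob A y) \<noteq> 0" "rmob (adj A) (rmob A y) = y"
    if y: "rden A y \<noteq> 0" for y
  proof -
    have 1: "rden (adj A) (rmob A y) = 1 / (rden A y)"
      using y det' by (simp add: rmob_def field_simps)
    then show "rden (adj A) (rmob A y) \<noteq> 0" using y by simp
    have "of_int (adj A $1$1) * rmob A y + of_int (adj A $1$2) = (real_of_int (A$1$1) * A$2$2 - real_of_int (A$1$2) * A$2$1) * y / (rden A y)"
      using y by (simp add: rmob_def field_simps)
    also have "\<dots> = y / (rden A y)" using det' by simp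
    finally show "rmob (adj A) (rmob A y) = y"
      using 1 y unfolding rmob_def[of "adj A"] by simp
  qed
  show ?thesis
  proof
    show "mob A ` geo p q \<subseteq> geo (rmob A p) (rmob A q)" using sub[OF det p q] by blast
    show "geo (rmob A p) (rmob A q) \<subseteq> mob A ` geo p q"
    proof
      fix z assume z: "z \<in> geo (rmob A p) (rmob A q)"
      then have "mob (adj A) z \<in> geo p q"
        using sub[of "adj A" "rmob A p" "rmob A q" z] bwd[OF p] bwd[OF q] det by simp
      moreover have "mob A (mob (adj A) z) = z" using z det by (simp add: mob_adj geo_def)
      ultimately show "z \<in> mob A ` geo p q" by force
    qed
  qed
qed

lemma geo_cross:
  assumes "p < p'" "p' < q" "q < q'"
  shows "geo p q \<inter> geo p' q' \<noteq> {}"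
proof -
  define d where "d = p' + q' - p - q"
  have d: "0 < d" using assms by (simp add: d_def)
  define x where "x = (p' * q' - p * q) / d"
  have xd: "x * d = p' * q' - p * q" using d by (simp add: x_def)
  have "(x - p) * d = (p' - p) * (q' - p)" "(q - x) * d = (q - p') * (q' - q)"
    unfolding left_diff_distrib xd by (simp_all add: d_def algebra_simps)
  moreover have "0 < (p' - p) * (q' - p)" "0 < (q - p') * (q' - q)"
    using assms by simp_all
  ultimately have "0 < (x - p) * d" "0 < (q - x) * d" by simp_all
  then have x: "p < x" "x < q"
    using d by (simp_all add: zero_less_mult_iff)
  then have pos: "0 < (x - p) * (q - x)" by simp
  have "(x - p) * (x - q) = (x - p') * (x - q')"
    using xd by (simp add: d_def algebra_simps)
  then have "Complex x (sqrt ((x - p) * (q - x))) \<in> geo p q \<inter> geo p' q'"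
    using pos by (simp add: geo_def algebra_simps)
  then show ?thesis by blast
qed

text \<open>An arc records a lift by its end points; noncrossing lifts become nested or disjoint intervals.\<close>

definition arcs :: "(real \<Rightarrow> complex) \<Rightarrow> (real \<times> real) set" where
  "arcs \<sigma> = {(p, q). p < q \<and> (\<exists>M\<in>torus_matrices. range (mob M \<circ> \<sigma>) = geo p q)}"

text \<open>Half-circles with interlaced ends meet, and translates of the axis that meet coincide.\<close>

lemma arcs_noncrossing:
  assumes \<sigma>: "simple_lift A L \<sigma>" and "(p, q) \<in> arcs \<sigma>" "(p', q') \<in> arcs \<sigma>"
    and x: "p < x" "x < q" "p' < x" "x < q'"
  shows "p \<le> p' \<and> q' \<le> q \<or> p' \<le> p \<and> q \<le> q'"
proof (rule ccontr)
  have Im: "0 < Im (\<sigma> t)" for t using \<sigma> axis_Im by (auto simp: simple_lift_def)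
  assume not: "\<not> ?thesis"
  then consider "p < p'" "q < q'" | "p' < p" "q' < q" by force
  then have "geo p q \<inter> geo p' q' \<noteq> {}"
    using geo_cross[of p p' q q'] geo_cross[of p' p q' q] x by cases auto
  moreover obtain M M' where M: "M \<in> torus_matrices" "range (mob M \<circ> \<sigma>) = geo p q"
    "M' \<in> torus_matrices" "range (mob M' \<circ> \<sigma>) = geo p' q'"
    using assms by (auto simp: arcs_def)
  ultimately obtain z where "z \<in> range (mob M \<circ> \<sigma>)" "z \<in> range (mob M' \<circ> \<sigma>)" by blast
  then obtain s t where st: "mob M (\<sigma> s) = mob M' (\<sigma> t)" by (metis comp_apply rangeE)
  have "adj M' ** M \<in> torus_matrices"
    using M by (intro torus_matrices_mult torus_matrices_adj)
  moreover have "mob (adj M' ** M) (\<sigma> s) = \<sigma> t"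
    using M Im by (simp add: mob_mult torus_matrices_det mob_adj st)
  ultimately obtain k :: int where k: "\<And>u. mob (adj M' ** M) (\<sigma> u) = \<sigma> (u + of_int k * L)"
    using simple_lift_meet[OF \<sigma>] by blast
  have "mob M (\<sigma> u) = mob M' (\<sigma> (u + of_int k * L))" for u
    using k[of u] M Im by (metis mob_mult torus_matrices_det det_adj mob_adj(2) Im_mob_pos)
  then have eq: "mob M \<circ> \<sigma> = (mob M' \<circ> \<sigma>) \<circ> (\<lambda>u. u + of_int k * L)" by auto
  have "range (mob M \<circ> \<sigma>) = (mob M' \<circ> \<sigma>) ` range (\<lambda>u. u + of_int k * L)"
    unfolding eq by (simp only: image_comp)
  also have "range (\<lambda>u. u + of_int k * L) = UNIV"
    by (rule surjI[of _ "\<lambda>u. u - of_int k * L"]) simp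
  finally have "range (mob M \<circ> \<sigma>) = range (mob M' \<circ> \<sigma>)" .
  then have "geo p q = geo p' q'" using M by simp
  with geo_inj[of p q p' q'] assms not show False by (auto simp: arcs_def)
qed

lemma arcs_torus:
  assumes "(p, q) \<in> arcs \<sigma>" "M \<in> torus_matrices" "rden M p \<noteq> 0" "rden M q \<noteq> 0" "rmob M p < rmob M q"
    and Im: "\<And>t. 0 < Im (\<sigma> t)"
  shows "(rmob M p, rmob M q) \<in> arcs \<sigma>"
proof -
  obtain N where N: "N \<in> torus_matrices" "range (mob N \<circ> \<sigma>) = geo p q" using assms by (auto simp: arcs_def)
  have "range (mob (M ** N) \<circ> \<sigma>) = mob M ` range (mob N \<circ> \<sigma>)"
  proof -
    have "mob (M ** N) \<circ> \<sigma> = mob M \<circ> (mob N \<circ> \<sigma>)"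
      using N assms(2) Im by (simp add: fun_eq_iff mob_mult torus_matrices_det)
    then show ?thesis by (simp only: image_comp)
  qed
  also have "\<dots> = geo (rmob M p) (rmob M q)"
    unfolding N(2) using assms by (intro geo_mob) (auto simp: torus_matrices_det)
  finally show ?thesis
    using assms N torus_matrices_mult unfolding arcs_def by blast
qed

text \<open>The points of the orbit keep a constant distance from points of the axis that run into the end
  towards which the axis is traversed; near the boundary this means a small euclidean distance.\<close>

lemma orbit_converges:
  assumes \<sigma>: "axis A L \<sigma>" and semi: "e \<in> {1, -1}" "0 < r" "\<And>t. \<sigma> t = semicircle x r (e * t + a)"
    and z: "0 < Im z"
  shows "(\<lambda>k. (mob A ^^ k) z) \<longlonglongrightarrow> of_real (x + e * r)"
proof -
  have det: "det A = 1" and L: "0 < L" and step: "\<And>t. \<sigma> (t + L) = mob A (\<sigma> t)"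
    using \<sigma> by (auto simp: axis_def)
  note Im_s = axis_Im[OF \<sigma>]
  define D where "D = cdist z (\<sigma> 0)"
  have D1: "1 \<le> D" using cdist_ge_1 z Im_s by (simp add: D_def)
  have Imk: "0 < Im ((mob A ^^ k) z)" for k
    by (induction k) (simp_all add: z Im_mob_pos det)
  have sk: "\<sigma> (real k * L) = (mob A ^^ k) (\<sigma> 0)" for k
  proof (induction k)
    case (Suc k)
    then show ?case using step[of "real k * L"] by (simp add: algebra_simps)
  qed simp
  have Dk: "cdist ((mob A ^^ k) z) (\<sigma> (real k * L)) = D" for k
  proof (induction k)
    case (Suc k)
    have "cdist (mob A ((mob A ^^ k) z)) (mob A (\<sigma> (real k * L))) = D"
      using cdist_mob[OF det Imk Im_s] Suc by simp
    moreover have "mob A (\<sigma> (real k * L)) = \<sigma> (real (Suc k) * L)"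
      using step[of "real k * L"] by (simp add: algebra_simps)
    ultimately show ?case by simp
  qed (simp add: D_def)
  have bound: "cmod ((mob A ^^ k) z - \<sigma> (real k * L)) \<le> 2 * D * Im (\<sigma> (real k * L))" for k
  proof -
    define u where "u = (mob A ^^ k) z"
    define w where "w = \<sigma> (real k * L)"
    have pos: "0 < Im u" "0 < Im w" using Imk Im_s by (auto simp: u_def w_def)
    have n: "(Re u - Re w)\<^sup>2 + (Im u - Im w)\<^sup>2 = (D - 1) * (2 * Im u * Im w)"
    proof -
      have "((Re u - Re w)\<^sup>2 + (Im u - Im w)\<^sup>2) / (2 * Im u * Im w) = D - 1"
        using Dk[of k] by (simp add: cdist_def flip: u_def w_def)
      moreover have "2 * Im u * Im w \<noteq> 0" using pos by simp
      ultimately show ?thesis using nonzero_divide_eq_eq by blast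
    qed
    have "(Im u - Im w)\<^sup>2 \<le> (D - 1) * (2 * Im u * Im w)"
      using n zero_le_power2[of "Re u - Re w"] by linarith
    then have "(Im u)\<^sup>2 + (Im w)\<^sup>2 \<le> D * (2 * Im u * Im w)" by (simp add: power2_eq_square algebra_simps)
    then have "(Im u)\<^sup>2 \<le> D * (2 * Im u * Im w)" by (smt (verit) zero_le_power2)
    then have "Im u * Im u \<le> Im u * (2 * D * Im w)" by (simp add: power2_eq_square mult_ac)
    then have Iu: "Im u \<le> 2 * D * Im w" using pos by simp
    have "(cmod (u - w))\<^sup>2 = (D - 1) * (2 * Im u * Im w)" using n by (simp add: cmod_power2)
    also have "\<dots> \<le> D * (2 * (2 * D * Im w) * Im w)"
      using Iu pos D1 by (intro mult_mono) auto
    also have "\<dots> = (2 * D * Im w)\<^sup>2" by (simp add: power2_eq_square)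
    finally show ?thesis
      using pos D1 unfolding u_def w_def by (simp add: power2_le_iff_abs_le)
  qed
  have arg: "filterlim (\<lambda>k. real k * L) at_top sequentially"
    using filterlim_real_sequentially L filterlim_tendsto_pos_mult_at_top[OF tendsto_const L]
    by (subst mult.commute) blast
  have cosh: "filterlim (\<lambda>k. cosh (e * (real k * L) + a)) at_top sequentially"
  proof -
    have "filterlim (\<lambda>k. real k * L + e * a) at_top sequentially"
      using filterlim_tendsto_add_at_top[OF tendsto_const arg, of "e * a"] by (simp add: add.commute)
    then have "filterlim (\<lambda>k. cosh (real k * L + e * a)) at_top sequentially"
      by (rule filterlim_compose[OF cosh_real_at_top])
    moreover have "cosh (e * (real k * L) + a) = cosh (real k * L + e * a)" for k
      using semi(1) cosh_minus[of "real k * L - a"] by (auto simp del: cosh_real_eq_iff)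
    ultimately show ?thesis by (simp only:)
  qed
  have tanh: "(\<lambda>k. tanh (e * (real k * L) + a)) \<longlonglongrightarrow> e"
  proof -
    have "filterlim (\<lambda>k. real k * L + e * a) at_top sequentially"
      using filterlim_tendsto_add_at_top[OF tendsto_const arg, of "e * a"] by (simp add: add.commute)
    then have "(\<lambda>k. e * tanh (real k * L + e * a)) \<longlonglongrightarrow> e * 1"
      by (intro tendsto_mult tendsto_const filterlim_compose[OF tanh_real_at_top])
    moreover have "tanh (e * (real k * L) + a) = e * tanh (real k * L + e * a)" for k
      using semi(1) tanh_minus[of "real k * L - a"] by auto
    ultimately show ?thesis by simp
  qed
  have "(\<lambda>k. Im (\<sigma> (real k * L))) \<longlonglongrightarrow> 0"
    unfolding semi(3) semicircle_simps using cosh by (rule real_tendsto_divide_at_top[OF tendsto_const])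
  then have Im0: "(\<lambda>k. Im (\<sigma> (real k * L))) \<longlonglongrightarrow> 0" .
  have "(\<lambda>k. 2 * D * Im (\<sigma> (real k * L))) \<longlonglongrightarrow> 2 * D * 0" by (intro tendsto_mult tendsto_const Im0)
  then have g0: "(\<lambda>k. 2 * D * Im (\<sigma> (real k * L))) \<longlonglongrightarrow> 0" by simp
  have "(\<lambda>k. (mob A ^^ k) z - \<sigma> (real k * L)) \<longlonglongrightarrow> 0"
    by (rule Lim_null_comparison[OF always_eventually[OF allI[OF bound]] g0])
  moreover have "(\<lambda>k. \<sigma> (real k * L)) \<longlonglongrightarrow> of_real (x + e * r)"
  proof (rule tendsto_complex_iff[THEN iffD2], intro conjI)
    have "(\<lambda>k. x + r * tanh (e * (real k * L) + a)) \<longlonglongrightarrow> x + r * e"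
      by (intro tendsto_add tendsto_mult tendsto_const tanh)
    then show "(\<lambda>k. Re (\<sigma> (real k * L))) \<longlonglongrightarrow> Re (of_real (x + e * r))"
      unfolding semi(3) by (simp add: mult.commute)
    show "(\<lambda>k. Im (\<sigma> (real k * L))) \<longlonglongrightarrow> Im (of_real (x + e * r))" using Im0 by simp
  qed
  ultimately show ?thesis using tendsto_add by fastforce
qed

section \<open>Markov bases\<close>

lemma shift_6: "shift 6 \<in> torus_matrices"
proof -
  have "shift 6 = - (alpha_mat ** (beta_mat ** (adj alpha_mat ** adj beta_mat)))"
    by (simp add: mat2_eq_iff)
  then show ?thesis
    by (simp only: torus_matrices_eq) (intro ab_words.minus ab_words_mult ab_words_gens)
qed

text \<open>The torus has an orientation preserving involution, and these are its lifts. With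
  \<open>torus_matrices\<close> they form the group of the quotient orbifold, in which they are the products of
  an odd number of half-turns.\<close>

definition odd_matrices :: "(int^2^2) set" where
  "odd_matrices = {M. det M = 1 \<and> shift 3 ** M \<in> torus_matrices}"

lemma odd_det: "M \<in> odd_matrices \<Longrightarrow> det M = 1"
  by (simp add: odd_matrices_def)

lemma odd_uminus [simp]: "- M \<in> odd_matrices \<longleftrightarrow> M \<in> odd_matrices"
  by (simp add: odd_matrices_def)

lemma torus_shift_conj: "A \<in> torus_matrices \<Longrightarrow> shift k ** A ** shift (- k) \<in> torus_matrices"
  using torus_conj[of A "shift k"] by simp

lemma odd_mult_even: "M \<in> odd_matrices \<Longrightarrow> A \<in> torus_matrices \<Longrightarrow> M ** A \<in> odd_matrices"
  using torus_matrices_mult by (auto simp: odd_matrices_def det_mul torus_matrices_det matrix_mul_assoc)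

lemma even_mult_odd:
  assumes "A \<in> torus_matrices" "M \<in> odd_matrices"
  shows "A ** M \<in> odd_matrices"
proof -
  have "shift 3 ** (A ** M) = (shift 3 ** A ** shift (- 3)) ** (shift 3 ** M)"
    by (simp add: shift_assoc flip: matrix_mul_assoc)
  then show ?thesis
    using assms torus_shift_conj[of A 3] torus_matrices_mult
    by (auto simp: odd_matrices_def det_mul torus_matrices_det)
qed

lemma odd_mult_odd:
  assumes "M \<in> odd_matrices" "N \<in> odd_matrices"
  shows "M ** N \<in> torus_matrices"
proof -
  have "M ** N = (shift (- 3) ** (shift 3 ** M) ** shift 3) ** adj (shift 6) ** (shift 3 ** N)"
    by (simp add: shift_assoc flip: matrix_mul_assoc)
  then show ?thesis
    using assms torus_shift_conj[of "shift 3 ** M" "- 3"] torus_matrices_mult torus_matrices_adj[OF shift_6]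
    by (auto simp: odd_matrices_def)
qed

lemma odd_adj:
  assumes "M \<in> odd_matrices"
  shows "adj M \<in> odd_matrices"
proof -
  have "shift 3 ** adj M = (shift 3 ** adj (shift 3 ** M) ** shift (- 3)) ** shift 6"
    by (simp add: shift_mult adj_mult flip: matrix_mul_assoc)
  then show ?thesis
    using assms torus_shift_conj[of "adj (shift 3 ** M)" 3] torus_matrices_mult torus_matrices_adj shift_6
    by (auto simp: odd_matrices_def)
qed

lemma shift_3_odd: "shift 3 \<in> odd_matrices" "shift (- 3) \<in> odd_matrices"
  using shift_6 torus_matrices_one by (simp_all add: odd_matrices_def shift_mult)

datatype letter = La | Lb | Lc

fun letter_mat :: "int^2^2 \<Rightarrow> int^2^2 \<Rightarrow> int^2^2 \<Rightarrow> letter \<Rightarrow> int^2^2" where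
  "letter_mat A B C La = A"
| "letter_mat A B C Lb = B"
| "letter_mat A B C Lc = C"

primrec wmat :: "(letter \<Rightarrow> int^2^2) \<Rightarrow> letter list \<Rightarrow> int^2^2" where
  "wmat E [] = mat 1"
| "wmat E (l # w) = E l ** wmat E w"

lemma wmat_append: "wmat E (u @ v) = wmat E u ** wmat E v"
  by (induction u) (simp_all add: matrix_mul_assoc)

text \<open>Trace 0 makes it a rotation by a half-turn; of the two signs of the matrix one is selected.\<close>

definition half_turn :: "int^2^2 \<Rightarrow> bool" where
  "half_turn A \<longleftrightarrow> det A = 1 \<and> A$2$2 = - A$1$1 \<and> 0 < A$2$1"

text \<open>Half-turns about points of the three vertical lines that follow each other in the ideal
  triangulation, from left to right. The relation says that the triangles around the cusp
  at infinity close up after the translation by 3.\<close>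

definition markov_basis :: "int^2^2 \<Rightarrow> int^2^2 \<Rightarrow> int^2^2 \<Rightarrow> bool" where
  "markov_basis A B C \<longleftrightarrow> half_turn A \<and> half_turn B \<and> half_turn C \<and> C ** B ** A = shift 3 \<and>
     A ** B \<in> torus_matrices \<and> C ** B \<in> torus_matrices \<and>
     (\<forall>M\<in>torus_matrices. \<exists>w. even (length w) \<and>
        (M = wmat (letter_mat A B C) w \<or> M = - wmat (letter_mat A B C) w))"

lemma half_turn_adj: "half_turn A \<Longrightarrow> adj A = - A"
  by (auto simp: half_turn_def mat2_eq_iff)

lemma half_turn_square: "half_turn A \<Longrightarrow> A ** A = - mat 1"
  using mult_adj(1)[of A] half_turn_adj[of A] by (auto simp: half_turn_def minus_equation_iff)

lemma half_turn_cancel: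
  fixes A B :: "int^2^2"
  assumes "half_turn A"
  shows "A ** (A ** B) = - B"
proof -
  have "A ** (A ** B) = (A ** A) ** B" by (simp add: matrix_mul_assoc)
  also have "\<dots> = - B" unfolding half_turn_square[OF assms] by simp
  finally show ?thesis .
qed

lemma half_turn_det: "half_turn A \<Longrightarrow> det A = 1"
  by (simp add: half_turn_def)

lemma half_turn_conj:
  assumes A: "half_turn A" and B: "half_turn B"
  shows "half_turn (- (B ** A ** B))"
proof -
  have "det (- (B ** A ** B)) = 1" using A B by (simp add: half_turn_def det_mul)
  moreover have "(- (B ** A ** B))$2$2 = - (- (B ** A ** B))$1$1"
    using A B by (simp add: half_turn_def algebra_simps)
  moreover have "0 < (- (B ** A ** B))$2$1"
  proof -
    let ?k = "A$2$1"
    have det: "A$1$1 * A$1$1 + A$1$2 * ?k = - 1"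
    proof -
      have "A$1$1 * A$2$2 - A$1$2 * ?k = 1" "A$2$2 = - A$1$1"
        using A unfolding half_turn_def det_2 by blast+
      then show ?thesis by simp
    qed
    have "?k * (- (B ** A ** B))$2$1
      = (?k * B$1$1 - B$2$1 * A$1$1)\<^sup>2 - (A$1$1 * A$1$1 + A$1$2 * ?k) * (B$2$1)\<^sup>2"
      using A B by (simp add: half_turn_def power2_eq_square algebra_simps)
    also have "\<dots> > 0" unfolding det using B by (simp add: half_turn_def add_nonneg_pos)
    finally show ?thesis using A by (simp add: half_turn_def zero_less_mult_iff)
  qed
  ultimately show ?thesis by (simp add: half_turn_def)
qed

text \<open>A change of generators in which each old one is an odd word in the new ones keeps the parity of words.\<close>

lemma wmat_subst:
  assumes "\<And>l. odd (length (f l)) \<and> (E l = wmat E' (f l) \<or> E l = - wmat E' (f l))"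
  shows "\<exists>w'. (even (length w') \<longleftrightarrow> even (length w)) \<and> (wmat E w = wmat E' w' \<or> wmat E w = - wmat E' w')"
proof (induction w)
  case Nil
  then show ?case by (intro exI[of _ "[]"]) simp
next
  case (Cons l w)
  then obtain w' where w': "even (length w') \<longleftrightarrow> even (length w)" "wmat E w = wmat E' w' \<or> wmat E w = - wmat E' w'"
    by blast
  then show ?case
    using assms[of l] by (intro exI[of _ "f l @ w'"]) (auto simp: wmat_append)
qed

lemma markov_basis_base: "markov_basis (mk (- 1) (- 2) 1 1) (mk 0 (- 1) 1 0) (mk 1 (- 2) 1 (- 1))"
proof -
  let ?A = "mk (- 1) (- 2) 1 1" and ?B = "mk 0 (- 1) 1 0" and ?C = "mk 1 (- 2) 1 (- 1)"
  let ?E = "letter_mat ?A ?B ?C"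
  have eqs: "?C ** ?B = - alpha_mat" "?B ** ?C = - adj alpha_mat" "?A ** ?B = - beta_mat" "?B ** ?A = - adj beta_mat"
    by (simp_all add: mat2_eq_iff)
  have "\<exists>w. even (length w) \<and> (M = wmat ?E w \<or> M = - wmat ?E w)" if "M \<in> ab_words" for M
    using that
  proof (induction rule: ab_words.induct)
    case one
    show ?case by (intro exI[of _ "[]"]) simp
  next
    case (alpha M)
    then obtain w where "even (length w)" "M = wmat ?E w \<or> M = - wmat ?E w" by blast
    then show ?case by (intro exI[of _ "Lc # Lb # w"]) (auto simp: matrix_mul_assoc eqs)
  next
    case (alpha' M)
    then obtain w where "even (length w)" "M = wmat ?E w \<or> M = - wmat ?E w" by blast
    then show ?case by (intro exI[of _ "Lb # Lc # w"]) (auto simp: matrix_mul_assoc eqs)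
  next
    case (beta M)
    then obtain w where "even (length w)" "M = wmat ?E w \<or> M = - wmat ?E w" by blast
    then show ?case by (intro exI[of _ "La # Lb # w"]) (auto simp: matrix_mul_assoc eqs)
  next
    case (beta' M)
    then obtain w where "even (length w)" "M = wmat ?E w \<or> M = - wmat ?E w" by blast
    then show ?case by (intro exI[of _ "Lb # La # w"]) (auto simp: matrix_mul_assoc eqs)
  next
    case (minus M)
    then obtain w where "even (length w)" "M = wmat ?E w \<or> M = - wmat ?E w" by blast
    then show ?case by (intro exI[of _ w]) auto
  qed
  moreover have "half_turn ?A" "half_turn ?B" "half_turn ?C" by (simp_all add: half_turn_def det_2)
  moreover have "?C ** ?B ** ?A = shift 3" by (simp add: mat2_eq_iff)
  moreover have "?A ** ?B \<in> torus_matrices" "?C ** ?B \<in> torus_matrices"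
    unfolding eqs torus_matrices_eq by (intro ab_words.minus ab_words_gens)+
  ultimately show ?thesis unfolding markov_basis_def torus_matrices_eq by blast
qed

lemma markov_basis_half_turns:
  "markov_basis A B C \<Longrightarrow> half_turn A" "markov_basis A B C \<Longrightarrow> half_turn B" "markov_basis A B C \<Longrightarrow> half_turn C"
  by (simp_all add: markov_basis_def)

lemma markov_basis_new_mats:
  assumes "markov_basis A B C"
  shows "B ** shift 3 ** A = - (B ** C ** B)" "C ** shift 3 ** B = - (B ** A ** B)"
proof -
  note ht = markov_basis_half_turns[OF assms]
  have T: "shift 3 = C ** (B ** A)" using assms by (simp add: markov_basis_def matrix_mul_assoc)
  have "B ** shift 3 ** A = B ** (C ** (B ** (A ** A)))" unfolding T by (simp flip: matrix_mul_assoc)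
  then show "B ** shift 3 ** A = - (B ** C ** B)"
    unfolding half_turn_square[OF ht(1)] by (simp add: matrix_mul_assoc)
  have "C ** shift 3 ** B = C ** (C ** (B ** (A ** B)))" unfolding T by (simp flip: matrix_mul_assoc)
  then show "C ** shift 3 ** B = - (B ** A ** B)"
    unfolding half_turn_cancel[OF ht(3)] by (simp add: matrix_mul_assoc)
qed

text \<open>The middle half-turn moves to the end, and the new one in the middle is the conjugate of \<open>C\<close> by
  \<open>B\<close>; the old generators are odd words in the new ones.\<close>

lemma markov_basis_left:
  assumes "markov_basis A B C"
  shows "markov_basis A (B ** shift 3 ** A) B"
proof -
  note ht = markov_basis_half_turns[OF assms]
  let ?N = "B ** shift 3 ** A"
  note new = markov_basis_new_mats(1)[OF assms]
  let ?f = "\<lambda>l. case l of La \<Rightarrow> [La] | Lb \<Rightarrow> [Lc] | Lc \<Rightarrow> [Lc, Lb, Lc]"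
  have C: "B ** (?N ** B) = - C"
    unfolding new by (simp add: half_turn_cancel[OF ht(2)] half_turn_square[OF ht(2)] flip: matrix_mul_assoc)
  have "odd (length (?f l)) \<and> (letter_mat A B C l = wmat (letter_mat A ?N B) (?f l)
      \<or> letter_mat A B C l = - wmat (letter_mat A ?N B) (?f l))" for l
    by (cases l) (use C in simp_all)
  note subst = wmat_subst[of ?f, OF this]
  have gen: "\<exists>w. even (length w) \<and> (M = wmat (letter_mat A ?N B) w \<or> M = - wmat (letter_mat A ?N B) w)"
    if M: "M \<in> torus_matrices" for M
  proof -
    obtain w where w: "even (length w)" "M = wmat (letter_mat A B C) w \<or> M = - wmat (letter_mat A B C) w"
      using assms M unfolding markov_basis_def by blast
    with subst[of w] show ?thesis by (metis minus_minus)
  qed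
  have "half_turn ?N" unfolding new by (rule half_turn_conj[OF ht(3,2)])
  moreover have "B ** ?N ** A = shift 3"
    by (simp add: half_turn_cancel[OF ht(2)] half_turn_square[OF ht(1)] flip: matrix_mul_assoc)
  moreover have "A ** ?N = - ((A ** B) ** (C ** B))" unfolding new by (simp add: matrix_mul_assoc)
  moreover have "B ** ?N = C ** B" unfolding new by (simp add: half_turn_cancel[OF ht(2)] flip: matrix_mul_assoc)
  moreover have "A ** B \<in> torus_matrices" "C ** B \<in> torus_matrices" using assms by (auto simp: markov_basis_def)
  ultimately show ?thesis
    unfolding markov_basis_def using ht gen torus_matrices_mult by auto
qed

lemma markov_basis_right:
  assumes "markov_basis A B C"
  shows "markov_basis B (C ** shift 3 ** B) C"
proof -
  note ht = markov_basis_half_turns[OF assms]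
  let ?N = "C ** shift 3 ** B"
  note new = markov_basis_new_mats(2)[OF assms]
  let ?f = "\<lambda>l. case l of La \<Rightarrow> [La, Lb, La] | Lb \<Rightarrow> [La] | Lc \<Rightarrow> [Lc]"
  have A: "B ** (?N ** B) = - A"
    unfolding new by (simp add: half_turn_cancel[OF ht(2)] half_turn_square[OF ht(2)] flip: matrix_mul_assoc)
  have "odd (length (?f l)) \<and> (letter_mat A B C l = wmat (letter_mat B ?N C) (?f l)
      \<or> letter_mat A B C l = - wmat (letter_mat B ?N C) (?f l))" for l
    by (cases l) (use A in simp_all)
  note subst = wmat_subst[of ?f, OF this]
  have gen: "\<exists>w. even (length w) \<and> (M = wmat (letter_mat B ?N C) w \<or> M = - wmat (letter_mat B ?N C) w)"
    if M: "M \<in> torus_matrices" for M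
  proof -
    obtain w where w: "even (length w)" "M = wmat (letter_mat A B C) w \<or> M = - wmat (letter_mat A B C) w"
      using assms M unfolding markov_basis_def by blast
    with subst[of w] show ?thesis by (metis minus_minus)
  qed
  have "half_turn ?N" unfolding new by (rule half_turn_conj[OF ht(1,2)])
  moreover have "C ** ?N ** B = shift 3"
    by (simp add: half_turn_cancel[OF ht(3)] half_turn_square[OF ht(2)] flip: matrix_mul_assoc)
  moreover have "C ** ?N = - ((C ** B) ** (A ** B))" unfolding new by (simp add: matrix_mul_assoc)
  moreover have "B ** ?N = A ** B" unfolding new by (simp add: half_turn_cancel[OF ht(2)] flip: matrix_mul_assoc)
  moreover have "A ** B \<in> torus_matrices" "C ** B \<in> torus_matrices" using assms by (auto simp: markov_basis_def)
  ultimately show ?thesis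
    unfolding markov_basis_def using ht gen torus_matrices_mult by auto
qed

lemma markov_basis_odd:
  assumes "markov_basis A B C"
  shows "A \<in> odd_matrices" "B \<in> odd_matrices" "C \<in> odd_matrices"
proof -
  note ht = markov_basis_half_turns[OF assms]
  have T: "shift 3 = C ** (B ** A)" using assms by (simp add: markov_basis_def matrix_mul_assoc)
  have G: "A ** B \<in> torus_matrices" "C ** B \<in> torus_matrices" using assms by (auto simp: markov_basis_def)
  have "shift 3 ** A = - (C ** B)"
    unfolding T by (simp add: half_turn_square[OF ht(1)] flip: matrix_mul_assoc)
  with G ht show A: "A \<in> odd_matrices" by (simp add: odd_matrices_def half_turn_det)
  have "B = - (A ** (A ** B))" using half_turn_cancel[OF ht(1), of B] by simp
  with odd_mult_even[OF A G(1)] show B: "B \<in> odd_matrices" by (metis odd_uminus)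
  have "C = - (C ** B ** B)" using half_turn_square[OF ht(2)] by (simp flip: matrix_mul_assoc)
  with even_mult_odd[OF G(2) B] show "C \<in> odd_matrices" by (metis odd_uminus)
qed

text \<open>Comparing lower left entries in three forms of the relation \<open>C ** B ** A = shift 3\<close>. The first
  three equations are the distances between the vertical lines, because a half-turn \<open>A\<close> maps infinity
  to \<open>A$1$1 / A$2$1\<close>.\<close>

lemma markov_basis_entries:
  assumes "markov_basis A B C"
  shows "B$1$1 * A$2$1 - A$1$1 * B$2$1 = C$2$1" "C$1$1 * B$2$1 - B$1$1 * C$2$1 = A$2$1"
    "C$1$1 * A$2$1 - A$1$1 * C$2$1 = 3 * A$2$1 * C$2$1 - B$2$1"
    "(A$2$1)\<^sup>2 + (B$2$1)\<^sup>2 + (C$2$1)\<^sup>2 = 3 * A$2$1 * B$2$1 * C$2$1"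
proof -
  note ht = markov_basis_half_turns[OF assms]
  have T: "shift 3 = C ** (B ** A)" using assms by (simp add: markov_basis_def matrix_mul_assoc)
  have "B ** A = - (C ** shift 3)" unfolding T by (simp add: half_turn_cancel[OF ht(3)])
  then have "(B ** A)$2$1 = (- (C ** shift 3))$2$1" by simp
  then show 1: "B$1$1 * A$2$1 - A$1$1 * B$2$1 = C$2$1"
    using ht by (simp add: half_turn_def algebra_simps)
  have "C ** B = - (shift 3 ** A)"
    unfolding T by (simp add: half_turn_square[OF ht(1)] flip: matrix_mul_assoc)
  then have "(C ** B)$2$1 = (- (shift 3 ** A))$2$1" by simp
  then show 2: "C$1$1 * B$2$1 - B$1$1 * C$2$1 = A$2$1"
    using ht by (simp add: half_turn_def algebra_simps)
  have "C ** shift 3 ** A = B"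
    unfolding T by (simp add: half_turn_cancel[OF ht(3)] half_turn_square[OF ht(1)] flip: matrix_mul_assoc)
  then have "(C ** shift 3 ** A)$2$1 = B$2$1" by simp
  then show 3: "C$1$1 * A$2$1 - A$1$1 * C$2$1 = 3 * A$2$1 * C$2$1 - B$2$1"
    using ht by (simp add: half_turn_def algebra_simps)
  have "B$2$1 * (C$1$1 * A$2$1 - A$1$1 * C$2$1)
    = A$2$1 * (C$1$1 * B$2$1 - B$1$1 * C$2$1) + C$2$1 * (B$1$1 * A$2$1 - A$1$1 * B$2$1)"
    by (simp add: algebra_simps)
  then show "(A$2$1)\<^sup>2 + (B$2$1)\<^sup>2 + (C$2$1)\<^sup>2 = 3 * A$2$1 * B$2$1 * C$2$1"
    unfolding 1 2 3 by (simp add: power2_eq_square algebra_simps)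
qed

lemma markov_basis_new_entries:
  assumes "markov_basis A B C"
  shows "(B ** shift 3 ** A)$2$1 = 3 * A$2$1 * B$2$1 - C$2$1"
    "(C ** shift 3 ** B)$2$1 = 3 * B$2$1 * C$2$1 - A$2$1"
  using markov_basis_entries(1,2)[OF assms] markov_basis_half_turns[OF assms]
  by (simp_all add: half_turn_def algebra_simps)

text \<open>Up to sign \<open>C ** B\<close> is \<open>shift 3 ** A\<close> and \<open>A ** B\<close> is \<open>shift (- 3) ** C\<close>, so the slope of the
  geodesic of \<open>A\<close> is \<open>r\<close> and that of \<open>C\<close> is \<open>s\<close>. The homology class has the coordinates of the
  slope in reversed order.\<close>

definition basis_slopes :: "((int^2^2) set set \<Rightarrow> int \<times> int) \<Rightarrow> int^2^2 \<Rightarrow> int^2^2 \<Rightarrow> int^2^2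
    \<Rightarrow> int \<times> int \<Rightarrow> int \<times> int \<Rightarrow> bool" where
  "basis_slopes \<phi> A B C r s \<longleftrightarrow>
     hclass \<phi> (C ** B) = (snd r, fst r) \<and> hclass \<phi> (A ** B) = (snd s, fst s)"

lemma basis_slopes_left:
  assumes "H1_identification \<phi>" "markov_basis A B C" "basis_slopes \<phi> A B C r s"
  shows "basis_slopes \<phi> A (B ** shift 3 ** A) B r (r + s)"
proof -
  note ht = markov_basis_half_turns[OF assms(2)]
  have G: "A ** B \<in> torus_matrices" "C ** B \<in> torus_matrices" using assms by (auto simp: markov_basis_def)
  have "A ** (B ** shift 3 ** A) = - ((A ** B) ** (C ** B))"
    unfolding markov_basis_new_mats(1)[OF assms(2)] by (simp add: matrix_mul_assoc)
  moreover have "B ** (B ** shift 3 ** A) = C ** B"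
    unfolding markov_basis_new_mats(1)[OF assms(2)] by (simp add: half_turn_cancel[OF ht(2)] flip: matrix_mul_assoc)
  ultimately show ?thesis
    using assms(3) hclass_mult[OF assms(1) G] by (simp add: basis_slopes_def add.commute)
qed

lemma basis_slopes_right:
  assumes "H1_identification \<phi>" "markov_basis A B C" "basis_slopes \<phi> A B C r s"
  shows "basis_slopes \<phi> B (C ** shift 3 ** B) C (r + s) s"
proof -
  note ht = markov_basis_half_turns[OF assms(2)]
  have G: "A ** B \<in> torus_matrices" "C ** B \<in> torus_matrices" using assms by (auto simp: markov_basis_def)
  have "C ** (C ** shift 3 ** B) = - ((C ** B) ** (A ** B))"
    unfolding markov_basis_new_mats(2)[OF assms(2)] by (simp add: matrix_mul_assoc)
  moreover have "B ** (C ** shift 3 ** B) = A ** B"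
    unfolding markov_basis_new_mats(2)[OF assms(2)] by (simp add: half_turn_cancel[OF ht(2)] flip: matrix_mul_assoc)
  ultimately show ?thesis
    using assms(3) hclass_mult[OF assms(1) G(2,1)] by (simp add: basis_slopes_def)
qed

lemma basis_slopes_base:
  assumes "H1_identification \<phi>"
  shows "basis_slopes \<phi> (mk (- 1) (- 2) 1 1) (mk 0 (- 1) 1 0) (mk 1 (- 2) 1 (- 1)) (- 1, 1) (1, 0)"
proof -
  have "mk 1 (- 2) 1 (- 1) ** mk 0 (- 1) 1 0 = - alpha_mat" "mk (- 1) (- 2) 1 1 ** mk 0 (- 1) 1 0 = - beta_mat"
    by (simp_all add: mat2_eq_iff)
  then show ?thesis using hclass_gens[OF assms] by (simp add: basis_slopes_def)
qed


section \<open>Farey triples and Markov labels\<close>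

lemma is_fractionD:
  assumes "is_fraction (a, b)"
  shows "0 \<le> b" "b = 0 \<Longrightarrow> a = 1"
proof -
  have "0 < b \<or> a = 1 \<and> b = 0" using assms unfolding is_fraction_def snd_conv prod.inject by (rule conjunct2)
  then show "0 \<le> b" by linarith
  assume "b = 0"
  with \<open>0 < b \<or> a = 1 \<and> b = 0\<close> show "a = 1" by simp
qed

lemma farey_tripleD:
  assumes "farey_triple (a, b) (p, q) (c, d)"
  shows "p = a + c" "q = b + d" "b * c - a * d = 1" "0 \<le> b" "0 \<le> d" "b = 0 \<Longrightarrow> a = 1" "d = 0 \<Longrightarrow> c = 1"
proof -
  from assms show pq: "p = a + c" "q = b + d" by (auto simp: farey_triple_def)
  from assms have "a * q < p * b" "\<bar>a * d - b * c\<bar> = 1"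
    by (simp_all add: farey_triple_def fraction_less_def farey_neighbors_def)
  moreover have "p * b - a * q = b * c - a * d" unfolding pq by (simp add: algebra_simps)
  ultimately show "b * c - a * d = 1" by linarith
  from assms have "is_fraction (a, b)" "is_fraction (c, d)" by (simp_all add: farey_triple_def)
  then show "0 \<le> b" "0 \<le> d" "b = 0 \<Longrightarrow> a = 1" "d = 0 \<Longrightarrow> c = 1"
    by (blast dest: is_fractionD)+
qed

lemma farey_tripleI:
  assumes "b * c - a * d = 1" "0 < b" "0 < d \<or> d = 0 \<and> c = 1"
  shows "farey_triple (a, b) (a + c, b + d) (c, d)"
proof -
  have cop: "coprime x y" if "u * x + v * y = 1" for x y u v :: int
  proof (rule coprimeI)
    fix e assume "e dvd x" "e dvd y"
    then have "e dvd u * x + v * y" by (intro dvd_add dvd_mult)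
    then show "is_unit e" by (simp add: that)
  qed
  have "coprime a b" by (rule cop[of "- d" _ c]) (use assms in \<open>simp add: algebra_simps\<close>)
  moreover have "coprime c d" by (rule cop[of b _ "- a"]) (use assms in \<open>simp add: algebra_simps\<close>)
  moreover have "coprime (a + c) (b + d)" by (rule cop[of b _ "- a"]) (use assms in \<open>simp add: algebra_simps\<close>)
  ultimately show ?thesis
    using assms by (auto simp: farey_triple_def fraction_less_def farey_neighbors_def is_fraction_def algebra_simps)
qed

text \<open>The cross-multiplied equations show that two left precedents have denominators that agree modulo
  \<open>q\<close>, and these are positive and at most \<open>q\<close>.\<close>

lemma farey_triple_unique:
  assumes 1: "farey_triple r x s" and 2: "farey_triple r' x s'" and x: "0 < fst x" "fst x \<le> snd x"
  shows "r' = r" "s' = s"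
proof -
  obtain p q a b c d a' b' c' d' where [simp]: "x = (p, q)" "r = (a, b)" "s = (c, d)" "r' = (a', b')" "s' = (c', d')"
    by (metis surj_pair)
  note d1 = farey_tripleD[OF 1[simplified]] and d2 = farey_tripleD[OF 2[simplified]]
  have cop: "coprime q p" using 1 by (simp add: farey_triple_def is_fraction_def coprime_commute)
  have less: "a * q < p * b" "a' * q < p * b'" using 1 2 by (auto simp: farey_triple_def fraction_less_def)
  have q: "0 < q" using x by simp
  have "b \<noteq> 0" using less(1) d1(6) q by auto
  then have b: "0 < b" "b \<le> q" using d1 by auto
  have "b' \<noteq> 0" using less(2) d2(6) q by auto
  then have b': "0 < b'" "b' \<le> q" using d2 by auto
  have "p * b - a * q = 1" using d1(3) unfolding d1(1,2) by (simp add: algebra_simps)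
  moreover have "p * b' - a' * q = 1" using d2(3) unfolding d2(1,2) by (simp add: algebra_simps)
  ultimately have "p * b - a * q = p * b' - a' * q" by simp
  then have e: "p * (b - b') = q * (a - a')" by (simp add: algebra_simps)
  then have "q dvd b - b'" using cop by (metis coprime_dvd_mult_right_iff dvd_triv_left)
  moreover have "\<bar>b - b'\<bar> < q" using b b' by auto
  ultimately have "b' = b" by (metis dvd_imp_le_int abs_of_pos eq_iff_diff_eq_0 not_le q)
  with e q have "a' = a" by simp
  with \<open>b' = b\<close> show "r' = r" by simp
  show "s' = s" using \<open>a' = a\<close> \<open>b' = b\<close> d1(1,2) d2(1,2) by simp
qed

text \<open>The determinants of \<open>t\<close> with \<open>r\<close> and \<open>s\<close> are \<open>\<plusminus>1\<close>, so \<open>t\<close> is up to sign the sum \<open>x\<close>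
  or the difference of \<open>r\<close> and \<open>s\<close>.\<close>

lemma farey_other_neighbor_unique:
  assumes F: "farey_triple r x s"
    and t: "is_fraction t" "farey_neighbors t r" "farey_neighbors t s" "t \<noteq> x"
    and t': "is_fraction t'" "farey_neighbors t' r" "farey_neighbors t' s" "t' \<noteq> x"
    and x: "0 < snd x"
  shows "t' = t"
proof -
  obtain p q a b c d where [simp]: "x = (p, q)" "r = (a, b)" "s = (c, d)" by (metis surj_pair)
  note D = farey_tripleD[OF F[simplified]]
  have *: "t = (c - a, d - b) \<or> t = (a - c, b - d)"
    if t: "is_fraction t" "farey_neighbors t r" "farey_neighbors t s" "t \<noteq> x" for t
  proof -
    obtain e f where [simp]: "t = (e, f)" by (metis surj_pair)
    define u where "u = e * b - a * f"
    define v where "v = e * d - c * f"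
    have uv: "\<bar>u\<bar> = 1" "\<bar>v\<bar> = 1" using t by (auto simp: farey_neighbors_def u_def v_def algebra_simps)
    have "e * (b * c - a * d) = u * c - a * v" "f * (b * c - a * d) = u * d - b * v"
      by (simp_all add: u_def v_def algebra_simps)
    then have ef: "e = u * c - a * v" "f = u * d - b * v"
      by (simp_all only: D(3) mult_1_right)
    have "is_fraction (e, f)" using t(1) by simp
    then have "f \<ge> 0" by (rule is_fractionD)
    consider "u = 1" "v = 1" | "u = -1" "v = -1" | "u = 1" "v = -1" | "u = -1" "v = 1"
    proof -
      have "u = 1 \<or> u = -1" using uv(1) by linarith
      moreover have "v = 1 \<or> v = -1" using uv(2) by linarith
      ultimately show thesis using that by blast
    qed
    then show ?thesis
    proof cases
      case 3
      then show ?thesis using ef D(1,2) t(4) by simp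
    next
      case 4
      then show ?thesis using ef D(2) \<open>f \<ge> 0\<close> x by simp
    qed (use ef in auto)
  qed
  from *[OF t] *[OF t'] t(1) t'(1) show ?thesis
    by (auto simp: is_fraction_def)
qed

lemma markov_label_unique:
  assumes "markov_label x m" "markov_label x m'"
  shows "m' = m"
  using assms
proof (induction arbitrary: m' rule: markov_label.induct)
  case minus_one
  then show ?case by (cases rule: markov_label.cases) auto
next
  case zero
  then show ?case by (cases rule: markov_label.cases) auto
next
  case infinity
  then show ?case by (cases rule: markov_label.cases) auto
next
  case (step x r s t k l m)
  from step.prems show ?case
  proof (cases rule: markov_label.cases)
    case (step r' s' t' k' l' m'')
    have "r' = r" "s' = s"
      using farey_triple_unique \<open>farey_triple r x s\<close> step \<open>0 < fst x\<close> \<open>fst x \<le> snd x\<close> by blast+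
    moreover have "t' = t"
    proof (rule farey_other_neighbor_unique[OF \<open>farey_triple r x s\<close>])
      show "0 < snd x" using \<open>0 < fst x\<close> \<open>fst x \<le> snd x\<close> by simp
    qed (use step \<open>r' = r\<close> \<open>s' = s\<close> \<open>is_fraction t\<close> \<open>farey_neighbors t r\<close> \<open>farey_neighbors t s\<close> \<open>t \<noteq> x\<close> in auto)
    ultimately show ?thesis using step "step.IH" by auto
  qed (use step.hyps in auto)
qed

text \<open>A basis that carries the slopes and the labels of a Farey triple. The inequalities are part of it
  because they are needed for the twist and are inherited by the children in the Farey tree.\<close>

definition labelled_basis :: "((int^2^2) set set \<Rightarrow> int \<times> int) \<Rightarrow> int^2^2 \<Rightarrow> int^2^2 \<Rightarrow> int^2^2
    \<Rightarrow> int \<times> int \<Rightarrow> int \<times> int \<Rightarrow> int \<times> int \<Rightarrow> bool" where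
  "labelled_basis \<phi> A B C r x s \<longleftrightarrow> markov_basis A B C \<and> basis_slopes \<phi> A B C r s \<and>
     markov_label r (A$2$1) \<and> markov_label x (B$2$1) \<and> markov_label s (C$2$1) \<and>
     A$2$1 < B$2$1 \<and> C$2$1 < B$2$1"

text \<open>The triple of 0, 1 and infinity is the right child of the triple with centre 0 between -1 and
  infinity, to which the half-turns of \<open>markov_basis_base\<close> belong.\<close>

lemma labelled_basis_root:
  assumes "H1_identification \<phi>"
  shows "\<exists>A B C. labelled_basis \<phi> A B C (0, 1) (1, 1) (1, 0)"
proof -
  let ?A = "mk 0 (- 1) 1 0" and ?C = "mk 1 (- 2) 1 (- 1)"
  have F: "farey_triple (0, 1) (1, 1) (1, 0)" using farey_tripleI[of 1 1 0 0] by simp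
  have "markov_label (1, 1) (3 * 1 * 1 - 1)"
    by (rule markov_label.step[OF _ _ F, of "(- 1, 1)"])
       (auto simp: is_fraction_def farey_neighbors_def intro: markov_label.intros(1-3))
  moreover have "(?C ** shift 3 ** ?A)$2$1 = 2" by simp
  ultimately have "labelled_basis \<phi> ?A (?C ** shift 3 ** ?A) ?C (0, 1) (1, 1) (1, 0)"
    using markov_basis_right[OF markov_basis_base]
      basis_slopes_right[OF assms markov_basis_base basis_slopes_base[OF assms]]
    by (simp add: labelled_basis_def zero infinity)
  then show ?thesis by blast
qed

lemma labelled_basis_left:
  assumes \<phi>: "H1_identification \<phi>" and B: "labelled_basis \<phi> A B C r x s" and F: "farey_triple r x s"
    and F': "farey_triple r (r + x) x" and x: "0 < fst (r + x)" "fst (r + x) \<le> snd (r + x)"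
  shows "\<exists>A B C. labelled_basis \<phi> A B C r (r + x) x"
proof -
  let ?N = "B ** shift 3 ** A"
  have mb: "markov_basis A B C" and sl: "basis_slopes \<phi> A B C r s"
    and lab: "markov_label r (A$2$1)" "markov_label x (B$2$1)" "markov_label s (C$2$1)"
    and lt: "A$2$1 < B$2$1" "C$2$1 < B$2$1"
    using B by (auto simp: labelled_basis_def)
  note ht = markov_basis_half_turns[OF mb]
  have N: "?N$2$1 = 3 * A$2$1 * B$2$1 - C$2$1" by (rule markov_basis_new_entries(1)[OF mb])
  have "r + s = x" using F by (simp add: farey_triple_def prod_eq_iff)
  have "s \<noteq> r + x"
  proof
    assume "s = r + x"
    with F have "fst r = 0" "snd r = 0" by (auto simp: farey_triple_def)
    with F show False by (simp add: farey_triple_def is_fraction_def)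
  qed
  then have "markov_label (r + x) (3 * A$2$1 * B$2$1 - C$2$1)"
    using F lab x by (intro markov_label.step[OF _ _ F', of s])
      (auto simp: farey_triple_def farey_neighbors_def abs_minus_commute mult.commute)
  moreover have "B$2$1 < ?N$2$1" "A$2$1 < ?N$2$1"
  proof -
    have "1 * B$2$1 \<le> A$2$1 * B$2$1" using ht by (intro mult_right_mono) (auto simp: half_turn_def)
    moreover have "0 < B$2$1" using ht by (simp add: half_turn_def)
    ultimately show "B$2$1 < ?N$2$1" unfolding N mult.assoc using lt by linarith
    with lt show "A$2$1 < ?N$2$1" by simp
  qed
  ultimately have "labelled_basis \<phi> A ?N B r (r + x) x"
    using markov_basis_left[OF mb] basis_slopes_left[OF \<phi> mb sl] lab N \<open>r + s = x\<close>
    by (simp add: labelled_basis_def)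
  then show ?thesis by blast
qed

lemma labelled_basis_right:
  assumes \<phi>: "H1_identification \<phi>" and B: "labelled_basis \<phi> A B C r x s" and F: "farey_triple r x s"
    and F': "farey_triple x (x + s) s" and x: "0 < fst (x + s)" "fst (x + s) \<le> snd (x + s)"
  shows "\<exists>A B C. labelled_basis \<phi> A B C x (x + s) s"
proof -
  let ?N = "C ** shift 3 ** B"
  have mb: "markov_basis A B C" and sl: "basis_slopes \<phi> A B C r s"
    and lab: "markov_label r (A$2$1)" "markov_label x (B$2$1)" "markov_label s (C$2$1)"
    and lt: "A$2$1 < B$2$1" "C$2$1 < B$2$1"
    using B by (auto simp: labelled_basis_def)
  note ht = markov_basis_half_turns[OF mb]
  have N: "?N$2$1 = 3 * B$2$1 * C$2$1 - A$2$1" by (rule markov_basis_new_entries(2)[OF mb])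
  have "r + s = x" using F by (simp add: farey_triple_def prod_eq_iff)
  have "r \<noteq> x + s"
  proof
    assume "r = x + s"
    with F have "fst s = 0" "snd s = 0" by (auto simp: farey_triple_def)
    with F show False by (simp add: farey_triple_def is_fraction_def)
  qed
  then have "markov_label (x + s) (3 * B$2$1 * C$2$1 - A$2$1)"
    using F lab x by (intro markov_label.step[OF _ _ F', of r])
      (auto simp: farey_triple_def farey_neighbors_def abs_minus_commute mult.commute)
  moreover have "B$2$1 < ?N$2$1" "C$2$1 < ?N$2$1"
  proof -
    have "B$2$1 * 1 \<le> B$2$1 * C$2$1" using ht by (intro mult_left_mono) (auto simp: half_turn_def)
    moreover have "0 < B$2$1" using ht by (simp add: half_turn_def)
    ultimately show "B$2$1 < ?N$2$1" unfolding N mult.assoc using lt by linarith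
    with lt show "C$2$1 < ?N$2$1" by simp
  qed
  ultimately have "labelled_basis \<phi> B ?N C x (x + s) s"
    using markov_basis_right[OF mb] basis_slopes_right[OF \<phi> mb sl] lab N \<open>r + s = x\<close>
    by (simp add: labelled_basis_def)
  then show ?thesis by blast
qed

text \<open>One of two Farey neighbours is an immediate precedent of the other, so the components compare in the
  same way.\<close>

lemma farey_compare:
  fixes a b c d :: int
  assumes "b * c - a * d = 1" "0 \<le> a" "0 < b" "0 < c" "0 < d"
  shows "a \<le> c \<and> b \<le> d \<or> c \<le> a \<and> d \<le> b"
proof (rule ccontr)
  assume "\<not> ?thesis"
  then consider "a < c" "d < b" | "c < a" "b < d" by linarith
  then show False
  proof cases
    case 1
    then have "(d + 1) * (a + 1) \<le> b * c" using assms by (intro mult_mono) auto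
    then have "d + a + 1 \<le> 1" using assms(1) by (simp add: algebra_simps)
    then show False using assms by linarith
  next
    case 2
    then have "b * c \<le> d * a" using assms by (intro mult_mono) auto
    then show False using assms(1) by (simp add: algebra_simps)
  qed
qed

text \<open>Unless \<open>s\<close> is infinity, the triple is a child of the triple centred at the one of \<open>r\<close> and \<open>s\<close> with the
  larger components.\<close>

theorem labelled_basis_exists:
  assumes \<phi>: "H1_identification \<phi>"
  shows "farey_triple r x s \<Longrightarrow> 0 \<le> fst r \<Longrightarrow> fst x \<le> snd x \<Longrightarrow> \<exists>A B C. labelled_basis \<phi> A B C r x s"
proof (induction "nat (fst x + snd x)" arbitrary: r x s rule: less_induct)
  case less
  obtain a b c d p q where [simp]: "r = (a, b)" "s = (c, d)" "x = (p, q)" by (metis surj_pair)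
  note F = less.prems(1)
  note D = farey_tripleD[OF F[simplified]]
  have a: "0 \<le> a" and pq: "a + c \<le> b + d" using less.prems D by simp_all
  have b: "0 < b"
  proof (rule ccontr)
    assume "\<not> ?thesis"
    then have "b = 0" "a = 1" using D by auto
    then show False using D by auto
  qed
  have bc: "b * c = 1 + a * d" using D(3) by simp
  then have "0 < b * c" using a D(5) by (simp add: add_pos_nonneg)
  with b have c: "0 < c" by (simp add: zero_less_mult_iff)
  have x: "x = r + s" by (simp add: D)
  show ?case
  proof (cases "d = 0")
    case True
    then have "c = 1" "b = 1" using bc D(7) b by auto
    then have "a = 0" using pq True a by simp
    then show ?thesis using labelled_basis_root[OF \<phi>] True \<open>c = 1\<close> \<open>b = 1\<close> by (simp add: D)
  next
    case False
    with D(5) have d: "0 < d" by simp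
    from farey_compare[OF D(3) a b c d] show ?thesis
    proof
      assume le: "a \<le> c \<and> b \<le> d"
      have cd: "c \<le> d"
      proof (rule ccontr)
        assume "\<not> c \<le> d"
        then have "b * (d + 1) \<le> b * c" "a * d \<le> (b - 1) * d"
          using b d pq by (auto intro: mult_left_mono mult_right_mono)
        then have "b + d \<le> 1" using D(3) by (simp add: algebra_simps)
        with b d show False by simp
      qed
      have "farey_triple (a, b) (a + (c - a), b + (d - b)) (c - a, d - b)"
      proof (rule farey_tripleI)
        show "b * (c - a) - a * (d - b) = 1" using D(3) by (simp add: algebra_simps)
        show "0 < d - b \<or> d - b = 0 \<and> c - a = 1"
        proof (cases "b = d")
          case True
          with D(3) have "b * (c - a) = 1" by (simp add: algebra_simps)
          with b show ?thesis using True by (metis zmult_eq_1_iff diff_self not_one_less_zero zero_less_one less_trans neg_equal_iff_equal verit_minus_simplify(4) add.inverse_inverse neg_0_less_iff_less)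
        qed (use le in auto)
      qed (rule b)
      then have P: "farey_triple r s (c - a, d - b)" by simp
      then obtain A B C where "labelled_basis \<phi> A B C r s (c - a, d - b)"
        using less.hyps[OF _ P] a cd b c d D(1,2) by auto
      from labelled_basis_left[OF \<phi> this P] show ?thesis
        using F less.prems D a c by (simp add: x)
    next
      assume le: "c \<le> a \<and> d \<le> b"
      have ab: "a \<le> b"
      proof (rule ccontr)
        assume "\<not> a \<le> b"
        then have "a \<ge> b + 1" "c \<le> d - 1" using pq by auto
        then have "b * c \<le> b * (d - 1)" "(b + 1) * d \<le> a * d" using b d by (auto intro: mult_left_mono mult_right_mono)
        then show False using D(3) b d by (simp add: algebra_simps)
      qed
      have "farey_triple (a - c, b - d) ((a - c) + c, (b - d) + d) (c, d)"
      proof (rule farey_tripleI)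
        show "(b - d) * c - (a - c) * d = 1" using D(3) by (simp add: algebra_simps)
        show "0 < b - d"
        proof (rule ccontr)
          assume "\<not> ?thesis"
          then have "b = d" using le by simp
          then have "d * (c - a) = 1" using D(3) by (simp add: algebra_simps)
          moreover have "d * (c - a) \<le> 0" using d le by (simp add: mult_le_0_iff)
          ultimately show False by simp
        qed
      qed (use d in simp)
      then have P: "farey_triple (a - c, b - d) r s" by simp
      then obtain A B C where "labelled_basis \<phi> A B C (a - c, b - d) r s"
        using less.hyps[OF _ P] a ab b c d D(1,2) le by auto
      from labelled_basis_right[OF \<phi> this P] show ?thesis
        using F less.prems D a c by (simp add: x)
    qed
  qed
qed

lemma ordered_triple_basis:
  assumes "H1_identification \<phi>" "ordered_markov_triple_at x1 x x2 n1 n n2"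
  obtains A B C where "markov_basis A B C" "basis_slopes \<phi> A B C x1 x2" "A$2$1 = n1" "B$2$1 = n" "C$2$1 = n2"
    "n1 < n" "n2 < n"
proof -
  have "farey_triple x1 x x2" "0 \<le> fst x1" "fst x \<le> snd x"
    and lab: "markov_label x1 n1" "markov_label x n" "markov_label x2 n2"
    using assms(2) by (auto simp: ordered_markov_triple_at_def unit_interval_fraction_def)
  then obtain A B C where "labelled_basis \<phi> A B C x1 x x2" using labelled_basis_exists[OF assms(1)] by blast
  then show thesis
    using that[of A B C] lab markov_label_unique unfolding labelled_basis_def by metis
qed

section \<open>Reduced words and the sides of an ideal triangle\<close>

text \<open>The three half-turns preserve the sides of the ideal triangle with vertices \<open>line A\<close>, \<open>line C\<close>
  and infinity: two vertical lines and a half-circle. The function \<open>side\<close> is positive at the points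
  that the geodesic does not separate from the triangle, and \<open>in_gap\<close> describes the boundary points
  that it separates from the triangle.\<close>

definition line :: "int^2^2 \<Rightarrow> real" where
  "line A = A$1$1 / A$2$1"

fun side :: "real \<Rightarrow> real \<Rightarrow> letter \<Rightarrow> complex \<Rightarrow> real" where
  "side u v La z = Re z - u"
| "side u v Lb z = (Re z - u) * (Re z - v) + (Im z)\<^sup>2"
| "side u v Lc z = v - Re z"

fun in_gap :: "real \<Rightarrow> real \<Rightarrow> letter \<Rightarrow> real \<Rightarrow> bool" where
  "in_gap u v La x \<longleftrightarrow> x < u"
| "in_gap u v Lb x \<longleftrightarrow> u < x \<and> x < v"
| "in_gap u v Lc x \<longleftrightarrow> v < x"

text \<open>A point outside the triangle is beyond only one of its sides.\<close>

lemma side_other: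
  assumes "u < v" "0 < Im z" "side u v l z \<le> 0" "l' \<noteq> l"
  shows "0 < side u v l' z"
proof (cases l)
  case La
  with assms have "0 \<le> (Re z - u) * (Re z - v)" by (intro mult_nonpos_nonpos) auto
  with assms La show ?thesis by (cases l') (auto simp: add_nonneg_pos)
next
  case Lc
  with assms have "0 \<le> (Re z - u) * (Re z - v)" by (intro mult_nonneg_nonneg) auto
  with assms Lc show ?thesis by (cases l') (auto simp: add_nonneg_pos)
next
  case Lb
  with assms have "(Re z - u) * (Re z - v) < 0" by (smt (verit) side.simps(2) zero_less_power)
  then have "u < Re z \<and> Re z < v" using assms(1) by (auto simp: mult_less_0_iff)
  with Lb assms(4) show ?thesis by (cases l') auto
qed

text \<open>In the coordinate centred at its line, a half-turn is the map
  \<open>z \<mapsto> - 1 / (n\<^sup>2 z)\<close> with \<open>n\<close> the lower left entry.\<close>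

lemma half_turn_mob:
  assumes A: "half_turn A" and z: "0 < Im z"
  shows "mob A z = of_real (line A) - 1 / ((of_int (A$2$1))\<^sup>2 * (z - of_real (line A)))"
proof -
  define n where "n = (of_int (A$2$1) :: complex)"
  define a where "a = (of_int (A$1$1) :: complex)"
  define b where "b = (of_int (A$1$2) :: complex)"
  have n: "n \<noteq> 0" using A by (auto simp: n_def half_turn_def)
  have "A$1$1 * A$1$1 + A$1$2 * A$2$1 = - 1"
  proof -
    have "A$1$1 * A$2$2 - A$1$2 * A$2$1 = 1" "A$2$2 = - A$1$1"
      using A unfolding half_turn_def det_2 by blast+
    then show ?thesis by simp
  qed
  then have "of_int (A$1$1 * A$1$1 + A$1$2 * A$2$1) = (- 1 :: complex)" by simp
  then have det: "a * a + b * n = - 1" by (simp add: a_def b_def n_def)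
  have den: "n * z - a \<noteq> 0"
    using mob_denom_nonzero[OF half_turn_det[OF A] z] A by (simp add: n_def a_def half_turn_def)
  have "mob A z = (a * z + b) / (n * z - a)" using A by (simp add: mob_eq a_def b_def n_def half_turn_def)
  also have "\<dots> = (a * (n * z - a) + (a * a + b * n)) / (n * (n * z - a))"
    using n den by (simp add: divide_simps) (simp add: algebra_simps)
  also have "\<dots> = a / n - 1 / (n * (n * z - a))"
    unfolding det using n den by (simp add: divide_simps)
  also have "n * (n * z - a) = n\<^sup>2 * (z - a / n)" using n by (simp add: field_simps power2_eq_square)
  finally show ?thesis by (simp add: line_def a_def n_def)
qed

lemma half_turn_rmob:
  assumes A: "half_turn A" and x: "x \<noteq> line A"
  shows "rden A x \<noteq> 0" "rmob A x = line A - 1 / ((of_int (A$2$1))\<^sup>2 * (x - line A))"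
proof -
  define n where "n = real_of_int (A$2$1)"
  define a where "a = real_of_int (A$1$1)"
  define b where "b = real_of_int (A$1$2)"
  have n: "n \<noteq> 0" using A by (auto simp: n_def half_turn_def)
  have "A$1$1 * A$1$1 + A$1$2 * A$2$1 = - 1"
  proof -
    have "A$1$1 * A$2$2 - A$1$2 * A$2$1 = 1" "A$2$2 = - A$1$1"
      using A unfolding half_turn_def det_2 by blast+
    then show ?thesis by simp
  qed
  then have "real_of_int (A$1$1 * A$1$1 + A$1$2 * A$2$1) = - 1" by simp
  then have det: "a * a + b * n = - 1" by (simp add: a_def b_def n_def)
  have den: "n * x - a \<noteq> 0" using x n by (auto simp: line_def n_def a_def field_simps)
  then show "rden A x \<noteq> 0" using A by (simp add: n_def a_def half_turn_def)
  have "rmob A x = (a * x + b) / (n * x - a)" using A by (simp add: rmob_def a_def b_def n_def half_turn_def)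
  also have "\<dots> = (a * (n * x - a) + (a * a + b * n)) / (n * (n * x - a))"
    using n den by (simp add: divide_simps) (simp add: algebra_simps)
  also have "\<dots> = a / n - 1 / (n * (n * x - a))"
    unfolding det using n den by (simp add: divide_simps)
  also have "n * (n * x - a) = n\<^sup>2 * (x - a / n)" using n by (simp add: field_simps power2_eq_square)
  finally show "rmob A x = line A - 1 / ((of_int (A$2$1))\<^sup>2 * (x - line A))"
    by (simp add: line_def a_def n_def)
qed

lemma half_turn_Re:
  assumes A: "half_turn A" and z: "0 < Im z"
  shows "Re (mob A z) - line A
    = - ((Re z - line A) / ((of_int (A$2$1))\<^sup>2 * ((Re z - line A)\<^sup>2 + (Im z)\<^sup>2)))"
proof -
  define w where "w = z - of_real (line A)"
  define m where "m = (real_of_int (A$2$1))\<^sup>2"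
  have "mob A z = of_real (line A) - 1 / (of_real m * w)"
    using half_turn_mob[OF A z] by (simp add: w_def m_def)
  then have "Re (mob A z) - line A = - Re (1 / w / of_real m)" by (simp add: mult.commute)
  also have "\<dots> = - (Re w / ((Re w)\<^sup>2 + (Im w)\<^sup>2) / m)"
    unfolding Re_divide_of_real by (simp add: Re_divide)
  finally show ?thesis by (simp add: w_def m_def mult.commute)
qed

lemma basis_lines:
  assumes "markov_basis A B C"
  defines "u \<equiv> line A" and "v \<equiv> line C" and "a \<equiv> real_of_int (A$2$1)" and "b \<equiv> real_of_int (B$2$1)"
    and "c \<equiv> real_of_int (C$2$1)"
  shows "u < v" "v - u = 3 - b / (a * c)" "line B - u = c / (a * b)" "v - line B = a / (b * c)"
    "a\<^sup>2 + b\<^sup>2 + c\<^sup>2 = 3 * a * b * c" "v - u = (a\<^sup>2 + c\<^sup>2) / (a * b * c)" "0 < a" "0 < b" "0 < c"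
proof -
  note ht = markov_basis_half_turns[OF assms(1)]
  show pos: "0 < a" "0 < b" "0 < c" using ht by (auto simp: half_turn_def a_def b_def c_def)
  have e1: "real_of_int (B$1$1) * a - A$1$1 * b = c"
    using arg_cong[OF markov_basis_entries(1)[OF assms(1)], of real_of_int] by (simp add: a_def b_def c_def)
  have e2: "real_of_int (C$1$1) * b - B$1$1 * c = a"
    using arg_cong[OF markov_basis_entries(2)[OF assms(1)], of real_of_int] by (simp add: a_def b_def c_def)
  have e3: "real_of_int (C$1$1) * a - A$1$1 * c = 3 * a * c - b"
    using arg_cong[OF markov_basis_entries(3)[OF assms(1)], of real_of_int] by (simp add: a_def b_def c_def)
  show e4: "a\<^sup>2 + b\<^sup>2 + c\<^sup>2 = 3 * a * b * c"
    using arg_cong[OF markov_basis_entries(4)[OF assms(1)], of real_of_int] by (simp add: a_def b_def c_def)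
  have uv: "v - u = (real_of_int (C$1$1) * a - A$1$1 * c) / (a * c)"
    using pos by (simp add: u_def v_def line_def a_def c_def diff_frac_eq mult.commute)
  show 3: "v - u = 3 - b / (a * c)" unfolding uv e3 using pos by (simp add: diff_divide_distrib)
  show "line B - u = c / (a * b)"
    unfolding e1[symmetric] using pos by (simp add: u_def line_def a_def b_def diff_frac_eq mult.commute)
  show "v - line B = a / (b * c)"
    unfolding e2[symmetric] using pos by (simp add: v_def line_def b_def c_def diff_frac_eq mult.commute)
  show 6: "v - u = (a\<^sup>2 + c\<^sup>2) / (a * b * c)"
    unfolding 3 using pos e4 by (simp add: divide_simps power2_eq_square) (simp add: algebra_simps)
  have "0 < (a\<^sup>2 + c\<^sup>2) / (a * b * c)" using pos by (intro divide_pos_pos add_pos_pos mult_pos_pos) auto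
  with 6 show "u < v" by simp
qed

text \<open>The half-turn \<open>B\<close> exchanges the points \<open>line A\<close> and \<open>line C\<close>, because their distances from
  \<open>line B\<close> have the product \<open>1 / (B$2$1)\<^sup>2\<close>. The equations avoid the denominators.\<close>

lemma basis_middle_swaps:
  assumes "markov_basis A B C"
  shows "(B$1$1 - B$2$1 * line A) * line C + (B$1$2 + B$1$1 * line A) = 0"
    "(B$1$1 - B$2$1 * line C) * line A + (B$1$2 + B$1$1 * line C) = 0"
proof -
  define a where "a = real_of_int (A$2$1)"
  define b where "b = real_of_int (B$2$1)"
  define c where "c = real_of_int (C$2$1)"
  note L = basis_lines[OF assms, folded a_def b_def c_def]
  have hb: "half_turn B" using markov_basis_half_turns[OF assms] by simp
  define m where "m = real_of_int (B$1$1)"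
  have m: "m = b * line B" using L(8) by (simp add: m_def b_def line_def)
  have "B$1$1 * B$1$1 + B$1$2 * B$2$1 = - 1"
  proof -
    have "B$1$1 * B$2$2 - B$1$2 * B$2$1 = 1" "B$2$2 = - B$1$1"
      using hb unfolding half_turn_def det_2 by blast+
    then show ?thesis by simp
  qed
  then have "real_of_int (B$1$1 * B$1$1 + B$1$2 * B$2$1) = - 1" by simp
  then have det: "m * m + B$1$2 * b = - 1" by (simp add: m_def b_def)
  have prod: "(line B - line A) * (line C - line B) * b\<^sup>2 = 1"
    unfolding L(3,4) using L(7-9) by (simp add: power2_eq_square)
  have "b * ((m - b * line A) * line C + (B$1$2 + m * line A))
    = (m * m + B$1$2 * b) + (m - b * line A) * (b * line C - m)"
    by (simp add: algebra_simps)
  also have "\<dots> = - 1 + (line B - line A) * (line C - line B) * b\<^sup>2"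
    unfolding det by (simp add: m power2_eq_square algebra_simps)
  finally have 1: "(m - b * line A) * line C + (B$1$2 + m * line A) = 0" using prod L(8) by simp
  then show "(B$1$1 - B$2$1 * line A) * line C + (B$1$2 + B$1$1 * line A) = 0" by (simp add: m_def b_def)
  show "(B$1$1 - B$2$1 * line C) * line A + (B$1$2 + B$1$1 * line C) = 0"
    using 1 by (simp add: m_def b_def algebra_simps)
qed

text \<open>A half-turn exchanges the two sides of the geodesic it preserves. For \<open>B\<close> the sides are
  distinguished by a product that changes its sign when the ends are exchanged.\<close>

lemma side_swap:
  assumes mb: "markov_basis A B C" and z: "0 < Im z" and pos: "0 < side (line A) (line C) l z"
  shows "side (line A) (line C) l (mob (letter_mat A B C l) z) < 0"
proof (cases l)
  case La
  have ht: "half_turn A" using markov_basis_half_turns[OF mb] by simp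
  have "0 < (real_of_int (A$2$1))\<^sup>2 * ((Re z - line A)\<^sup>2 + (Im z)\<^sup>2)"
    using ht z by (intro mult_pos_pos add_nonneg_pos) (auto simp: half_turn_def)
  then have "0 < (Re z - line A) / ((real_of_int (A$2$1))\<^sup>2 * ((Re z - line A)\<^sup>2 + (Im z)\<^sup>2))"
    using La pos by (intro divide_pos_pos) auto
  then show ?thesis using La half_turn_Re[OF ht z] by simp
next
  case Lc
  have ht: "half_turn C" using markov_basis_half_turns[OF mb] by simp
  have "0 < (real_of_int (C$2$1))\<^sup>2 * ((Re z - line C)\<^sup>2 + (Im z)\<^sup>2)"
    using ht z by (intro mult_pos_pos add_nonneg_pos) (auto simp: half_turn_def)
  then have "(Re z - line C) / ((real_of_int (C$2$1))\<^sup>2 * ((Re z - line C)\<^sup>2 + (Im z)\<^sup>2)) < 0"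
    using Lc pos by (intro divide_neg_pos) auto
  then show ?thesis using Lc half_turn_Re[OF ht z] by simp
next
  case Lb
  have ht: "half_turn B" using markov_basis_half_turns[OF mb] by simp
  define u where "u = line A"
  define v where "v = line C"
  note L = basis_lines[OF mb, folded u_def v_def]
  define m where "m = real_of_int (B$1$1)"
  define b where "b = real_of_int (B$2$1)"
  define w where "w = of_int (B$2$1) * z + of_int (B$2$2)"
  have w: "w \<noteq> 0" using mob_denom_nonzero[OF half_turn_det[OF ht] z] by (simp add: w_def)
  have sub: "mob B z - of_real s = of_real (m - b * s) * (z - of_real t) / w"
    if "(m - b * s) * t + (B$1$2 + m * s) = 0" for s t :: real
  proof -
    have e: "of_real ((m - b * s) * t + (B$1$2 + m * s)) = (0 :: complex)" using that by simp
    have "mob B z - of_real s = (of_int (B$1$1) * z + of_int (B$1$2) - of_real s * w) / w"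
      using w by (simp add: mob_eq w_def diff_divide_distrib)
    also have "of_int (B$1$1) * z + of_int (B$1$2) - of_real s * w
      = of_real (m - b * s) * (z - of_real t) + of_real ((m - b * s) * t + (B$1$2 + m * s))"
      using ht by (simp add: w_def m_def b_def half_turn_def algebra_simps)
    finally show ?thesis unfolding e by simp
  qed
  have form: "(Re y - s) * (Re y - t) + (Im y)\<^sup>2 = Re ((y - of_real s) * cnj (y - of_real t))" for y s t
    by (simp add: power2_eq_square algebra_simps)
  have quot: "Re ((of_real p * y / w) * cnj (of_real q * y' / w)) = p * q * Re (y * cnj y') / (cmod w)\<^sup>2"
    for y y' and p q :: real
  proof -
    have "(of_real p * y / w) * cnj (of_real q * y' / w) = of_real (p * q) * (y * cnj y') / of_real ((cmod w)\<^sup>2)"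
      by (simp add: complex_norm_square mult_ac del: of_real_power)
    then show ?thesis by (simp only: Re_divide_of_real) simp
  qed
  have mm: "m - b * u = b * (line B - u)" "m - b * v = b * (line B - v)"
    using L(8) by (simp_all add: m_def b_def line_def field_simps)
  have "line B - u > 0" unfolding L(3) using L(7-9) by simp
  moreover have "v - line B > 0" unfolding L(4) using L(7-9) by simp
  ultimately have "line B - u > 0" "line B - v < 0" by simp_all
  then have neg: "(m - b * u) * (m - b * v) < 0"
    unfolding mm using L(8) by (intro mult_pos_neg) (auto simp: b_def mult_pos_neg)
  have "Re ((mob B z - of_real u) * cnj (mob B z - of_real v))
     = (m - b * u) * (m - b * v) * Re ((z - of_real v) * cnj (z - of_real u)) / (cmod w)\<^sup>2"
    unfolding sub[OF basis_middle_swaps(1)[OF mb, folded u_def v_def m_def b_def]]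
      sub[OF basis_middle_swaps(2)[OF mb, folded u_def v_def m_def b_def]] quot ..
  also have "Re ((z - of_real v) * cnj (z - of_real u)) = side u v Lb z"
    unfolding form[symmetric] by (simp add: mult.commute)
  also have "(m - b * u) * (m - b * v) * side u v Lb z / (cmod w)\<^sup>2 < 0"
    using mult_neg_pos[OF neg, of "side u v Lb z"] pos w unfolding Lb
    by (intro divide_neg_pos) (simp_all add: u_def v_def)
  finally show ?thesis using Lb by (simp add: form u_def v_def)
qed

lemma wmat_det:
  assumes "markov_basis A B C"
  shows "det (wmat (letter_mat A B C) w) = 1"
proof (induction w)
  case (Cons l w)
  then show ?case
    using markov_basis_half_turns[OF assms] by (cases l) (simp_all add: det_mul half_turn_det)
qed simp

text \<open>A half-turn carries the triangle's side of its geodesic beyond it, and a point beyond one side of the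
  triangle is not beyond any other.\<close>

lemma ping_pong:
  assumes mb: "markov_basis A B C" and w: "distinct_adj w" "w \<noteq> []"
    and z: "0 < Im z" "0 < side (line A) (line C) (last w) z"
  shows "side (line A) (line C) (hd w) (mob (wmat (letter_mat A B C) w) z) < 0"
  using w z(2)
proof (induction w)
  case (Cons l w)
  let ?E = "letter_mat A B C"
  have dl: "det (?E l) = 1" using markov_basis_half_turns[OF mb] by (cases l) (auto simp: half_turn_det)
  have Im: "0 < Im (mob (wmat ?E w) z)" using wmat_det[OF mb] z by (simp add: Im_mob_pos)
  have split: "mob (wmat ?E (l # w)) z = mob (?E l) (mob (wmat ?E w) z)"
    using dl wmat_det[OF mb] z by (simp add: mob_mult)
  show ?case
  proof (cases "w = []")
    case True
    then show ?thesis using Cons.prems side_swap[OF mb z(1)] by simp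
  next
    case False
    then have "side (line A) (line C) (hd w) (mob (wmat ?E w) z) < 0" "l \<noteq> hd w"
      using Cons by (auto simp: distinct_adj_Cons)
    then have "0 < side (line A) (line C) l (mob (wmat ?E w) z)"
      using side_other[OF basis_lines(1)[OF mb] Im] by force
    then show ?thesis unfolding split using side_swap[OF mb Im] by simp
  qed
qed simp

definition cyclic_word :: "letter list \<Rightarrow> bool" where
  "cyclic_word w \<longleftrightarrow> distinct_adj w \<and> w \<noteq> [] \<and> hd w \<noteq> last w"

text \<open>Iterating \<open>M\<close> keeps a point beyond the side of the first letter, so the limit of the orbit lies in
  the closed interval of this side. The end of the axis is irrational, the vertices of the triangle are not.\<close>

lemma axis_ends_in_gap:
  assumes mb: "markov_basis A B C" and w: "cyclic_word w"
    and \<sigma>: "axis M L \<sigma>" and M: "M = wmat (letter_mat A B C) w \<or> M = - wmat (letter_mat A B C) w"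
    and semi: "e \<in> {1, -1}" "0 < r" "\<And>t. \<sigma> t = semicircle x r (e * t + a)"
    and irr: "x + e * r \<notin> \<rat>"
  shows "in_gap (line A) (line C) (hd w) (x + e * r)"
proof -
  let ?E = "letter_mat A B C"
  let ?s = "side (line A) (line C)"
  have uv: "line A < line C" by (rule basis_lines(1)[OF mb])
  define z where "z = Complex ((line A + line C) / 2) (1 + (line C - line A))"
  have Im: "0 < Im z" using uv by (simp add: z_def)
  have base: "0 < ?s (last w) z"
  proof (cases "last w")
    case Lb
    have "(Re z - line A) * (Re z - line C) + (Im z)\<^sup>2
      = 1 + 2 * (line C - line A) + 3 / 4 * (line C - line A)\<^sup>2"
      by (simp add: z_def power2_eq_square field_simps)
    also have "\<dots> > 0" using uv by (simp add: add_pos_nonneg)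
    finally show ?thesis using Lb by simp
  qed (use uv in \<open>simp_all add: z_def field_simps\<close>)
  have Imk: "0 < Im ((mob M ^^ k) z)" for k
    using \<sigma> by (induction k) (simp_all add: Im Im_mob_pos axis_def)
  have step: "?s (hd w) (mob M y) < 0" if "0 < Im y" "0 < ?s (last w) y" for y
    using ping_pong[OF mb _ _ that] w M by (auto simp: cyclic_word_def)
  have orbit: "?s (hd w) ((mob M ^^ Suc k) z) < 0" for k
  proof (induction k)
    case 0
    then show ?case using step[OF Im base] by simp
  next
    case (Suc k)
    have "0 < ?s (last w) ((mob M ^^ Suc k) z)"
      using side_other[OF uv Imk less_imp_le[OF Suc]] w by (metis cyclic_word_def)
    from step[OF Imk this] show ?case by (simp only: funpow.simps o_apply)
  qed
  have conv: "(\<lambda>k. (mob M ^^ Suc k) z) \<longlonglongrightarrow> of_real (x + e * r)"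
    using LIMSEQ_Suc[OF orbit_converges[OF \<sigma> semi Im]] .
  have cont: "(\<lambda>k. ?s l ((mob M ^^ Suc k) z)) \<longlonglongrightarrow> ?s l (of_real (x + e * r))" for l
    by (cases l) (simp_all only: side.simps, (intro tendsto_intros conv)+)
  have le: "?s (hd w) (of_real (x + e * r)) \<le> 0"
    by (rule LIMSEQ_le_const2[OF cont]) (use orbit in \<open>auto intro: less_imp_le\<close>)
  have "line A \<in> \<rat>" "line C \<in> \<rat>" by (simp_all add: line_def)
  with irr have ne: "x + e * r \<noteq> line A" "x + e * r \<noteq> line C" by metis+
  show ?thesis
  proof (cases "hd w")
    case Lb
    with le have "(x + e * r - line A) * (x + e * r - line C) \<le> 0" by simp
    with ne uv show ?thesis using Lb by (auto simp: mult_le_0_iff)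
  qed (use le ne in auto)
qed

lemma wmat_rev:
  assumes "markov_basis A B C"
  shows "adj (wmat (letter_mat A B C) w) = wmat (letter_mat A B C) (rev w)
    \<or> adj (wmat (letter_mat A B C) w) = - wmat (letter_mat A B C) (rev w)"
proof (induction w)
  case (Cons l w)
  have "adj (letter_mat A B C l) = - letter_mat A B C l"
    using markov_basis_half_turns[OF assms] by (cases l) (simp_all add: half_turn_adj)
  with Cons show ?case by (auto simp: adj_mult wmat_append)
qed simp

text \<open>The other end of the axis is the attracting one of the inverse, whose word is reversed.\<close>

lemma axis_both_ends:
  assumes mb: "markov_basis A B C" and w: "cyclic_word w"
    and \<sigma>: "axis M L \<sigma>" and M: "M = wmat (letter_mat A B C) w \<or> M = - wmat (letter_mat A B C) w"
  obtains p q where "p \<noteq> q" "range \<sigma> = geo p q" "p \<notin> \<rat>" "q \<notin> \<rat>"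
    "in_gap (line A) (line C) (hd w) p" "in_gap (line A) (line C) (last w) q"
proof -
  obtain x r e a where semi: "e \<in> {1, -1}" "0 < r" "\<And>t. \<sigma> t = semicircle x r (e * t + a)"
    and dat: "M$2$1 \<noteq> 0" "2 * real_of_int (M$2$1) * x = M$1$1 - M$2$2"
    "4 * (real_of_int (M$2$1))\<^sup>2 * r\<^sup>2 = (real_of_int (trace2 M))\<^sup>2 - 4"
    using axis_semicircle[OF \<sigma>] by metis
  have irr: "x + r \<notin> \<rat>" "x - r \<notin> \<rat>"
    using axis_ends_irrational[OF dat(3,1) semi(2), of x "M$1$1 - M$2$2"] dat(2) by auto
  then have irr_e: "x + e * r \<notin> \<rat>" "x + - e * r \<notin> \<rat>" using semi(1) by auto
  have range: "range \<sigma> = geo (x + e * r) (x + - e * r)"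
  proof -
    have "range \<sigma> = geo (x - r) (x + r)"
      unfolding geo_center[OF semi(2)] by (rule axis_range[OF semi])
    then show ?thesis using semi(1) by (auto simp: geo_commute)
  qed
  have p: "in_gap (line A) (line C) (hd w) (x + e * r)"
    by (rule axis_ends_in_gap[OF mb w \<sigma> M semi irr_e(1)])
  have "in_gap (line A) (line C) (hd (rev w)) (x + - e * r)"
  proof (rule axis_ends_in_gap[OF mb _ axis_reverse[OF \<sigma>] _ _ semi(2) _ irr_e(2)])
    show "cyclic_word (rev w)" using w by (auto simp: cyclic_word_def hd_rev last_rev)
    show "adj M = wmat (letter_mat A B C) (rev w) \<or> adj M = - wmat (letter_mat A B C) (rev w)"
      using wmat_rev[OF mb, of w] M by auto
    show "\<sigma> (- t) = semicircle x r (- e * t + a)" for t by (simp add: semi(3))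
  qed (use semi(1) in auto)
  then have q: "in_gap (line A) (line C) (last w) (x + - e * r)" using w by (simp add: hd_rev cyclic_word_def)
  have "x + e * r \<noteq> x + - e * r" using semi(1,2) by auto
  then show thesis using that range irr_e p q by blast
qed

section \<open>Cyclic reduction\<close>

lemma wmat_parity:
  assumes mb: "markov_basis A B C"
  shows "even (length w) \<Longrightarrow> wmat (letter_mat A B C) w \<in> torus_matrices"
    "odd (length w) \<Longrightarrow> wmat (letter_mat A B C) w \<in> odd_matrices"
proof -
  have odd: "letter_mat A B C l \<in> odd_matrices" for l
    using markov_basis_odd[OF mb] by (cases l) auto
  have "if even (length w) then wmat (letter_mat A B C) w \<in> torus_matrices
    else wmat (letter_mat A B C) w \<in> odd_matrices"
  proof (induction w)
    case Nil
    show ?case by (simp add: torus_matrices_one)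
  next
    case (Cons l w)
    then show ?case using odd_mult_even[OF odd[of l]] odd_mult_odd[OF odd[of l]] by (auto split: if_splits)
  qed
  then show "even (length w) \<Longrightarrow> wmat (letter_mat A B C) w \<in> torus_matrices"
    "odd (length w) \<Longrightarrow> wmat (letter_mat A B C) w \<in> odd_matrices" by (auto split: if_splits)
qed

lemma not_distinct_adj:
  assumes "\<not> distinct_adj w"
  shows "\<exists>u l v. w = u @ [l, l] @ v"
  using assms
proof (induction w)
  case (Cons x w)
  show ?case
  proof (cases "distinct_adj w")
    case True
    with Cons.prems have "w \<noteq> []" "hd w = x" by (auto simp: distinct_adj_Cons)
    then have "x # w = [] @ [x, x] @ tl w" by (cases w) auto
    then show ?thesis by blast
  next
    case False
    then obtain u l v where "w = u @ [l, l] @ v" using Cons.IH by blast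
    then have "x # w = (x # u) @ [l, l] @ v" by simp
    then show ?thesis by blast
  qed
qed simp

text \<open>Two equal adjacent letters cancel, and conjugation by a letter that is both first and last shortens
  the word by two.\<close>

lemma cyclic_reduction_aux:
  assumes mb: "markov_basis A B C"
  defines "E \<equiv> letter_mat A B C"
  shows "even (length w) \<Longrightarrow> \<exists>N w'. (N \<in> torus_matrices \<or> N \<in> odd_matrices) \<and> even (length w') \<and>
    (w' = [] \<or> cyclic_word w') \<and>
    (wmat E w = N ** wmat E w' ** adj N \<or> wmat E w = - (N ** wmat E w' ** adj N))"
proof (induction "length w" arbitrary: w rule: less_induct)
  case less
  have ht: "half_turn (E l)" for l
    using markov_basis_half_turns[OF mb] by (cases l) (auto simp: E_def)
  have odd: "E l \<in> odd_matrices" for l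
    using markov_basis_odd[OF mb] by (cases l) (auto simp: E_def)
  consider "w = [] \<or> cyclic_word w" | "\<not> distinct_adj w" | "distinct_adj w" "w \<noteq> []" "hd w = last w"
    by (auto simp: cyclic_word_def)
  then show ?case
  proof cases
    case 1
    then show ?thesis using less.prems torus_matrices_one by (intro exI[of _ "mat 1"] exI[of _ w]) simp
  next
    case 2
    then obtain u l v where w: "w = u @ [l, l] @ v" using not_distinct_adj by blast
    have "wmat E w = - wmat E (u @ v)"
      by (simp add: w wmat_append half_turn_cancel[OF ht])
    moreover have "length (u @ v) < length w" "even (length (u @ v))" using less.prems by (auto simp: w)
    ultimately show ?thesis using less.hyps[of "u @ v"] by (metis minus_minus)
  next
    case 3
    obtain l w1 where w1: "w = l # w1" using 3(2) by (cases w) auto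
    then have "w1 \<noteq> []" using less.prems by auto
    then obtain u l' where u: "w1 = u @ [l']" by (metis append_butlast_last_id)
    then have w: "w = l # u @ [l]" using 3(3) w1 by simp
    have len: "length u < length w" "even (length u)" using less.prems by (auto simp: w)
    then obtain N w' where N: "N \<in> torus_matrices \<or> N \<in> odd_matrices" "even (length w')" "w' = [] \<or> cyclic_word w'"
      "wmat E u = N ** wmat E w' ** adj N \<or> wmat E u = - (N ** wmat E w' ** adj N)"
      using less.hyps by blast
    have "wmat E w = - (E l ** wmat E u ** adj (E l))"
      by (simp add: w wmat_append half_turn_adj[OF ht] matrix_mul_assoc)
    then have "wmat E w = (E l ** N) ** wmat E w' ** adj (E l ** N) \<or>
        wmat E w = - ((E l ** N) ** wmat E w' ** adj (E l ** N))"
      using N(4) by (auto simp: adj_mult matrix_mul_assoc)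
    moreover have "E l ** N \<in> torus_matrices \<or> E l ** N \<in> odd_matrices"
      using N(1) odd_mult_even[OF odd] odd_mult_odd[OF odd] by blast
    ultimately show ?thesis using N(2,3) by blast
  qed
qed

text \<open>The conjugating element can be taken in the group itself: rotating a cyclic word by one letter
  changes its parity.\<close>

lemma cyclic_reduction:
  assumes mb: "markov_basis A B C" and M: "M \<in> torus_matrices"
  defines "E \<equiv> letter_mat A B C"
  obtains N w where "N \<in> torus_matrices" "even (length w)" "w = [] \<or> cyclic_word w"
    "M = N ** wmat E w ** adj N \<or> M = - (N ** wmat E w ** adj N)"
proof -
  obtain w0 where w0: "even (length w0)" "M = wmat E w0 \<or> M = - wmat E w0"
    using mb M unfolding markov_basis_def E_def by blast
  obtain N w where N: "N \<in> torus_matrices \<or> N \<in> odd_matrices" "even (length w)" "w = [] \<or> cyclic_word w"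
    and w: "wmat E w0 = N ** wmat E w ** adj N \<or> wmat E w0 = - (N ** wmat E w ** adj N)"
    using cyclic_reduction_aux[OF mb w0(1)] unfolding E_def by blast
  have MN: "M = N ** wmat E w ** adj N \<or> M = - (N ** wmat E w ** adj N)" using w0(2) w by auto
  show thesis
  proof (cases "N \<in> torus_matrices")
    case True
    then show thesis using that N MN by blast
  next
    case False
    then have odd: "N \<in> odd_matrices" using N by blast
    have dN: "det N = 1" using odd by (rule odd_det)
    show thesis
    proof (cases "w = []")
      case True
      then have "M = mat 1 ** wmat E [] ** adj (mat 1) \<or> M = - (mat 1 ** wmat E [] ** adj (mat 1))"
        using MN dN by (simp add: mult_adj)
      then show thesis using that[of "mat 1" "[]"] torus_matrices_one by simp
    next
      case False
      then obtain l v where lv: "w = l # v" by (cases w) auto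
      have c: "cyclic_word w" using N(3) False by blast
      then have "v \<noteq> []" by (auto simp: cyclic_word_def lv)
      then have c': "cyclic_word (v @ [l])"
        using c by (auto simp: cyclic_word_def lv distinct_adj_append_iff distinct_adj_Cons)
      have El: "E l \<in> odd_matrices" "det (E l) = 1"
        using markov_basis_odd[OF mb] by (cases l; auto simp: E_def odd_det)+
      have "N ** wmat E w ** adj N = (N ** E l) ** wmat E (v @ [l]) ** adj (N ** E l)"
        using El by (simp add: lv wmat_append adj_mult mult_assoc_adj flip: matrix_mul_assoc)
      then show thesis
        using that[of "N ** E l" "v @ [l]"] odd_mult_odd[OF odd El(1)] N(2) c' MN by (simp add: lv)
    qed
  qed
qed


section \<open>Six corners around the cusp\<close>

definition spans :: "(real \<Rightarrow> complex) \<Rightarrow> real \<Rightarrow> real \<Rightarrow> bool" where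
  "spans \<sigma> s t \<longleftrightarrow> (\<exists>p q. (p, q) \<in> arcs \<sigma> \<and> p < s \<and> t < q)"

lemma spansI:
  assumes \<sigma>: "\<And>t. 0 < Im (\<sigma> t)" and M: "range (mob M \<circ> \<sigma>) = geo p q" "det M = 1" "det N = 1" "N ** M \<in> torus_matrices"
    and nz: "rden N p \<noteq> 0" "rden N q \<noteq> 0" and lt: "rmob N p < s" "s < t" "t < rmob N q"
  shows "spans \<sigma> s t"
proof -
  have "mob (N ** M) \<circ> \<sigma> = mob N \<circ> (mob M \<circ> \<sigma>)"
    using \<sigma> M by (simp add: fun_eq_iff mob_mult)
  then have "range (mob (N ** M) \<circ> \<sigma>) = mob N ` range (mob M \<circ> \<sigma>)" by (simp only: image_comp)
  also have "\<dots> = geo (rmob N p) (rmob N q)" unfolding M(1) using geo_mob[OF M(3) nz] .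
  finally have "(rmob N p, rmob N q) \<in> arcs \<sigma>" using M lt by (auto simp: arcs_def)
  then show ?thesis using lt by (auto simp: spans_def)
qed

lemma rmob_shift:
  assumes "rden M x \<noteq> 0"
  shows "rden (shift k ** M) x \<noteq> 0" "rmob (shift k ** M) x = rmob M x + of_int k"
  using assms by (simp_all add: rmob_def field_simps)

lemma trace_conj: "det M = 1 \<Longrightarrow> trace2 (M ** A ** adj M) = trace2 A"
proof -
  assume d: "det M = 1"
  have "trace2 (M ** A ** adj M) = det M * trace2 A" by (simp add: det_2 algebra_simps)
  with d show ?thesis by simp
qed

text \<open>The positive integer \<open>c\<close> is the absolute value of the lower left entry of the conjugated matrix,
  while the trace does not depend on the arc.\<close>

lemma arc_data:
  assumes \<sigma>: "simple_lift A L \<sigma>" and pq: "(p, q) \<in> arcs \<sigma>"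
  obtains c :: nat where "0 < c" "(q - p)\<^sup>2 * (real c)\<^sup>2 = (real_of_int (trace2 A))\<^sup>2 - 4"
    "p \<notin> \<rat>" "q \<notin> \<rat>" "p + q \<in> \<rat>"
proof -
  obtain M where M: "M \<in> torus_matrices" "range (mob M \<circ> \<sigma>) = geo p q" "p < q" using pq by (auto simp: arcs_def)
  let ?A = "M ** A ** adj M"
  have ax: "axis ?A L (mob M \<circ> \<sigma>)"
    using axis_mob \<sigma> M torus_matrices_det by (auto simp: simple_lift_def)
  obtain e r x a where s: "e \<in> {1, -1}" "0 < r" "\<And>t. (mob M \<circ> \<sigma>) t = semicircle x r (e * t + a)"
    "?A$2$1 \<noteq> 0" "2 * real_of_int (?A$2$1) * x = ?A$1$1 - ?A$2$2"
    "4 * (real_of_int (?A$2$1))\<^sup>2 * r\<^sup>2 = (real_of_int (trace2 ?A))\<^sup>2 - 4"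
    "\<bar>real_of_int (trace2 ?A)\<bar> = 2 * cosh (L / 2)" "0 < e * real_of_int (?A$2$1) * trace2 ?A"
    by (rule axis_semicircle[OF ax]) (rule that)
  have geo: "geo p q = geo (x - r) (x + r)"
    unfolding geo_center[OF s(2)] M(2)[symmetric] by (rule axis_range[OF s(1-3)])
  have "x - r < x + r" using s(2) by simp
  note pq = geo_inj[OF M(3) this geo]
  show thesis
  proof (rule that[of "nat \<bar>?A$2$1\<bar>"])
    show "0 < nat \<bar>?A$2$1\<bar>" using s(4) by simp
    have "(real (nat \<bar>?A$2$1\<bar>))\<^sup>2 = (real_of_int (?A$2$1))\<^sup>2" by simp
    moreover have "trace2 ?A = trace2 A" using M(1) by (intro trace_conj) (simp add: torus_matrices_det)
    ultimately show "(q - p)\<^sup>2 * (real (nat \<bar>?A$2$1\<bar>))\<^sup>2 = (real_of_int (trace2 A))\<^sup>2 - 4"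
      using s(6) unfolding pq by (simp only:) (simp add: power_mult_distrib mult_ac)
    show "p \<notin> \<rat>" "q \<notin> \<rat>"
      using axis_ends_irrational[OF s(6,4,2), of x "?A$1$1 - ?A$2$2"] s(5) pq by auto
    have "(p + q) * real_of_int (?A$2$1) = ?A$1$1 - ?A$2$2"
      unfolding s(5)[symmetric] pq by simp
    moreover have "real_of_int (?A$2$1) \<noteq> 0" using s(4) by (simp only: of_int_eq_0_iff not_False_eq_True)
    ultimately have "p + q = real_of_int (?A$1$1 - ?A$2$2) / real_of_int (?A$2$1)"
      using nonzero_eq_divide_eq by blast
    then show "p + q \<in> \<rat>" by (metis Rats_divide Rats_of_int)
  qed
qed

text \<open>The possible lengths of arcs are a constant divided by positive integers.\<close>

lemma longest_arc:
  assumes \<sigma>: "simple_lift A L \<sigma>" and sp: "spans \<sigma> s t"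
  obtains p q where "(p, q) \<in> arcs \<sigma>" "p < s" "t < q"
    "\<And>p' q'. (p', q') \<in> arcs \<sigma> \<Longrightarrow> p' < s \<Longrightarrow> t < q' \<Longrightarrow> q' - p' \<le> q - p"
proof -
  define K where "K = (real_of_int (trace2 A))\<^sup>2 - 4"
  define P where "P c \<longleftrightarrow> (\<exists>p q. (p, q) \<in> arcs \<sigma> \<and> p < s \<and> t < q \<and> 0 < c \<and> (q - p)\<^sup>2 * (real c)\<^sup>2 = K)" for c :: nat
  obtain p0 q0 where 0: "(p0, q0) \<in> arcs \<sigma>" "p0 < s" "t < q0" using sp by (auto simp: spans_def)
  obtain c0 :: nat where "0 < c0" "(q0 - p0)\<^sup>2 * (real c0)\<^sup>2 = K"
    using arc_data[OF \<sigma> 0(1)] unfolding K_def by metis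
  with 0 have "P c0" by (auto simp: P_def)
  then have least: "P (LEAST c. P c)" "\<And>c. P c \<Longrightarrow> (LEAST c. P c) \<le> c" by (auto intro: LeastI Least_le)
  define c where "c = (LEAST c. P c)"
  have "P c" using least(1) by (simp add: c_def)
  then obtain p q where pq: "(p, q) \<in> arcs \<sigma>" "p < s" "t < q" "0 < c" "(q - p)\<^sup>2 * (real c)\<^sup>2 = K"
    unfolding P_def by blast
  have "q' - p' \<le> q - p" if *: "(p', q') \<in> arcs \<sigma>" "p' < s" "t < q'" for p' q'
  proof (rule ccontr)
    assume not: "\<not> ?thesis"
    obtain c' :: nat where c': "0 < c'" "(q' - p')\<^sup>2 * (real c')\<^sup>2 = K"
      using arc_data[OF \<sigma> *(1)] unfolding K_def by metis
    with * have "P c'" by (auto simp: P_def)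
    then have "c \<le> c'" using least(2) by (simp add: c_def)
    have "0 < q - p" using pq(1) by (simp add: arcs_def)
    then have "((q - p) * c)\<^sup>2 < ((q' - p') * c')\<^sup>2"
      using not \<open>c \<le> c'\<close> pq(4) by (intro power_strict_mono mult_less_le_imp_less) auto
    then show False using pq(5) c'(2) by (simp add: power_mult_distrib)
  qed
  with pq that show thesis by blast
qed

lemma arcs_shift6:
  assumes "(p, q) \<in> arcs \<sigma>" "\<And>t. 0 < Im (\<sigma> t)"
  shows "(p + 6, q + 6) \<in> arcs \<sigma>"
  using arcs_torus[OF assms(1) shift_6] assms by (auto simp: rmob_def arcs_def)

text \<open>Longest arcs over adjacent intervals have a point in common, hence are nested, hence equal, because the
  outer one competes with the inner one. So one arc goes over all six intervals; it is wider
  than 6 and crosses its translate by 6.\<close>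

lemma no_arcs_around_cusp:
  assumes \<sigma>: "simple_lift A L \<sigma>" and sp: "\<And>i. i < 6 \<Longrightarrow> spans \<sigma> (s i) (s (Suc i))"
    and mono: "\<And>i. i < 6 \<Longrightarrow> s i < s (Suc i)" and s6: "s 6 = s 0 + (6::real)"
  shows False
proof -
  have Im: "0 < Im (\<sigma> t)" for t using \<sigma> axis_Im by (auto simp: simple_lift_def)
  have "\<exists>p q. (p, q) \<in> arcs \<sigma> \<and> p < s i \<and> s (Suc i) < q \<and>
      (\<forall>p' q'. (p', q') \<in> arcs \<sigma> \<longrightarrow> p' < s i \<longrightarrow> s (Suc i) < q' \<longrightarrow> q' - p' \<le> q - p)" if "i < 6" for i
    using longest_arc[OF \<sigma> sp[OF that]] by metis
  then obtain p q where pq: "\<And>i. i < 6 \<Longrightarrow> (p i, q i) \<in> arcs \<sigma>" "\<And>i. i < 6 \<Longrightarrow> p i < s i"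
    "\<And>i. i < 6 \<Longrightarrow> s (Suc i) < q i"
    and max: "\<And>i p' q'. i < 6 \<Longrightarrow> (p', q') \<in> arcs \<sigma> \<Longrightarrow> p' < s i \<Longrightarrow> s (Suc i) < q' \<Longrightarrow> q' - p' \<le> q i - p i"
    by metis
  have eq: "p (Suc i) = p i \<and> q (Suc i) = q i" if i: "i < 5" for i
  proof -
    have "p i < s (Suc i)" "p (Suc i) < s (Suc i)" "s (Suc i) < q i" "s (Suc i) < q (Suc i)"
      using pq(2)[of i] pq(2,3)[of "Suc i"] pq(3)[of i] mono[of i] mono[of "Suc i"] i by simp_all
    then consider "p i \<le> p (Suc i)" "q (Suc i) \<le> q i" | "p (Suc i) \<le> p i" "q i \<le> q (Suc i)"
      using arcs_noncrossing[OF \<sigma> pq(1)[of i] pq(1)[of "Suc i"], of "s (Suc i)"] i by auto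
    then show ?thesis
    proof cases
      case 1
      then have "q i - p i \<le> q (Suc i) - p (Suc i)"
        using max[of "Suc i" "p i" "q i"] pq(1,2)[of i] pq(3)[of "Suc i"] mono[of i] i by simp
      with 1 show ?thesis by simp
    next
      case 2
      then have "q (Suc i) - p (Suc i) \<le> q i - p i"
        using max[of i "p (Suc i)" "q (Suc i)"] pq(2,3)[of i] pq(1)[of "Suc i"] i by simp
      with 2 show ?thesis by simp
    qed
  qed
  have "p 5 = p 0" "q 5 = q 0" using eq[of 0] eq[of 1] eq[of 2] eq[of 3] eq[of 4] by (simp_all add: eval_nat_numeral)
  then have "p 0 < s 0" "s 0 + 6 < q 0" "(p 0, q 0) \<in> arcs \<sigma>"
    using pq(1,2)[of 0] pq(3)[of 5] s6 by (simp_all add: eval_nat_numeral)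
  then show False
    using arcs_noncrossing[OF \<sigma> _ arcs_shift6, of "p 0" "q 0" "p 0" "q 0" "s 0 + 6"] Im by auto
qed

text \<open>A lift that crosses two sides of the base triangle cuts off the corner between them. If this corner is
  not at infinity, the half-turn \<open>A\<close> or \<open>C\<close> carries it there. The parity of \<open>M\<close>
  decides whether this or its translate by 3 is realized by the group of the torus.\<close>

lemma corner_spans:
  assumes mb: "markov_basis A B C" and \<sigma>: "\<And>t. 0 < Im (\<sigma> t)"
    and M: "M \<in> torus_matrices \<or> M \<in> odd_matrices" "range (mob M \<circ> \<sigma>) = geo p q"
    and gap: "in_gap (line A) (line C) l p" "in_gap (line A) (line C) l' q"
  defines "u \<equiv> line A" and "v \<equiv> line C"
    and "u' \<equiv> line C + 1 / ((real_of_int (C$2$1))\<^sup>2 * (line C - line A))"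
  shows "l = La \<Longrightarrow> l' = Lc \<Longrightarrow> if M \<in> torus_matrices then spans \<sigma> u v else spans \<sigma> (u + 3) (v + 3)"
    "l = Lb \<Longrightarrow> l' = Lc \<Longrightarrow> if M \<in> torus_matrices then spans \<sigma> (v + 3) (u' + 3) else spans \<sigma> v u'"
    "l = La \<Longrightarrow> l' = Lb \<Longrightarrow> if M \<in> torus_matrices then spans \<sigma> u' (u + 3) else spans \<sigma> (u' + 3) (u + 6)"
    "v < u'" "u' < u + 3"
proof -
  note ht = markov_basis_half_turns[OF mb]
  define a where "a = real_of_int (A$2$1)"
  define b where "b = real_of_int (B$2$1)"
  define c where "c = real_of_int (C$2$1)"
  note L = basis_lines[OF mb, folded a_def b_def c_def u_def v_def]
  have u': "u' = v + 1 / (c\<^sup>2 * (v - u))" by (simp add: u'_def v_def u_def c_def)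
  have "1 / (a\<^sup>2 * (v - u)) + 1 / (c\<^sup>2 * (v - u)) = b / (a * c)"
    unfolding L(6) using L(7-9) by (simp add: divide_simps power2_eq_square add_pos_pos) (simp add: algebra_simps)
  then have u'': "u' = u + 3 - 1 / (a\<^sup>2 * (v - u))" unfolding u' using L(2) by simp
  have pos: "0 < 1 / (c\<^sup>2 * (v - u))" "0 < 1 / (a\<^sup>2 * (v - u))" using L(1,7-9) by simp_all
  show vu: "v < u'" unfolding u' using pos by simp
  show uu: "u' < u + 3" unfolding u'' using pos by simp
  have dM: "det M = 1" using M torus_matrices_det odd_det by blast
  have odd3: "shift 3 ** M \<in> torus_matrices" if "M \<notin> torus_matrices"
    using odd_mult_odd[OF shift_3_odd(1)] M that by blast
  show "if M \<in> torus_matrices then spans \<sigma> u v else spans \<sigma> (u + 3) (v + 3)" if "l = La" "l' = Lc"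
  proof (cases "M \<in> torus_matrices")
    case True
    have "spans \<sigma> u v"
      by (rule spansI[OF \<sigma> M(2) dM, of "mat 1"]) (use True that gap L(1) in \<open>auto simp: rmob_def u_def v_def\<close>)
    with True show ?thesis by simp
  next
    case False
    have "spans \<sigma> (u + 3) (v + 3)"
      by (rule spansI[OF \<sigma> M(2) dM, of "shift 3"])
         (use odd3[OF False] that gap L(1) in \<open>auto simp: rmob_def u_def v_def\<close>)
    with False show ?thesis by simp
  qed
  have inv_less: "1 / (k\<^sup>2 * y) < 1 / (k\<^sup>2 * x)" if "0 < k" "0 < x" "x < y" for k x y :: real
    using that by (intro divide_strict_left_mono mult_strict_left_mono mult_pos_pos) auto
  show "if M \<in> torus_matrices then spans \<sigma> (v + 3) (u' + 3) else spans \<sigma> v u'" if l: "l = Lb" "l' = Lc"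
  proof -
    have gp: "u < p" "p < v" "v < q" using gap l by (auto simp: u_def v_def)
    have nz: "rden C p \<noteq> 0" "rden C q \<noteq> 0" using half_turn_rmob(1)[OF ht(3)] gp by (auto simp: v_def)
    have "rmob C p = v - 1 / (c\<^sup>2 * (p - v))" "rmob C q = v - 1 / (c\<^sup>2 * (q - v))"
      using half_turn_rmob(2)[OF ht(3)] gp by (auto simp: v_def c_def)
    moreover have "c\<^sup>2 * (p - v) = - (c\<^sup>2 * (v - p))" by (simp add: algebra_simps)
    ultimately have rm: "rmob C p = v + 1 / (c\<^sup>2 * (v - p))" "rmob C q = v - 1 / (c\<^sup>2 * (q - v))" by simp_all
    have "1 / (c\<^sup>2 * (v - u)) < 1 / (c\<^sup>2 * (v - p))" using L(9) gp by (intro inv_less) auto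
    then have lt: "u' < rmob C p" unfolding rm u' by simp
    have "0 < 1 / (c\<^sup>2 * (q - v))" using L(9) gp by simp
    then have gt: "rmob C q < v" unfolding rm by simp
    have M': "range (mob M \<circ> \<sigma>) = geo q p" using M(2) geo_commute by simp
    show ?thesis
    proof (cases "M \<in> torus_matrices")
      case True
      have "(shift 3 ** C) ** M \<in> torus_matrices"
        using torus_matrices_mult[OF odd_mult_odd[OF shift_3_odd(1) markov_basis_odd(3)[OF mb]] True] .
      then have "spans \<sigma> (v + 3) (u' + 3)"
        using lt gt vu rmob_shift[OF nz(1), of 3] rmob_shift[OF nz(2), of 3] ht
        by (intro spansI[OF \<sigma> M' dM, of "shift 3 ** C"]) (simp_all add: det_mul half_turn_det)
      with True show ?thesis by simp
    next
      case False
      then have "C ** M \<in> torus_matrices" using M odd_mult_odd[OF markov_basis_odd(3)[OF mb]] by blast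
      then have "spans \<sigma> v u'"
        using lt gt vu nz ht by (intro spansI[OF \<sigma> M' dM, of C]) (simp_all add: half_turn_det)
      with False show ?thesis by simp
    qed
  qed
  show "if M \<in> torus_matrices then spans \<sigma> u' (u + 3) else spans \<sigma> (u' + 3) (u + 6)" if l: "l = La" "l' = Lb"
  proof -
    have gp: "p < u" "u < q" "q < v" using gap l by (auto simp: u_def v_def)
    have nz: "rden A p \<noteq> 0" "rden A q \<noteq> 0" using half_turn_rmob(1)[OF ht(1)] gp by (auto simp: u_def)
    have "rmob A p = u - 1 / (a\<^sup>2 * (p - u))" "rmob A q = u - 1 / (a\<^sup>2 * (q - u))"
      using half_turn_rmob(2)[OF ht(1)] gp by (auto simp: u_def a_def)
    moreover have "a\<^sup>2 * (p - u) = - (a\<^sup>2 * (u - p))" by (simp add: algebra_simps)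
    ultimately have rm: "rmob A p = u + 1 / (a\<^sup>2 * (u - p))" "rmob A q = u - 1 / (a\<^sup>2 * (q - u))" by simp_all
    have "1 / (a\<^sup>2 * (v - u)) < 1 / (a\<^sup>2 * (q - u))" using L(7) gp by (intro inv_less) auto
    then have lt: "rmob A q < u' - 3" unfolding rm u'' by simp
    have "0 < 1 / (a\<^sup>2 * (u - p))" using L(7) gp by simp
    then have gt: "u < rmob A p" unfolding rm by simp
    have M': "range (mob M \<circ> \<sigma>) = geo q p" using M(2) geo_commute by simp
    show ?thesis
    proof (cases "M \<in> torus_matrices")
      case True
      have "(shift 3 ** A) ** M \<in> torus_matrices"
        using torus_matrices_mult[OF odd_mult_odd[OF shift_3_odd(1) markov_basis_odd(1)[OF mb]] True] .
      then have "spans \<sigma> u' (u + 3)"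
        using lt gt uu rmob_shift[OF nz(1), of 3] rmob_shift[OF nz(2), of 3] ht
        by (intro spansI[OF \<sigma> M' dM, of "shift 3 ** A"]) (simp_all add: det_mul half_turn_det)
      with True show ?thesis by simp
    next
      case False
      then have "A ** M \<in> torus_matrices" using M odd_mult_odd[OF markov_basis_odd(1)[OF mb]] by blast
      then have "(shift 6 ** A) ** M \<in> torus_matrices"
        using torus_matrices_mult[OF shift_6] by (simp flip: matrix_mul_assoc)
      then have "spans \<sigma> (u' + 3) (u + 6)"
        using lt gt uu rmob_shift[OF nz(1), of 6] rmob_shift[OF nz(2), of 6] ht
        by (intro spansI[OF \<sigma> M' dM, of "shift 6 ** A"]) (simp_all add: det_mul half_turn_det)
      with False show ?thesis by simp
    qed
  qed
qed

text \<open>The letters on both sides of the position \<open>k\<close>, between 1 and the length; at the end of the word the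
  index wraps around.\<close>

definition corner :: "letter list \<Rightarrow> nat \<Rightarrow> letter set" where
  "corner w k = {w ! (k - 1), w ! (k mod length w)}"

lemma hd_last_rotate:
  assumes "1 \<le> k" "k \<le> length w"
  shows "hd (drop k w @ take k w) = w ! (k mod length w)" "last (drop k w @ take k w) = w ! (k - 1)"
proof -
  have "w \<noteq> []" using assms by auto
  show "hd (drop k w @ take k w) = w ! (k mod length w)"
  proof (cases "k = length w")
    case True
    then show ?thesis using \<open>w \<noteq> []\<close> by (simp add: hd_conv_nth)
  next
    case False
    then show ?thesis using assms by (simp add: hd_append hd_drop_conv_nth)
  qed
  show "last (drop k w @ take k w) = w ! (k - 1)"
    using assms \<open>w \<noteq> []\<close> by (simp add: last_append last_conv_nth)
qed

lemma cyclic_word_rotate: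
  assumes w: "cyclic_word w" and k: "1 \<le> k" "k \<le> length w"
  shows "cyclic_word (drop k w @ take k w)"
proof (cases "k = length w")
  case True
  then show ?thesis using w by simp
next
  case False
  then have ne: "take k w \<noteq> []" "drop k w \<noteq> []" using k by auto
  have w': "w = take k w @ drop k w" by simp
  have d: "distinct_adj (take k w)" "distinct_adj (drop k w)" "last (take k w) \<noteq> hd (drop k w)"
    using w ne unfolding cyclic_word_def by (metis distinct_adj_append_iff w')+
  have "hd (take k w) \<noteq> last (drop k w)"
    using w ne unfolding cyclic_word_def by (metis hd_append2 last_appendR w')
  then show ?thesis
    using d ne by (auto simp: cyclic_word_def distinct_adj_append_iff)
qed

text \<open>Conjugation by a prefix rotates the word, and the axis of the rotated word passes the base triangle
  between the sides of its first and its last letter.\<close>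

lemma corner_of_lift:
  assumes mb: "markov_basis A B C" and \<sigma>: "axis M L \<sigma>"
    and w: "cyclic_word w" "M = wmat (letter_mat A B C) w \<or> M = - wmat (letter_mat A B C) w"
    and k: "1 \<le> k" "k \<le> length w"
  defines "K \<equiv> adj (wmat (letter_mat A B C) (take k w))"
  obtains p q where "range (mob K \<circ> \<sigma>) = geo p q"
    "in_gap (line A) (line C) (w ! (k mod length w)) p" "in_gap (line A) (line C) (w ! (k - 1)) q"
proof -
  let ?E = "letter_mat A B C"
  have dT: "det (wmat ?E (take k w)) = 1" by (rule wmat_det[OF mb])
  have split: "wmat ?E w = wmat ?E (take k w) ** wmat ?E (drop k w)" by (simp flip: wmat_append)
  have "K ** wmat ?E w ** adj K = wmat ?E (drop k w @ take k w)"
    unfolding split K_def using dT by (simp add: mult_assoc_adj wmat_append matrix_mul_assoc)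
       (simp add: mult_adj)
  then have KM: "K ** M ** adj K = wmat ?E (drop k w @ take k w) \<or> K ** M ** adj K = - wmat ?E (drop k w @ take k w)"
    using w(2) by auto
  have "axis (K ** M ** adj K) L (mob K \<circ> \<sigma>)"
    by (rule axis_mob[OF \<sigma>]) (simp add: K_def dT)
  from axis_both_ends[OF mb cyclic_word_rotate[OF w(1) k] this KM] show thesis
    using that hd_last_rotate[OF k] by metis
qed

text \<open>Otherwise there are arcs over the six strips between the consecutive points \<open>u\<close>, \<open>v\<close>, \<open>u'\<close> and
  their translates by 3.\<close>

lemma some_corner_missing:
  assumes mb: "markov_basis A B C" and \<sigma>: "simple_lift M L \<sigma>"
    and w: "cyclic_word w" "even (length w)" "M = wmat (letter_mat A B C) w \<or> M = - wmat (letter_mat A B C) w"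
  obtains P b where "P \<in> {{La, Lb}, {Lb, Lc}, {La, Lc}}"
    "\<And>k. 1 \<le> k \<Longrightarrow> k \<le> length w \<Longrightarrow> even k = b \<Longrightarrow> corner w k \<noteq> P"
proof (rule ccontr)
  assume not: "\<not> thesis"
  note obtained = that
  have all: "\<exists>k. 1 \<le> k \<and> k \<le> length w \<and> even k = b \<and> corner w k = P"
    if "P \<in> {{La, Lb}, {Lb, Lc}, {La, Lc}}" for P b
    using obtained[OF that, of b] not by blast
  have ax: "axis M L \<sigma>" using \<sigma> by (simp add: simple_lift_def)
  note Im = axis_Im[OF ax]
  let ?T = torus_matrices
  define u where "u = line A"
  define v where "v = line C"
  define u' where "u' = line C + 1 / ((real_of_int (C$2$1))\<^sup>2 * (line C - line A))"
  have get: "\<exists>K p q. (if b then K \<in> ?T else K \<in> odd_matrices \<and> K \<notin> ?T) \<and>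
      range (mob K \<circ> \<sigma>) = geo p q \<and> in_gap (line A) (line C) l p \<and> in_gap (line A) (line C) l' q"
    if P: "{l, l'} \<in> {{La, Lb}, {Lb, Lc}, {La, Lc}}" for l l' b
  proof -
    obtain k where k: "1 \<le> k" "k \<le> length w" "even k = b" "corner w k = {l, l'}" using all[OF P] by blast
    let ?K = "adj (wmat (letter_mat A B C) (take k w))"
    obtain p q where pq: "range (mob ?K \<circ> \<sigma>) = geo p q"
      "in_gap (line A) (line C) (w ! (k mod length w)) p" "in_gap (line A) (line C) (w ! (k - 1)) q"
      using corner_of_lift[OF mb ax w(1,3) k(1,2)] by metis
    have par: "if b then ?K \<in> ?T else ?K \<in> odd_matrices"
      using wmat_parity[OF mb, of "take k w"] k by (auto simp: torus_matrices_adj odd_adj)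
    have ne: "?K \<notin> ?T" if "\<not> b"
    proof
      assume K: "?K \<in> ?T"
      have "?K \<in> odd_matrices" using par that by simp
      from odd_mult_even[OF this torus_matrices_adj[OF K]] have "mat 1 \<in> odd_matrices"
        using torus_matrices_det[OF K] by (simp add: mult_adj)
      from even_mult_odd[OF _ this] have "shift 3 ** shift (- 3) \<in> odd_matrices" by (simp add: shift_mult \<open>mat 1 \<in> odd_matrices\<close>)
      then have "shift 3 \<in> ?T" using \<open>mat 1 \<in> odd_matrices\<close> by (simp add: odd_matrices_def)
      then show False using torus_matrices_mod2(2)[of "shift 3"] by simp
    qed
    have "w ! (k - 1) = l \<and> w ! (k mod length w) = l' \<or> w ! (k - 1) = l' \<and> w ! (k mod length w) = l"
      using k(4) by (auto simp: corner_def doubleton_eq_iff)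
    then show ?thesis
    proof
      assume "w ! (k - 1) = l' \<and> w ! (k mod length w) = l"
      then show ?thesis using pq par ne by (intro exI[of _ ?K] exI[of _ p] exI[of _ q]) auto
    next
      assume "w ! (k - 1) = l \<and> w ! (k mod length w) = l'"
      then show ?thesis using pq par ne geo_commute
        by (intro exI[of _ ?K] exI[of _ q] exI[of _ p]) auto
    qed
  qed
  obtain K p q where K: "K \<in> ?T" "range (mob K \<circ> \<sigma>) = geo p q"
    "in_gap (line A) (line C) La p" "in_gap (line A) (line C) Lc q"
    using get[of La Lc True] by auto
  have order: "v < u'" "u' < u + 3" and s0: "spans \<sigma> u v"
    using corner_spans[OF mb Im _ K(2-4)] K(1) by (auto simp: u_def v_def u'_def)
  obtain K p q where K: "K \<in> odd_matrices" "K \<notin> ?T" "range (mob K \<circ> \<sigma>) = geo p q"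
    "in_gap (line A) (line C) La p" "in_gap (line A) (line C) Lc q"
    using get[of La Lc False] by auto
  have s3: "spans \<sigma> (u + 3) (v + 3)"
    using corner_spans(1)[OF mb Im _ K(3-5)] K(1,2) by (auto simp: u_def v_def)
  obtain K p q where K: "K \<in> ?T" "range (mob K \<circ> \<sigma>) = geo p q"
    "in_gap (line A) (line C) Lb p" "in_gap (line A) (line C) Lc q"
    using get[of Lb Lc True] by auto
  have s4: "spans \<sigma> (v + 3) (u' + 3)"
    using corner_spans(2)[OF mb Im _ K(2-4)] K(1) by (auto simp: v_def u'_def)
  obtain K p q where K: "K \<in> odd_matrices" "K \<notin> ?T" "range (mob K \<circ> \<sigma>) = geo p q"
    "in_gap (line A) (line C) Lb p" "in_gap (line A) (line C) Lc q"
    using get[of Lb Lc False] by auto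
  have s1: "spans \<sigma> v u'"
    using corner_spans(2)[OF mb Im _ K(3-5)] K(1,2) by (auto simp: v_def u'_def)
  obtain K p q where K: "K \<in> ?T" "range (mob K \<circ> \<sigma>) = geo p q"
    "in_gap (line A) (line C) La p" "in_gap (line A) (line C) Lb q"
    using get[of La Lb True] by auto
  have s2: "spans \<sigma> u' (u + 3)"
    using corner_spans(3)[OF mb Im _ K(2-4)] K(1) by (auto simp: u_def u'_def)
  obtain K p q where K: "K \<in> odd_matrices" "K \<notin> ?T" "range (mob K \<circ> \<sigma>) = geo p q"
    "in_gap (line A) (line C) La p" "in_gap (line A) (line C) Lb q"
    using get[of La Lb False] by auto
  have s5: "spans \<sigma> (u' + 3) (u + 6)"
    using corner_spans(3)[OF mb Im _ K(3-5)] K(1,2) by (auto simp: u_def u'_def)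
  have uv: "u < v" using basis_lines(1)[OF mb] by (simp add: u_def v_def)
  let ?s = "\<lambda>i. [u, v, u', u + 3, v + 3, u' + 3, u + 6] ! i"
  have lt6: "i < 6 \<longleftrightarrow> i \<in> {0, 1, 2, 3, 4, 5 :: nat}" for i by auto
  show False
  proof (rule no_arcs_around_cusp[OF \<sigma>, of ?s])
    show "spans \<sigma> (?s i) (?s (Suc i))" if "i < 6" for i
      using that s0 s1 s2 s3 s4 s5 unfolding lt6 by (auto simp: eval_nat_numeral)
    show "?s i < ?s (Suc i)" if "i < 6" for i
      using that order uv unfolding lt6 by (auto simp: eval_nat_numeral)
  qed simp
qed


section \<open>The classification in a homology class\<close>

text \<open>Pairing the positions in one way shows that half of the values are 1, so that in the
  other way of pairing no pair can consist of zeros.\<close>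

lemma alternating_sequence:
  fixes h :: "nat \<Rightarrow> nat"
  assumes per: "h (2 * m) = h 0" and one: "\<And>j. j < m \<Longrightarrow> h (2 * j) + h (2 * j + 1) = 1"
    and le: "\<And>j. j < m \<Longrightarrow> h (2 * j + 1) + h (2 * j + 2) \<le> 1" and j: "j < m"
  shows "h (2 * j) = h 0" "h (2 * j + 1) = 1 - h 0"
proof -
  have sum: "(\<Sum>j<k. h (2 * j + 1) + h (2 * j + 2)) + h 0 = (\<Sum>j<k. h (2 * j) + h (2 * j + 1)) + h (2 * k)" for k
    by (induction k) simp_all
  have "(\<Sum>j<m. h (2 * j + 1) + h (2 * j + 2)) = m"
    using sum[of m] per one by simp
  then have eq: "h (2 * j + 1) + h (2 * j + 2) = 1" if "j < m" for j
  proof -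
    have "(\<Sum>j<m. 1 - (h (2 * j + 1) + h (2 * j + 2))) = (\<Sum>j<m. 1) - (\<Sum>j<m. h (2 * j + 1) + h (2 * j + 2))"
      by (rule sum_subtractf_nat) (use le in auto)
    also have "\<dots> = 0" using \<open>(\<Sum>j<m. h (2 * j + 1) + h (2 * j + 2)) = m\<close> by simp
    finally have "1 - (h (2 * j + 1) + h (2 * j + 2)) = 0" using that by simp
    with le[OF that] show ?thesis by linarith
  qed
  have even: "h (2 * j) = h 0" if "j < m" for j
    using that
  proof (induction j)
    case (Suc j)
    have "2 * Suc j = 2 * j + 2" by simp
    then show ?case using one[of j] eq[of j] Suc by (metis Suc_lessD add_left_cancel add.commute)
  qed simp
  then show "h (2 * j) = h 0" using j .
  then show "h (2 * j + 1) = 1 - h 0" using one[OF j] by simp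
qed

text \<open>The sequence \<open>g\<close> indicates the letter \<open>l\<close>. Two neighbours are never both \<open>l\<close>, and the hypothesis
  gives one \<open>l\<close> in each pair of one parity.\<close>

lemma alternating_word:
  assumes w: "cyclic_word w" "length w = 2 * m"
    and miss: "\<And>k. 1 \<le> k \<Longrightarrow> k \<le> length w \<Longrightarrow> even k = b \<Longrightarrow> l \<in> corner w k"
  shows "(\<forall>i<length w. w ! i = l \<longleftrightarrow> even i) \<or> (\<forall>i<length w. w ! i = l \<longleftrightarrow> odd i)"
proof -
  define N where "N = length w"
  have "0 < length w" using w(1) by (simp add: cyclic_word_def)
  then have N: "0 < N" "N = 2 * m" using w(2) by (simp_all only: N_def)
  define g where "g i = (if w ! (i mod N) = l then 1 else 0 :: nat)" for i
  have g01: "g i \<le> 1" for i by (simp add: g_def)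
  have adj: "w ! (i mod N) \<noteq> w ! (Suc i mod N)" for i
  proof (cases "Suc (i mod N) < N")
    case True
    then have "Suc i mod N = Suc (i mod N)" using mod_Suc[of i N] by simp
    then show ?thesis
      using w(1) True by (simp add: cyclic_word_def distinct_adj_conv_nth N_def)
  next
    case False
    then have e: "i mod N = N - 1" using N(1) mod_less_divisor[of N i] by linarith
    then have "Suc i mod N = 0" using mod_Suc[of i N] N(1) by simp
    then show ?thesis using w(1) e by (auto simp: cyclic_word_def hd_conv_nth last_conv_nth N_def)
  qed
  have le: "g i + g (Suc i) \<le> 1" for i using adj[of i] by (auto simp: g_def)
  have per: "g (i + N) = g i" for i by (simp add: g_def)
  have ge: "g i + g (Suc i) = 1" if "odd i = b" "i < N" for i
  proof -
    have "l \<in> corner w (Suc i)" by (rule miss) (use that in \<open>auto simp: N_def\<close>)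
    then have "w ! i = l \<or> w ! (Suc i mod N) = l" by (auto simp: corner_def N_def)
    then have "1 \<le> g i + g (Suc i)" using that(2) by (auto simp: g_def)
    with le[of i] show ?thesis by simp
  qed
  have alt: "g (Suc i) = 1 - g i" for i
  proof -
    define e where "e = (if b then 1 else 0 :: nat)"
    define h where "h i = g (i + e)" for i
    have one: "h (2 * j) + h (2 * j + 1) = 1" if "j < m" for j
      using ge[of "2 * j + e"] that N by (auto simp: h_def e_def)
    have "h (2 * m) = h 0" using per[of e] N by (simp add: h_def add.commute)
    have h: "h (2 * j) = h 0" "h (2 * j + 1) = 1 - h 0" if "j < m" for j
      using alternating_sequence[OF \<open>h (2 * m) = h 0\<close> one _ that] le by (auto simp: h_def)
    have hper: "h (i mod N) = h i" for i
    proof -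
      have "g (i mod N + e) = g (i + e)" unfolding g_def by (simp add: mod_simps)
      then show ?thesis by (simp add: h_def)
    qed
    have hpar: "h i = (if even i then h 0 else 1 - h 0)" for i
    proof -
      have "i mod N < 2 * m" using N mod_less_divisor by metis
      have "even (i mod N) \<longleftrightarrow> even i" using N by (simp add: dvd_mod_iff)
      moreover have "h (i mod N) = (if even (i mod N) then h 0 else 1 - h 0)"
      proof (cases "even (i mod N)")
        case True
        then obtain j where "i mod N = 2 * j" by blast
        then show ?thesis using h(1)[of j] \<open>i mod N < 2 * m\<close> True by simp
      next
        case False
        then obtain j where "i mod N = 2 * j + 1" by (metis oddE)
        then show ?thesis using h(2)[of j] \<open>i mod N < 2 * m\<close> False by simp
      qed
      ultimately show ?thesis using hper by simp
    qed
    have "g (i + N) = h (i + N - e)" "g (Suc i + N) = h (Suc i + N - e)"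
      using N(1) by (simp_all add: h_def e_def)
    moreover have "even (Suc i + N - e) \<longleftrightarrow> odd (i + N - e)" using N(1) by (simp add: e_def)
    moreover have "h 0 \<le> 1" using g01 by (simp add: h_def)
    ultimately show ?thesis unfolding per using hpar[of "i + N - e"] hpar[of "Suc i + N - e"] by auto
  qed
  have gi: "g i = (if even i then g 0 else 1 - g 0)" for i
  proof (induction i)
    case (Suc i)
    have "1 - (1 - g 0) = g 0" using g01[of 0] by linarith
    then show ?case unfolding alt Suc by simp
  qed simp
  have wi: "w ! i = l \<longleftrightarrow> g i = 1" if "i < length w" for i
    using that by (simp add: g_def N_def)
  have "g 0 = 0 \<or> g 0 = 1" using g01[of 0] by linarith
  then show ?thesis
  proof
    assume g0: "g 0 = 0"
    have "w ! i = l \<longleftrightarrow> odd i" if "i < length w" for i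
      using wi[OF that] gi[of i] unfolding g0 by simp
    then show ?thesis by blast
  next
    assume g0: "g 0 = 1"
    have "w ! i = l \<longleftrightarrow> even i" if "i < length w" for i
      using wi[OF that] gi[of i] unfolding g0 by simp
    then show ?thesis by blast
  qed
qed

text \<open>The signs alternate, beginning with plus.\<close>

primrec sgn_count :: "letter \<Rightarrow> letter list \<Rightarrow> int" where
  "sgn_count l [] = 0"
| "sgn_count l (x # w) = of_bool (x = l) - sgn_count l w"

lemma sgn_count_alternating:
  assumes "even (length w)" "\<And>i. i < length w \<Longrightarrow> w ! i = l0 \<longleftrightarrow> even i = b"
  shows "sgn_count l w = (if (l = l0) = b then int (count_list w l) else - int (count_list w l))"
    "2 * count_list w l0 = length w"
proof -
  have "sgn_count l w = (if (l = l0) = b then int (count_list w l) else - int (count_list w l)) \<and>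
    2 * count_list w l0 = length w"
    using assms
  proof (induction w rule: induct_list012)
    case (3 x y w)
    have "w ! i = l0 \<longleftrightarrow> even i = b" if "i < length w" for i
      using "3.prems"(2)[of "Suc (Suc i)"] that by simp
    then have IH: "sgn_count l w = (if (l = l0) = b then int (count_list w l) else - int (count_list w l))"
      "2 * count_list w l0 = length w"
      using "3.IH"(1) "3.prems"(1) by auto
    have "x = l0 \<longleftrightarrow> b" "y = l0 \<longleftrightarrow> \<not> b"
      using "3.prems"(2)[of 0] "3.prems"(2)[of 1] by auto
    with IH show ?case by auto
  qed simp_all
  then show "sgn_count l w = (if (l = l0) = b then int (count_list w l) else - int (count_list w l))"
    "2 * count_list w l0 = length w" by auto
qed

lemma count_letters: "count_list w La + count_list w Lb + count_list w Lc = length w"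
proof (induction w)
  case (Cons l w)
  then show ?case by (cases l) auto
qed simp

text \<open>Up to sign the product of two letters \<open>x\<close> and \<open>y\<close> is \<open>(x ** B) ** adj (y ** B)\<close>, so letters
  contribute the classes of \<open>x ** B\<close> with alternating signs, and \<open>B ** B = - mat 1\<close> contributes nothing.\<close>

lemma hclass_word:
  assumes \<phi>: "H1_identification \<phi>" and mb: "markov_basis A B C" and w: "even (length w)"
  shows "fst (hclass \<phi> (wmat (letter_mat A B C) w))
      = sgn_count La w * fst (hclass \<phi> (A ** B)) + sgn_count Lc w * fst (hclass \<phi> (C ** B))"
    "snd (hclass \<phi> (wmat (letter_mat A B C) w))
      = sgn_count La w * snd (hclass \<phi> (A ** B)) + sgn_count Lc w * snd (hclass \<phi> (C ** B))"
proof -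
  let ?E = "letter_mat A B C"
  note ht = markov_basis_half_turns[OF mb]
  define h where "h l = hclass \<phi> (?E l ** B)" for l
  have odd: "?E l \<in> odd_matrices" for l using markov_basis_odd[OF mb] by (cases l) auto
  have htl: "half_turn (?E l)" for l using ht by (cases l) auto
  have EB: "?E l ** B \<in> torus_matrices" for l
    by (rule odd_mult_odd[OF odd markov_basis_odd(2)[OF mb]])
  have hb: "h Lb = 0" by (simp add: h_def half_turn_square[OF ht(2)] hclass_one[OF \<phi>])
  have pair: "hclass \<phi> (?E x ** ?E y) = h x - h y" for x y
  proof -
    have "?E x ** ?E y = - ((?E x ** B) ** adj (?E y ** B))"
      using half_turn_cancel[OF ht(2)]
      by (simp add: adj_mult half_turn_adj[OF htl] half_turn_adj[OF ht(2)] flip: matrix_mul_assoc)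
    then show ?thesis
      by (simp add: hclass_mult[OF \<phi> EB torus_matrices_adj[OF EB]] hclass_adj[OF \<phi> EB] h_def)
  qed
  have of: "fst (h x) = of_bool (x = La) * fst (h La) + of_bool (x = Lc) * fst (h Lc)"
    "snd (h x) = of_bool (x = La) * snd (h La) + of_bool (x = Lc) * snd (h Lc)" for x
    using hb by (cases x; simp)+
  have "fst (hclass \<phi> (wmat ?E w)) = sgn_count La w * fst (h La) + sgn_count Lc w * fst (h Lc) \<and>
     snd (hclass \<phi> (wmat ?E w)) = sgn_count La w * snd (h La) + sgn_count Lc w * snd (h Lc)"
    using w
  proof (induction w rule: induct_list012)
    case 1
    then show ?case by (simp add: hclass_one[OF \<phi>])
  next
    case (3 x y w)
    then have w: "even (length w)" by simp
    have "wmat ?E (x # y # w) = (?E x ** ?E y) ** wmat ?E w" by (simp add: matrix_mul_assoc)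
    then have eq: "hclass \<phi> (wmat ?E (x # y # w)) = h x - h y + hclass \<phi> (wmat ?E w)"
      using hclass_mult[OF \<phi> odd_mult_odd[OF odd odd] wmat_parity(1)[OF mb w]] pair by simp
    have IH: "fst (hclass \<phi> (wmat ?E w)) = sgn_count La w * fst (h La) + sgn_count Lc w * fst (h Lc)"
      "snd (hclass \<phi> (wmat ?E w)) = sgn_count La w * snd (h La) + sgn_count Lc w * snd (h Lc)"
      using "3.IH"(1)[OF w] by blast+
    show ?case
      unfolding eq fst_add fst_diff snd_add snd_diff IH of[of x] of[of y] sgn_count.simps
      by (simp only: algebra_simps)
  qed simp
  then show "fst (hclass \<phi> (wmat ?E w)) = sgn_count La w * fst (hclass \<phi> (A ** B)) + sgn_count Lc w * fst (hclass \<phi> (C ** B))"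
    "snd (hclass \<phi> (wmat ?E w)) = sgn_count La w * snd (hclass \<phi> (A ** B)) + sgn_count Lc w * snd (hclass \<phi> (C ** B))"
    by (simp_all add: h_def)
qed

lemma third_letter:
  assumes "P \<in> {{La, Lb}, {Lb, Lc}, {La, Lc}}"
  obtains l where "\<And>x y. x \<noteq> y \<Longrightarrow> {x, y} \<noteq> P \<Longrightarrow> l \<in> {x, y}"
proof -
  define l where "l = (if P = {La, Lb} then Lc else if P = {Lb, Lc} then La else Lb)"
  have "l \<in> {x, y}" if "x \<noteq> y" "{x, y} \<noteq> P" for x y
    using assms that by (cases x; cases y) (auto simp: l_def doubleton_eq_iff)
  then show thesis by (rule that)
qed

lemma corner_distinct:
  assumes "cyclic_word w" "1 \<le> k" "k \<le> length w"
  shows "w ! (k - 1) \<noteq> w ! (k mod length w)"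
  using cyclic_word_rotate[OF assms] hd_last_rotate[OF assms(2,3)] by (auto simp: cyclic_word_def)

text \<open>The homology class gives the signed counts 0 and 1 of the letters \<open>La\<close> and \<open>Lc\<close>. The letter
  opposite to a missing corner alternates with the others, so the signed counts are up to sign the
  numbers of occurrences. In each of the three cases the word has length two.\<close>

theorem simple_geodesic_in_class:
  assumes \<phi>: "H1_identification \<phi>" and mb: "markov_basis A B C" and \<sigma>: "simple_lift M L \<sigma>"
    and cl: "hclass \<phi> M = hclass \<phi> (C ** B)"
    and indep: "fst (hclass \<phi> (A ** B)) * snd (hclass \<phi> (C ** B)) \<noteq> snd (hclass \<phi> (A ** B)) * fst (hclass \<phi> (C ** B))"
  obtains N where "N \<in> torus_matrices" "simple_lift (C ** B) L (mob N \<circ> \<sigma>)"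
proof -
  let ?E = "letter_mat A B C"
  have M: "M \<in> torus_matrices" "axis M L \<sigma>" using \<sigma> by (auto simp: simple_lift_def)
  obtain N w where N: "N \<in> torus_matrices" and w: "even (length w)" "w = [] \<or> cyclic_word w"
    and MN: "M = N ** wmat ?E w ** adj N \<or> M = - (N ** wmat ?E w ** adj N)"
    using cyclic_reduction[OF mb M(1)] by metis
  have dN: "det N = 1" using N by (rule torus_matrices_det)
  have conj: "adj N ** M ** adj (adj N) = wmat ?E w \<or> adj N ** M ** adj (adj N) = - wmat ?E w"
  proof -
    have "adj N ** (N ** wmat ?E w ** adj N) ** N = wmat ?E w"
      using dN by (simp add: mult_assoc_adj mult_adj flip: matrix_mul_assoc)
    then show ?thesis using MN by auto
  qed
  let ?M = "adj N ** M ** adj (adj N)"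
  let ?\<sigma> = "mob (adj N) \<circ> \<sigma>"
  have \<sigma>': "simple_lift ?M L ?\<sigma>" by (rule simple_lift_mob(1)[OF \<sigma> torus_matrices_adj[OF N]])
  have wG: "wmat ?E w \<in> torus_matrices" by (rule wmat_parity(1)[OF mb w(1)])
  have "hclass \<phi> (N ** wmat ?E w ** adj N) = hclass \<phi> (wmat ?E w)"
    using hclass_mult[OF \<phi> torus_matrices_mult[OF N wG] torus_matrices_adj[OF N]]
      hclass_mult[OF \<phi> N wG] hclass_adj[OF \<phi> N] by simp
  then have "hclass \<phi> (wmat ?E w) = hclass \<phi> (C ** B)" using cl MN by auto
  then have eqs: "sgn_count La w * fst (hclass \<phi> (A ** B)) + (sgn_count Lc w - 1) * fst (hclass \<phi> (C ** B)) = 0"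
    "sgn_count La w * snd (hclass \<phi> (A ** B)) + (sgn_count Lc w - 1) * snd (hclass \<phi> (C ** B)) = 0"
    using hclass_word[OF \<phi> mb w(1)] by (simp_all add: algebra_simps)
  have "a = 0 \<and> b = 0" if "a * p + b * q = 0" "a * p' + b * q' = 0" "p * q' \<noteq> p' * q" for a b p q p' q' :: int
  proof -
    have "a * (p * q' - p' * q) = q' * (a * p + b * q) - q * (a * p' + b * q')"
      "b * (p * q' - p' * q) = p * (a * p' + b * q') - p' * (a * p + b * q)"
      by (simp_all add: algebra_simps)
    then have "a * (p * q' - p' * q) = 0" "b * (p * q' - p' * q) = 0" unfolding that(1,2) by simp_all
    with that(3) show ?thesis by simp
  qed
  note lin = this
  have sg: "sgn_count La w = 0" "sgn_count Lc w = 1" using lin[OF eqs indep] by simp_all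
  then have "w \<noteq> []" by auto
  then have cw: "cyclic_word w" using w(2) by blast
  obtain m where m: "length w = 2 * m" using w(1) by blast
  obtain P b where P: "P \<in> {{La, Lb}, {Lb, Lc}, {La, Lc}}"
    "\<And>k. 1 \<le> k \<Longrightarrow> k \<le> length w \<Longrightarrow> even k = b \<Longrightarrow> corner w k \<noteq> P"
    using some_corner_missing[OF mb \<sigma>' cw w(1) conj] by metis
  obtain l0 where l0: "\<And>x y. x \<noteq> y \<Longrightarrow> {x, y} \<noteq> P \<Longrightarrow> l0 \<in> {x, y}" using third_letter[OF P(1)] by metis
  have miss: "l0 \<in> corner w k" if "1 \<le> k" "k \<le> length w" "even k = b" for k
    using l0[OF corner_distinct[OF cw that(1,2)]] P(2)[OF that] unfolding corner_def by blast
  have "(\<forall>i<length w. w ! i = l0 \<longleftrightarrow> even i) \<or> (\<forall>i<length w. w ! i = l0 \<longleftrightarrow> odd i)"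
    by (rule alternating_word[OF cw m, of b]) (rule miss)
  then obtain b' where alt: "\<And>i. i < length w \<Longrightarrow> w ! i = l0 \<longleftrightarrow> even i = b'" by metis
  note sc = sgn_count_alternating[OF w(1) alt]
  have "m = 1"
  proof (cases l0)
    case La
    then have "count_list w La = 0" using sg(1) sc(1)[of La] by (auto split: if_splits)
    then show ?thesis using sc(2) La \<open>w \<noteq> []\<close> by simp
  next
    case Lc
    then have "count_list w Lc = 1" using sg(2) sc(1)[of Lc] by (auto split: if_splits)
    then show ?thesis using sc(2) Lc m by simp
  next
    case Lb
    then have "count_list w La = 0" "count_list w Lc = 1"
      using sg sc(1)[of La] sc(1)[of Lc] by (auto split: if_splits)
    then show ?thesis using sc(2) Lb m count_letters[of w] by simp
  qed
  then obtain x y where xy: "w = [x, y]" using m by (auto simp: length_Suc_conv eval_nat_numeral)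
  have "x = Lc" "y = Lb" using sg unfolding xy by (cases x; cases y; simp)+
  then have "wmat ?E w = C ** B" by (simp add: xy)
  then have "simple_lift (C ** B) L ?\<sigma>"
    using \<sigma>' conj by (auto simp: simple_lift_def)
  with torus_matrices_adj[OF N] that show thesis by blast
qed

section \<open>Rays to the cusp\<close>

text \<open>Translations and the inversion bring a point to height at least one half, since the inversion
  more than doubles the height of a lower point in the strip of width one about the imaginary axis.\<close>

lemma high_translate:
  assumes "0 < Im z"
  shows "\<exists>M. det M = 1 \<and> 1 / 2 \<le> Im (mob M z)"
proof -
  have "\<exists>M. det M = 1 \<and> 1 / 2 \<le> Im (mob M z)" if "(1 / 2) ^ n \<le> Im z" "0 < Im z" for n z
    using that
  proof (induction n arbitrary: z)
    case 0
    then show ?case by (intro exI[of _ "mat 1"]) (simp add: det_I)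
  next
    case (Suc n)
    show ?case
    proof (cases "1 / 2 \<le> Im z")
      case True
      then show ?thesis by (intro exI[of _ "mat 1"]) (simp add: det_I)
    next
      case False
      define k where "k = round (Re z)"
      define S where "S = mk 0 (- 1) 1 0 ** shift (- k)"
      have dS: "det S = 1" by (simp add: S_def det_mul) (simp add: det_2)
      define w where "w = z - of_int k"
      have w: "\<bar>Re w\<bar> \<le> 1 / 2" "Im w = Im z"
        using of_int_round_abs_le[of "Re z"] by (auto simp: w_def k_def abs_minus_commute)
      have "(Re w)\<^sup>2 \<le> (1 / 2)\<^sup>2" using w by (intro abs_le_square_iff[THEN iffD1]) auto
      moreover have "(Im w)\<^sup>2 < (1 / 2)\<^sup>2" using w False Suc.prems by (intro power_strict_mono) auto
      moreover have "(1 / 2)\<^sup>2 = (1 / 4 :: real)" by (simp add: power_divide)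
      ultimately have c: "(cmod w)\<^sup>2 < 1 / 2" unfolding cmod_power2 by linarith
      have c0: "0 < (cmod w)\<^sup>2" using w Suc.prems by (auto simp: w_def)
      have "Im (mob S z) = Im z / (cmod w)\<^sup>2"
        unfolding Im_mob[OF dS] by (simp add: S_def w_def)
      moreover have "Im z * (2 * (cmod w)\<^sup>2) \<le> Im z * 1"
        using c Suc.prems by (intro mult_left_mono) auto
      ultimately have "2 * Im z \<le> Im (mob S z)"
        using c0 by (simp add: pos_le_divide_eq mult_ac)
      then have "(1 / 2) ^ n \<le> Im (mob S z)" using Suc.prems by simp
      from Suc.IH[OF this Im_mob_pos[OF dS Suc.prems(2)]]
      obtain M where "det M = 1" "1 / 2 \<le> Im (mob M (mob S z))" by blast
      then show ?thesis
        using dS Suc.prems by (intro exI[of _ "M ** S"]) (simp add: det_mul mob_mult)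
    qed
  qed
  moreover obtain n where "(1 / 2) ^ n < Im z" using real_arch_pow_inv[of "Im z" "1 / 2"] assms by auto
  ultimately show ?thesis using assms less_imp_le by blast
qed

lemma shift_6_multiple: "shift (6 * j) \<in> torus_matrices"
  proof (induction j rule: int_induct[where k = 0])
    case base
    show ?case by (simp add: torus_matrices_one)
  next
    case (step1 i)
    have "shift (6 * (i + 1)) = shift (6 * i) ** shift 6" by (simp add: shift_mult algebra_simps)
    then show ?case using step1 torus_matrices_mult[OF _ shift_6] by simp
  next
    case (step2 i)
    have "shift (6 * (i - 1)) = shift (6 * i) ** adj (shift 6)" by (simp add: shift_mult algebra_simps)
    then show ?case using step2 torus_matrices_mult[OF _ torus_matrices_adj[OF shift_6]] by simp
  qed

lemma high_torus_translate:
  assumes "0 < Im z"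
  shows "\<exists>M\<in>torus_matrices. 1 / 2 \<le> Im (mob M z) \<and> \<bar>Re (mob M z)\<bar> \<le> 6"
proof -
  obtain M where M: "det M = 1" "1 / 2 \<le> Im (mob M z)" using high_translate[OF assms] by blast
  obtain i N where N: "N \<in> torus_matrices" "M = shift i ** N" using torus_coset[OF M(1)] by blast
  have "mob M z = mob N z + of_int i" using N assms by (simp add: mob_mult torus_matrices_det)
  then have ImN: "1 / 2 \<le> Im (mob N z)" using M(2) by simp
  define k where "k = \<lfloor>Re (mob N z) / 6\<rfloor>"
  have k: "0 \<le> Re (mob N z) - 6 * k" "Re (mob N z) - 6 * k \<le> 6"
    unfolding k_def by linarith+
  have "shift (6 * (- k)) ** N \<in> torus_matrices" using N torus_matrices_mult shift_6_multiple by blast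
  moreover have "mob (shift (6 * (- k)) ** N) z = mob N z + of_int (6 * (- k))"
    using N assms by (simp add: mob_mult torus_matrices_det)
  ultimately show ?thesis using ImN k by (intro bexI[of _ "shift (6 * (- k)) ** N"]) auto
qed

text \<open>The compact set \<open>K\<close> meets the orbit of every point of height between \<open>1 / 2\<close> and 2. A ray that has
  left this orbit has a translate that starts above height 2 and never comes down to this height,
  so it is vertical.\<close>

lemma cusp_ray_vertical:
  assumes \<rho>: "unit_speed_geodesic {0..} \<rho>" and cusp: "tends_to_cusp \<rho>"
  obtains M x a where "M \<in> torus_matrices" "\<And>t. 0 \<le> t \<Longrightarrow> mob M (\<rho> t) = vertical x (t + a)"
proof -
  define K where "K = {z. Re z \<in> {-6..6} \<and> Im z \<in> {1/2..2}}"
  have K_cbox: "K = cbox (Complex (-6) (1/2)) (Complex 6 2)"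
    by (simp add: K_def cbox_complex_eq)
  have K: "compact K" "K \<subseteq> upper_half_plane"
    unfolding K_cbox by (simp, auto simp: cbox_complex_eq upper_half_plane_def)
  then obtain t0 where t0: "\<And>t. t0 \<le> t \<Longrightarrow> orb (\<rho> t) \<notin> orb ` K"
    using cusp unfolding tends_to_cusp_def eventually_at_top_linorder by blast
  define s where "s = max t0 0"
  have s: "0 \<le> s" "t0 \<le> s" by (auto simp: s_def)
  have Im: "0 < Im (\<rho> t)" if "0 \<le> t" for t using unit_speed_Im[OF \<rho>] that by simp
  obtain M where M: "M \<in> torus_matrices" "1 / 2 \<le> Im (mob M (\<rho> s))" "\<bar>Re (mob M (\<rho> s))\<bar> \<le> 6"
    using high_torus_translate[OF Im[OF s(1)]] by blast
  have dM: "det M = 1" using M(1) by (rule torus_matrices_det)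
  have orb_K: "z \<notin> K" if "orb z = orb (\<rho> t)" "s \<le> t" for z t
    using t0[of t] that s by (metis image_eqI order_trans)
  have out: "Im (mob M (\<rho> t)) \<noteq> 2" if t: "s \<le> t" for t
  proof
    assume 2: "Im (mob M (\<rho> t)) = 2"
    define k where "k = \<lfloor>Re (mob M (\<rho> t)) / 6\<rfloor>"
    have k: "0 \<le> Re (mob M (\<rho> t)) - 6 * k" "Re (mob M (\<rho> t)) - 6 * k \<le> 6"
      unfolding k_def by linarith+
    have Imt: "0 < Im (\<rho> t)" using Im t s by simp
    have "shift (6 * (- k)) ** M \<in> torus_matrices"
      by (rule torus_matrices_mult[OF shift_6_multiple M(1)])
    then have "orb (mob (shift (6 * (- k)) ** M) (\<rho> t)) = orb (\<rho> t)"
      using Imt by (rule orb_mob)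
    moreover have "mob (shift (6 * (- k)) ** M) (\<rho> t) = mob M (\<rho> t) - of_int (6 * k)"
      using dM Imt by (simp add: mob_mult)
    then have "mob (shift (6 * (- k)) ** M) (\<rho> t) \<in> K" using k 2 by (simp add: K_def)
    ultimately show False using orb_K t by blast
  qed
  have "mob M (\<rho> s) \<notin> K"
    using orb_K[OF orb_mob[OF M(1) Im[OF s(1)]]] by simp
  then have high: "2 < Im (mob M (\<rho> s))" using M(2,3) by (auto simp: K_def)
  have "unit_speed_geodesic {0..} (mob M \<circ> \<rho>)" by (rule unit_speed_mob[OF dM \<rho>])
  then show thesis
  proof (rule unit_speed_cases)
    fix x a e assume e: "e \<in> {1, - 1 :: real}" and v: "\<And>t. t \<in> {0..} \<Longrightarrow> (mob M \<circ> \<rho>) t = vertical x (e * t + a)"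
    have "e = 1"
    proof (rule ccontr)
      assume "e \<noteq> 1"
      then have e: "e = - 1" using e by auto
      have "2 < exp (a - s)" using high v[of s] s e by simp
      then have "exp (ln 2) < exp (a - s)" by simp
      then have "ln 2 < a - s" by (simp only: exp_less_cancel_iff)
      then have "s \<le> a - ln 2" by simp
      moreover have "Im (mob M (\<rho> (a - ln 2))) = 2" using v[of "a - ln 2"] e s \<open>s \<le> a - ln 2\<close> by simp
      ultimately show False using out by blast
    qed
    then show thesis using v M(1) that[of M x a] by simp
  next
    fix x r a e assume e: "e \<in> {1, - 1 :: real}" and r: "0 < r"
      and v: "\<And>t. t \<in> {0..} \<Longrightarrow> (mob M \<circ> \<rho>) t = semicircle x r (e * t + a)"
    define U where "U = arcosh (r / 2)"
    have "2 * cosh (e * s + a) < r" using high v[of s] s cosh_real_pos[of "e * s + a"] by (simp add: pos_less_divide_eq)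
    then have lt: "cosh (e * s + a) < r / 2" by simp
    then have "1 \<le> r / 2" using cosh_real_ge_1[of "e * s + a"] by simp
    then have U: "cosh U = r / 2" "0 \<le> U" by (simp_all add: U_def cosh_arcosh_real)
    have "\<bar>e * s + a\<bar> < U"
    proof (rule ccontr)
      assume "\<not> ?thesis"
      then have "cosh U \<le> cosh \<bar>e * s + a\<bar>" using U(2) by (subst cosh_real_nonneg_le_iff) auto
      then show False using lt U(1) by simp
    qed
    then have st: "s \<le> U - e * a" using e by auto
    have "e * (U - e * a) + a = e * U" using e by auto
    moreover have "cosh (e * U) = cosh U" using e by auto
    moreover have "r / (r / 2) = 2" using r by simp
    ultimately have "Im (mob M (\<rho> (U - e * a))) = 2"
      using v[of "U - e * a"] st s U(1) by (simp only: comp_apply semicircle_simps atLeast_iff)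
    with out[OF st] show thesis by blast
  qed simp_all
qed


section \<open>Feet of orthogeodesics\<close>

lemma has_vector_derivative_Complex:
  assumes "(f has_real_derivative f') (at t within S)" "(g has_real_derivative g') (at t within S)"
  shows "((\<lambda>t. Complex (f t) (g t)) has_vector_derivative Complex f' g') (at t within S)"
proof -
  have "((\<lambda>t. of_real (f t) + \<i> * of_real (g t)) has_vector_derivative (of_real f' + \<i> * of_real g')) (at t within S)"
    by (intro has_vector_derivative_add has_vector_derivative_mult_right has_vector_derivative_of_real assms)
  then show ?thesis by (simp add: Complex_eq)
qed

lemma semicircle_derivative:
  "((\<lambda>t. semicircle x r (e * t + a)) has_vector_derivative
     Complex (r * (e * (1 - (tanh (e * s + a))\<^sup>2))) (- (r * (e * sinh (e * s + a))) / (cosh (e * s + a))\<^sup>2)) (at s)"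
proof -
  have "((\<lambda>t. x + r * tanh (e * t + a)) has_real_derivative r * (e * (1 - (tanh (e * s + a))\<^sup>2))) (at s)"
    by (auto intro!: derivative_eq_intros)
  moreover have "((\<lambda>t. r / cosh (e * t + a)) has_real_derivative - (r * (e * sinh (e * s + a))) / (cosh (e * s + a))\<^sup>2) (at s)"
    by (auto intro!: derivative_eq_intros simp: power2_eq_square)
  ultimately show ?thesis unfolding semicircle_def by (rule has_vector_derivative_Complex)
qed

lemma vertical_derivative:
  "((\<lambda>t. vertical x (t + a)) has_vector_derivative Complex 0 (exp (s + a))) (at s within S)"
proof -
  have "((\<lambda>t. x) has_real_derivative 0) (at s within S)"
    "((\<lambda>t. exp (t + a)) has_real_derivative exp (s + a)) (at s within S)"
    by (auto intro!: derivative_eq_intros)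
  then show ?thesis unfolding vertical_def by (rule has_vector_derivative_Complex)
qed

lemma mob_derivative:
  assumes "det M = 1" "0 < Im z"
  shows "(mob M has_field_derivative 1 / (of_int (M$2$1) * z + of_int (M$2$2))\<^sup>2) (at z)"
proof -
  have nz: "of_int (M$2$1) * z + of_int (M$2$2) \<noteq> 0" by (rule mob_denom_nonzero[OF assms])
  have "of_int (M$1$1 * M$2$2 - M$1$2 * M$2$1) = (1 :: complex)" using assms by (simp add: det_2)
  then have d: "of_int (M$1$1) * of_int (M$2$2) - of_int (M$1$2) * of_int (M$2$1) = (1 :: complex)" by simp
  have "((\<lambda>z. (of_int (M$1$1) * z + of_int (M$1$2)) / (of_int (M$2$1) * z + of_int (M$2$2))) has_field_derivative
    (of_int (M$1$1) * (of_int (M$2$1) * z + of_int (M$2$2)) - (of_int (M$1$1) * z + of_int (M$1$2)) * of_int (M$2$1))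
      / ((of_int (M$2$1) * z + of_int (M$2$2)) * (of_int (M$2$1) * z + of_int (M$2$2)))) (at z)"
    using nz by (auto intro!: derivative_eq_intros)
  moreover have "of_int (M$1$1) * (of_int (M$2$1) * z + of_int (M$2$2)) - (of_int (M$1$1) * z + of_int (M$1$2)) * of_int (M$2$1)
    = (of_int (M$1$1) * of_int (M$2$2) - of_int (M$1$2) * of_int (M$2$1) :: complex)"
    by (simp add: algebra_simps)
  ultimately show ?thesis unfolding d by (simp add: mob_eq[abs_def] power2_eq_square)
qed

text \<open>After moving the cusp of the ray to infinity the ray is vertical. It is orthogonal to the half-circle
  at its start, which is therefore the top; the half-circle is traversed to the right if the ray leaves
  on the left side, and to the left otherwise.\<close>

lemma foot_normal_form:
  assumes \<sigma>: "simple_lift H L \<sigma>" and foot: "cusp_orthogeodesic_foot d (orb \<circ> \<sigma>) F"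
    and d: "e \<in> {1, - 1 :: real}" "d = of_real e * \<i>"
  obtains N x r a where "N \<in> torus_matrices" "0 < r" "\<And>t. mob N (\<sigma> t) = semicircle x r (e * t + a)"
    "F = orb (Complex x r)" "\<And>y. r < y \<Longrightarrow> orb (Complex x y) \<notin> range (orb \<circ> \<sigma>)"
    "\<And>y y'. r \<le> y \<Longrightarrow> r \<le> y' \<Longrightarrow> orb (Complex x y) = orb (Complex x y') \<Longrightarrow> y = y'"
proof -
  obtain \<tau> s v \<rho> where \<tau>: "is_lift \<tau> (orb \<circ> \<sigma>)" "(orb \<circ> \<sigma>) s = F" "(\<tau> has_vector_derivative v) (at s)"
    and \<rho>: "unit_speed_geodesic {0..} \<rho>" "\<rho> 0 = \<tau> s" "(\<rho> has_vector_derivative d * v) (at 0 within {0..})"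
      "inj_on (orb \<circ> \<rho>) {0..}" "\<forall>t>0. orb (\<rho> t) \<notin> range (orb \<circ> \<sigma>)" "tends_to_cusp \<rho>"
    using foot unfolding cusp_orthogeodesic_foot_def by blast
  have ax: "axis H L \<sigma>" "unit_speed_geodesic UNIV \<sigma>" using \<sigma> by (auto simp: simple_lift_def axis_def)
  obtain N1 where N1: "N1 \<in> torus_matrices" "\<tau> = mob N1 \<circ> \<sigma>"
    using lift_unique[OF ax(2), of \<tau>] \<tau>(1) by (auto simp: is_lift_def)
  obtain M x a where M: "M \<in> torus_matrices" "\<And>t. 0 \<le> t \<Longrightarrow> mob M (\<rho> t) = vertical x (t + a)"
    using cusp_ray_vertical[OF \<rho>(1,6)] by blast
  have dM: "det M = 1" "det N1 = 1" using M N1 torus_matrices_det by auto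
  define N where "N = M ** N1"
  have N: "N \<in> torus_matrices" unfolding N_def using M N1 torus_matrices_mult by blast
  have \<sigma>': "mob N \<circ> \<sigma> = mob M \<circ> \<tau>"
    using dM axis_Im[OF ax(1)] by (simp add: N_def N1 fun_eq_iff mob_mult)
  have axN: "axis (N ** H ** adj N) L (mob N \<circ> \<sigma>)" by (rule axis_mob[OF ax(1) torus_matrices_det[OF N]])
  obtain e' r x' a' where semi: "e' \<in> {1, -1}" "0 < r" "\<And>t. (mob N \<circ> \<sigma>) t = semicircle x' r (e' * t + a')"
    by (rule axis_semicircle[OF axN]) (rule that)
  have Im_s: "0 < Im (\<tau> s)" using unit_speed_Im[of UNIV \<tau>] \<tau>(1) by (simp add: is_lift_def)
  define m where "m = 1 / (of_int (M$2$1) * \<tau> s + of_int (M$2$2))\<^sup>2"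
  note der = mob_derivative[OF dM(1) Im_s, folded m_def]
  have "((mob N \<circ> \<sigma>) has_vector_derivative v * m) (at s)"
    unfolding \<sigma>' by (rule field_vector_diff_chain_at[OF \<tau>(3) der])
  moreover define u where "u = e' * s + a'"
  have "mob N \<circ> \<sigma> = (\<lambda>t. semicircle x' r (e' * t + a'))" using semi(3) by blast
  ultimately have vm: "v * m = Complex (r * (e' * (1 - (tanh u)\<^sup>2))) (- (r * (e' * sinh u)) / (cosh u)\<^sup>2)"
    using vector_derivative_unique_at semicircle_derivative unfolding u_def by metis
  have "((mob M \<circ> \<rho>) has_vector_derivative d * v * m) (at 0 within {0..})"
    by (rule field_vector_diff_chain_within[OF \<rho>(3)]) (use der \<rho>(2) in \<open>simp add: has_field_derivative_at_within\<close>)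
  then have "((\<lambda>t. vertical x (t + a)) has_vector_derivative d * v * m) (at 0 within {0..})"
    by (rule has_vector_derivative_transform[rotated 2]) (use M(2) in auto)
  then have "d * v * m = Complex 0 (exp (0 + a))"
    by (rule vector_derivative_unique_within[rotated, OF _ vertical_derivative])
       (simp add: at_within_Ici_at_right)
  then have "d * (v * m) = Complex 0 (exp a)" by (simp only: mult.assoc add_0)
  moreover have "d * (d * (v * m)) = - (v * m)" using d by auto
  ultimately have vm': "v * m = Complex (e * exp a) 0"
    using d by (auto simp: complex_eq_iff)
  with vm have "r * (e' * sinh u) = 0" "r * (e' * (1 - (tanh u)\<^sup>2)) = e * exp a"
    by (auto simp: complex_eq_iff)
  then have u0: "u = 0" and re: "r * e' = e * exp a" using semi(1,2) by auto
  have ee: "e' = e"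
  proof (rule ccontr)
    assume "e' \<noteq> e"
    then have "e' = - e" using semi(1) d(1) by auto
    then have "e * (r + exp a) = 0" using re by (simp add: algebra_simps)
    moreover have "r + exp a > 0" using semi(2) by (simp add: add_pos_pos)
    ultimately show False using d(1) by auto
  qed
  then have ra: "r = exp a" using re d(1) by auto
  have "mob N (\<sigma> s) = Complex x' r" using semi(3)[of s] u0 by (simp add: u_def semicircle_def)
  moreover have "mob N (\<sigma> s) = mob M (\<rho> 0)" using \<sigma>' \<rho>(2) by (metis comp_apply)
  ultimately have xx: "x' = x" and top: "mob N (\<sigma> s) = Complex x r" using M(2)[of 0] by (auto simp: complex_eq_iff)
  have Im_\<rho>: "0 < Im (\<rho> t)" if "0 \<le> t" for t using unit_speed_Im[OF \<rho>(1)] that by simp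
  have ray: "orb (Complex x y) = orb (\<rho> (ln (y / r)))" "0 \<le> ln (y / r)" if "r \<le> y" for y
  proof -
    show t: "0 \<le> ln (y / r)" using that semi(2) by simp
    have "0 < y / r" using that semi(2) by simp
    then have "exp (ln (y / r)) * r = y" using semi(2) by simp
    then have "exp (ln (y / r) + a) = y" by (simp add: exp_add flip: ra)
    then have "mob M (\<rho> (ln (y / r))) = Complex x y" using M(2)[OF t] by (simp add: complex_eq_iff)
    then show "orb (Complex x y) = orb (\<rho> (ln (y / r)))" using orb_mob[OF M(1) Im_\<rho>[OF t]] by simp
  qed
  show thesis
  proof (rule that[OF N semi(2)])
    show "mob N (\<sigma> t) = semicircle x r (e * t + a')" for t using semi(3)[of t] ee xx by simp
    show "F = orb (Complex x r)" using \<tau>(2) top orb_mob[OF N axis_Im[OF ax(1)]] by (metis comp_apply)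
    show "orb (Complex x y) \<notin> range (orb \<circ> \<sigma>)" if "r < y" for y
    proof -
      have "0 < ln (y / r)" using that semi(2) by simp
      then show ?thesis using ray[of y] that \<rho>(5) by simp
    qed
    show "y = y'" if "r \<le> y" "r \<le> y'" "orb (Complex x y) = orb (Complex x y')" for y y'
    proof -
      have "ln (y / r) = ln (y' / r)"
        using \<rho>(4) ray[OF that(1)] ray[OF that(2)] that(3) by (auto simp: inj_on_def)
      then show ?thesis using that semi(2) by simp
    qed
  qed
qed

section \<open>The geodesic at the centre of a Farey triple\<close>

text \<open>The axis of \<open>shift 3 ** B\<close> is a half-circle in the middle between the vertical lines of \<open>B\<close>
  and of its translate by 3, traversed to the right.\<close>

locale markov_geodesic =
  fixes A B C :: "int^2^2" and L :: real and \<sigma> :: "real \<Rightarrow> complex"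
  assumes mb: "markov_basis A B C" and lift: "simple_lift (shift 3 ** B) L \<sigma>"
    and larger: "A$2$1 < B$2$1" "C$2$1 < B$2$1"
begin

text \<open>The axis of \<open>shift 3 ** B\<close> has the radius \<open>r\<close>; its ends have the distance \<open>gap\<close> from the vertical
  line of \<open>B\<close> and from the translate of this line by 3. The half-turn \<open>R\<close> reverses the axis.\<close>

definition n :: real where "n = of_int (B$2$1)"
definition n1 :: real where "n1 = of_int (A$2$1)"
definition n2 :: real where "n2 = of_int (C$2$1)"
definition v :: real where "v = line B"
definition r :: real where "r = sqrt (9 - 4 / n\<^sup>2) / 2"
definition gap :: real where "gap = 3 / 2 - r"
definition R :: "int^2^2" where "R = shift 3 ** A ** shift (- 3)"

lemma ht: "half_turn A" "half_turn B" "half_turn C"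
  using markov_basis_half_turns[OF mb] by auto

lemma n_pos: "1 \<le> n1" "1 \<le> n2" "2 \<le> n" "n1 < n" "n2 < n"
proof -
  have "1 \<le> A$2$1" "1 \<le> C$2$1" using ht by (auto simp: half_turn_def)
  moreover have "2 \<le> B$2$1" using \<open>1 \<le> A$2$1\<close> larger by linarith
  ultimately show "1 \<le> n1" "1 \<le> n2" "2 \<le> n" "n1 < n" "n2 < n"
    using larger by (simp_all add: n_def n1_def n2_def)
qed

lemma r_square: "r\<^sup>2 = 9 / 4 - 1 / n\<^sup>2"
proof -
  have "2\<^sup>2 \<le> n\<^sup>2" using n_pos(3) by (intro power_mono) auto
  moreover have "0 < n\<^sup>2" using n_pos(3) by simp
  ultimately have "4 / n\<^sup>2 \<le> 1" by (simp add: divide_le_eq)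
  then show ?thesis by (simp add: r_def power_divide diff_divide_distrib)
qed

lemma r_bounds: "1 < r" "r < 3 / 2"
proof -
  have "2\<^sup>2 \<le> n\<^sup>2" using n_pos(3) by (intro power_mono) auto
  moreover have np: "0 < n\<^sup>2" using n_pos(3) by simp
  ultimately have n2: "0 < 1 / n\<^sup>2" "1 / n\<^sup>2 \<le> 1 / 4" by (simp_all add: divide_le_eq)
  have "4 / n\<^sup>2 = 4 * (1 / n\<^sup>2)" by simp
  then have "4 / n\<^sup>2 \<le> 9" using n2 by linarith
  then have "0 \<le> r" by (simp add: r_def)
  have "1\<^sup>2 < r\<^sup>2" unfolding r_square power_one using n2 by linarith
  then show "1 < r" using \<open>0 \<le> r\<close> by (rule power2_less_imp_less)
  have "r\<^sup>2 < (3 / 2)\<^sup>2" unfolding r_square using n2 by (simp add: power_divide)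
  then show "r < 3 / 2" by (rule power2_less_imp_less) simp
qed

lemma gap: "0 < gap" "gap < 1 / 2" "gap * (3 - gap) = 1 / n\<^sup>2"
proof -
  show "0 < gap" "gap < 1 / 2" using r_bounds by (auto simp: gap_def)
  have "gap * (3 - gap) = 9 / 4 - r\<^sup>2" by (simp add: gap_def power2_eq_square algebra_simps)
  then show "gap * (3 - gap) = 1 / n\<^sup>2" by (simp add: r_square)
qed

lemma axis_param:
  shows "\<exists>a. \<forall>t. \<sigma> t = semicircle (v + 3 / 2) r (t + a)" and length: "2 * cosh (L / 2) = 3 * n"
proof -
  let ?H = "shift 3 ** B"
  have ax: "axis ?H L \<sigma>" using lift by (simp add: simple_lift_def)
  obtain x \<rho> e a where s: "e \<in> {1, -1}" "0 < \<rho>" "\<And>t. \<sigma> t = semicircle x \<rho> (e * t + a)"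
    "?H$2$1 \<noteq> 0" "2 * real_of_int (?H$2$1) * x = ?H$1$1 - ?H$2$2"
    "4 * (real_of_int (?H$2$1))\<^sup>2 * \<rho>\<^sup>2 = (real_of_int (trace2 ?H))\<^sup>2 - 4"
    "\<bar>real_of_int (trace2 ?H)\<bar> = 2 * cosh (L / 2)" "0 < e * real_of_int (?H$2$1) * trace2 ?H"
    by (rule axis_semicircle[OF ax]) (rule that)
  have tr: "real_of_int (trace2 ?H) = 3 * n" using ht(2) by (simp add: half_turn_def n_def)
  have c: "real_of_int (?H$2$1) = n" by (simp add: n_def)
  have np: "0 < n" using n_pos by simp
  show "2 * cosh (L / 2) = 3 * n" using s(7) tr np by simp
  have "2 * n * x = 2 * n * v + 3 * n"
    using s(5) ht(2) np by (simp add: half_turn_def n_def v_def line_def)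
  then have "2 * n * x = 2 * n * (v + 3 / 2)" by (simp add: algebra_simps)
  then have x: "x = v + 3 / 2" using np by simp
  have "4 * n\<^sup>2 * \<rho>\<^sup>2 = 9 * n\<^sup>2 - 4" using s(6) unfolding c tr by (simp add: power_mult_distrib)
  then have "\<rho>\<^sup>2 = r\<^sup>2" unfolding r_square using np by (simp add: field_simps)
  then have \<rho>: "\<rho> = r" using s(2) r_bounds by (simp add: power2_eq_iff_nonneg)
  have "0 < e * (n * (3 * n))" using s(8) unfolding c tr by (simp add: mult.assoc)
  then have "0 < e" using np by (simp add: zero_less_mult_iff)
  then have e: "e = 1" using s(1) by auto
  show "\<exists>a. \<forall>t. \<sigma> t = semicircle (v + 3 / 2) r (t + a)"
    using s(3) x \<rho> e by auto
qed

text \<open>The axis is at its top at the parameter \<open>- phase\<close>.\<close>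

definition phase :: real where
  "phase = (SOME a. \<forall>t. \<sigma> t = semicircle (v + 3 / 2) r (t + a))"

lemma sigma: "\<sigma> t = semicircle (v + 3 / 2) r (t + phase)"
  using someI_ex[OF axis_param(1)] unfolding phase_def by blast

lemma Im_sigma: "0 < Im (\<sigma> t)"
  using lift axis_Im by (auto simp: simple_lift_def)

lemma L_pos: "0 < L"
  using lift by (auto simp: simple_lift_def axis_def)

lemma range_sigma: "range \<sigma> = geo (v + gap) (v + 3 - gap)"
proof -
  have "range \<sigma> = geo (v + 3 / 2 - r) (v + 3 / 2 + r)"
    unfolding geo_center[OF less_trans[OF zero_less_one r_bounds(1)]]
    by (rule axis_range[of 1 r \<sigma> _ phase]) (use r_bounds sigma in auto)
  then show ?thesis by (simp add: gap_def algebra_simps)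
qed

lemma half_turn_R: "half_turn R" "R$2$1 = A$2$1" "line R = line A + 3"
proof -
  have e: "R$1$1 = A$1$1 + 3 * A$2$1" "R$2$1 = A$2$1" "R$2$2 = A$2$2 - 3 * A$2$1"
    by (simp_all add: R_def algebra_simps)
  have "det R = 1" using ht(1) by (simp add: R_def det_mul half_turn_def)
  then show "half_turn R" using ht(1) e by (simp add: half_turn_def)
  show "R$2$1 = A$2$1" by (rule e(2))
  show "line R = line A + 3" using ht(1) by (simp add: line_def e half_turn_def add_divide_distrib)
qed

lemma R_odd: "R \<in> odd_matrices"
proof -
  have "A \<in> odd_matrices" using markov_basis_odd[OF mb] by blast
  from odd_mult_even[OF shift_3_odd(1) odd_mult_odd[OF this shift_3_odd(2)]]
  show ?thesis by (simp add: R_def matrix_mul_assoc)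
qed

text \<open>Half the distance from one foot to the other: the distance from the top of the half-circle to
  the fixed point of \<open>R\<close>, whose height is \<open>1 / n1\<close>.\<close>

definition d :: real where "d = arcosh (n1 * r)"

lemma half_turn_fixed_point:
  assumes "half_turn M" "0 < Im z" "mob M z = z"
  shows "z = Complex (line M) (1 / M$2$1)"
proof -
  define k where "k = real_of_int (M$2$1)"
  have k: "0 < k" using assms by (simp add: k_def half_turn_def)
  define w where "w = z - of_real (line M)"
  have w: "w \<noteq> 0" using assms(2) by (auto simp: w_def)
  have "w = - 1 / (of_real k ^ 2 * w)"
    using half_turn_mob[OF assms(1,2)] assms(3) by (simp add: w_def k_def algebra_simps)
  then have "(of_real k * w)\<^sup>2 = - 1"
    using w k by (simp add: field_simps power2_eq_square)
  then have "(of_real k * w)\<^sup>2 = \<i>\<^sup>2" by simp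
  then have "of_real k * w = \<i> \<or> of_real k * w = - \<i>" by (rule power2_eq_iff[THEN iffD1])
  moreover have "0 < Im (of_real k * w)" using k assms(2) by (simp add: w_def)
  moreover have "Im (- \<i>) < 0" by simp
  ultimately have kw: "of_real k * w = \<i>" by (metis order.asym)
  then have "Re (of_real k * w) = 0" "Im (of_real k * w) = 1" by simp_all
  then have "Re w = 0" "Im w = 1 / k" using k by (simp_all add: field_simps)
  then show ?thesis by (simp add: complex_eq_iff w_def k_def)
qed

text \<open>Up to sign \<open>R ** C\<close> is \<open>shift 3 ** B\<close>, and both factors are half-turns, so \<open>R\<close> conjugates
  \<open>shift 3 ** B\<close> into its inverse and reverses its axis. It fixes a point of the axis, whose
  height determines its distance from the top; by \<open>n2 < n1 * n\<close> it is to the right of the top.\<close>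

lemma R_reverses: "mob R (\<sigma> s) = \<sigma> (2 * d - 2 * phase - s)" and d_bounds: "0 < d" "2 * d < L"
proof -
  let ?H = "shift 3 ** B"
  have ax: "axis ?H L \<sigma>" using lift by (simp add: simple_lift_def)
  have T: "C ** B ** A = shift 3" using mb by (simp add: markov_basis_def)
  have Tm: "shift (- 3) = - (A ** (B ** C))"
  proof -
    have "shift (- 3) = adj (C ** B ** A)" by (simp add: T)
    then show ?thesis by (simp add: adj_mult half_turn_adj ht matrix_mul_assoc)
  qed
  have R: "R = shift 3 ** (B ** C)"
    unfolding R_def Tm by (simp add: half_turn_cancel[OF ht(1)] flip: matrix_mul_assoc)
  have HR: "R ** C = - ?H" unfolding R by (simp add: half_turn_square[OF ht(3)] flip: matrix_mul_assoc)
  have dR: "det R = 1" using half_turn_R(1) by (rule half_turn_det)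
  have "R ** adj ?H ** adj R = ?H"
  proof -
    have "?H = - (R ** C)" using HR by simp
    then have "adj ?H = - (C ** R)"
      by (simp add: adj_mult half_turn_adj[OF ht(3)] half_turn_adj[OF half_turn_R(1)])
    then have "R ** adj ?H ** adj R = R ** (C ** (R ** R))"
      by (simp add: half_turn_adj[OF half_turn_R(1)] flip: matrix_mul_assoc)
    also have "\<dots> = - (R ** C)" by (simp add: half_turn_square[OF half_turn_R(1)])
    finally show ?thesis using HR by simp
  qed
  with axis_mob[OF axis_reverse[OF ax] dR] have "axis ?H L (mob R \<circ> (\<lambda>t. \<sigma> (- t)))" by simp
  from axis_unique[OF ax this] obtain k where k: "\<And>t. mob R (\<sigma> (- t)) = \<sigma> (t + k)" by auto
  then have rev: "mob R (\<sigma> s) = \<sigma> (k - s)" for s using k[of "- s"] by simp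
  define u where "u = k / 2 + phase"
  have "mob R (\<sigma> (k / 2)) = \<sigma> (k / 2)" using rev[of "k / 2"] by simp
  from half_turn_fixed_point[OF half_turn_R(1) Im_sigma this]
  have fixed: "semicircle (v + 3 / 2) r u = Complex (line A + 3) (1 / n1)"
    using half_turn_R by (simp add: sigma u_def n1_def)
  then have h: "r / cosh u = 1 / n1" and re: "v + 3 / 2 + r * tanh u = line A + 3"
    by (simp_all add: complex_eq_iff)
  have cu: "cosh u = n1 * r" using h n_pos(1) by (simp add: field_simps)
  have "v - line A = n2 / (n1 * n)"
    using basis_lines(3)[OF mb] by (simp add: v_def n1_def n2_def n_def)
  moreover have "n2 / (n1 * n) < 1"
  proof -
    have "1 * n \<le> n1 * n" using n_pos by (intro mult_right_mono) auto
    then have "n2 < n1 * n" using n_pos by linarith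
    then show ?thesis using n_pos by simp
  qed
  ultimately have "0 < r * tanh u" using re by linarith
  then have "0 < u" using r_bounds by (simp add: zero_less_mult_iff)
  then have du: "d = u" unfolding d_def cu[symmetric] by (simp add: arcosh_cosh_real)
  then show "0 < d" using \<open>0 < u\<close> by simp
  have "k = 2 * d - 2 * phase" using du by (simp add: u_def)
  then show "mob R (\<sigma> s) = \<sigma> (2 * d - 2 * phase - s)" using rev by simp
  have "cosh d < cosh (L / 2)"
  proof -
    have "n1 * r < n * (3 / 2)" using n_pos r_bounds by (intro mult_strict_mono) auto
    then show ?thesis using length du cu by simp
  qed
  then show "2 * d < L"
    using \<open>0 < d\<close> L_pos by (subst (asm) cosh_real_nonneg_less_iff) auto
qed

lemma range_R: "range (mob R \<circ> \<sigma>) = range \<sigma>"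
proof -
  have "mob R \<circ> \<sigma> = \<sigma> \<circ> (\<lambda>s. 2 * d - 2 * phase - s)" by (simp add: fun_eq_iff R_reverses)
  then have "range (mob R \<circ> \<sigma>) = \<sigma> ` range (\<lambda>s. 2 * d - 2 * phase - s)" by (simp only: image_comp)
  also have "range (\<lambda>s. 2 * d - 2 * phase - s) = UNIV"
    by (rule surjI[of _ "\<lambda>s. 2 * d - 2 * phase - s"]) simp
  finally show ?thesis .
qed

text \<open>The ends of an arc in any order. Since \<open>R\<close> preserves the axis, odd elements permute these arcs as
  well.\<close>

definition arc2 :: "real \<Rightarrow> real \<Rightarrow> bool" where
  "arc2 p q \<longleftrightarrow> (min p q, max p q) \<in> arcs \<sigma>"

lemma arc2_commute: "arc2 p q \<longleftrightarrow> arc2 q p"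
  by (simp add: arc2_def min.commute max.commute)

lemma arc2_iff: "arc2 p q \<longleftrightarrow> p \<noteq> q \<and> (\<exists>M\<in>torus_matrices. range (mob M \<circ> \<sigma>) = geo p q)"
  by (cases "p \<le> q") (auto simp: arc2_def arcs_def min_def max_def geo_commute[of p q])

lemma arc2_mob:
  assumes "arc2 p q" "M \<in> odd_matrices" "rden M p \<noteq> 0" "rden M q \<noteq> 0" "rmob M p \<noteq> rmob M q"
  shows "arc2 (rmob M p) (rmob M q)"
proof -
  obtain N where N: "N \<in> torus_matrices" "range (mob N \<circ> \<sigma>) = geo p q" using assms by (auto simp: arc2_iff)
  have dets: "det M = 1" "det N = 1" "det R = 1" using assms(2) N(1) R_odd odd_det torus_matrices_det by auto
  have "M ** N ** R \<in> torus_matrices" using odd_mult_odd[OF odd_mult_even[OF assms(2) N(1)] R_odd] .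
  moreover have "range (mob (M ** N ** R) \<circ> \<sigma>) = geo (rmob M p) (rmob M q)"
  proof -
    have "mob (M ** N ** R) \<circ> \<sigma> = mob M \<circ> (mob N \<circ> (mob R \<circ> \<sigma>))"
      using dets Im_sigma by (simp add: fun_eq_iff mob_mult det_mul Im_mob_pos)
    then have "range (mob (M ** N ** R) \<circ> \<sigma>) = mob M ` mob N ` range (mob R \<circ> \<sigma>)" by (simp only: image_comp)
    also have "\<dots> = mob M ` range (mob N \<circ> \<sigma>)" unfolding range_R by (simp only: image_comp)
    also have "\<dots> = geo (rmob M p) (rmob M q)" unfolding N(2) using geo_mob[OF dets(1) assms(3,4)] .
    finally show ?thesis .
  qed
  ultimately show ?thesis using assms(5) by (auto simp: arc2_iff)
qed

lemma arc2_shift: "arc2 p q \<Longrightarrow> arc2 (p + 3 * of_int j) (q + 3 * of_int j)"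
proof (induction j rule: int_induct[where k = 0])
  case base
  then show ?case by simp
next
  case (step1 i)
  have "arc2 (rmob (shift 3) (p + 3 * of_int i)) (rmob (shift 3) (q + 3 * of_int i))"
    using step1 by (intro arc2_mob[OF _ shift_3_odd(1)]) (auto simp: rmob_def arc2_iff)
  then show ?case by (simp add: rmob_def algebra_simps)
next
  case (step2 i)
  have "arc2 (rmob (shift (- 3)) (p + 3 * of_int i)) (rmob (shift (- 3)) (q + 3 * of_int i))"
    using step2 by (intro arc2_mob[OF _ shift_3_odd(2)]) (auto simp: rmob_def arc2_iff)
  then show ?case by (simp add: rmob_def algebra_simps)
qed

lemma arc2_B:
  assumes "arc2 p q" "p \<noteq> v" "q \<noteq> v"
  shows "arc2 (v - 1 / (n\<^sup>2 * (p - v))) (v - 1 / (n\<^sup>2 * (q - v)))"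
proof -
  have nz: "rden B p \<noteq> 0" "rden B q \<noteq> 0" and rm: "rmob B p = v - 1 / (n\<^sup>2 * (p - v))"
    "rmob B q = v - 1 / (n\<^sup>2 * (q - v))"
    using half_turn_rmob[OF ht(2)] assms(2,3) by (auto simp: v_def n_def)
  have "n\<^sup>2 * (p - v) \<noteq> n\<^sup>2 * (q - v)" using assms n_pos by (auto simp: arc2_iff)
  then have "rmob B p \<noteq> rmob B q" unfolding rm using assms(2,3) n_pos by (auto simp: field_simps)
  from arc2_mob[OF assms(1) _ nz this] show ?thesis
    using markov_basis_odd(2)[OF mb] by (simp add: rm)
qed

lemma arc2_noncrossing:
  assumes "arc2 p q" "arc2 p' q'" "p < x" "x < q" "p' < x" "x < q'"
  shows "p \<le> p' \<and> q' \<le> q \<or> p' \<le> p \<and> q \<le> q'"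
  using arcs_noncrossing[OF lift, of p q p' q' x] assms by (auto simp: arc2_def min_def max_def split: if_splits)

lemma trace_H: "real_of_int (trace2 (shift 3 ** B)) = 3 * n"
  using ht(2) by (simp add: half_turn_def n_def)

lemma arc2_irrational: "arc2 p q \<Longrightarrow> p \<notin> \<rat>"
proof -
  assume "arc2 p q"
  then have "(min p q, max p q) \<in> arcs \<sigma>" by (simp add: arc2_def)
  from arc_data[OF lift this] have "min p q \<notin> \<rat>" "max p q \<notin> \<rat>" by metis+
  then show ?thesis by (auto simp: min_def max_def split: if_splits)
qed

text \<open>An arc does not cross its translate by 3, so it is at most 3 wide. The square of its width is
  \<open>(9 * n\<^sup>2 - 4) / c\<^sup>2\<close> with an integer \<open>c\<close>, which is then at least \<open>n\<close>, and for \<open>c = n\<close>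
  the width is that of the axis.\<close>

lemma arc2_length:
  assumes "arc2 p q"
  shows "\<bar>q - p\<bar> \<le> 2 * r"
proof -
  define p' where "p' = min p q"
  define q' where "q' = max p q"
  have a: "(p', q') \<in> arcs \<sigma>" "p' < q'" "\<bar>q - p\<bar> = q' - p'"
    using assms by (auto simp: arc2_def p'_def q'_def arcs_def)
  have a2: "arc2 p' q'" using a by (simp add: arc2_def min_def max_def)
  have le3: "q' - p' \<le> 3"
  proof (rule ccontr)
    assume "\<not> ?thesis"
    moreover have "arc2 (p' + 3) (q' + 3)" using arc2_shift[OF a2, of 1] by simp
    ultimately show False
      using arc2_noncrossing[OF a2, of "p' + 3" "q' + 3" "(p' + 3 + q') / 2"] by (auto simp: field_simps)
  qed
  obtain c :: nat where c: "0 < c" "(q' - p')\<^sup>2 * (real c)\<^sup>2 = (3 * n)\<^sup>2 - 4"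
    using arc_data[OF lift a(1)] unfolding trace_H by metis
  have "(q' - p')\<^sup>2 \<le> 3\<^sup>2" using le3 a(2) by (intro power_mono) auto
  then have "(3 * n)\<^sup>2 - 4 \<le> 9 * (real c)\<^sup>2" unfolding c(2)[symmetric] by (intro mult_right_mono) auto
  then have "real_of_int (9 * (B$2$1)\<^sup>2 - 4) \<le> real_of_int (9 * (int c)\<^sup>2)"
    by (simp add: n_def power_mult_distrib)
  then have "9 * (B$2$1)\<^sup>2 - 4 \<le> 9 * (int c)\<^sup>2" by (simp only: of_int_le_iff)
  then have "(B$2$1)\<^sup>2 \<le> (int c)\<^sup>2" by presburger
  then have "B$2$1 \<le> int c" by (rule power2_le_imp_le) simp
  then have nc: "n \<le> real c" by (simp add: n_def)
  have "((q' - p') * n)\<^sup>2 \<le> ((q' - p') * real c)\<^sup>2"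
    using nc a(2) n_pos by (intro power_mono mult_left_mono) auto
  also have "\<dots> = 9 * n\<^sup>2 - 4" unfolding power_mult_distrib c(2) by simp
  also have "\<dots> = 4 * r\<^sup>2 * n\<^sup>2" unfolding r_square using n_pos by (simp add: left_diff_distrib right_diff_distrib)
  also have "\<dots> = (2 * r * n)\<^sup>2" by (simp add: power_mult_distrib)
  finally have sq: "((q' - p') * n)\<^sup>2 \<le> (2 * r * n)\<^sup>2" .
  have "0 \<le> 2 * r * n" using r_bounds n_pos by simp
  with sq have "(q' - p') * n \<le> 2 * r * n" by (rule power2_le_imp_le)
  then show ?thesis using a(3) n_pos by simp
qed

text \<open>The other ends would be two different conjugates of the same quadratic irrationality.\<close>

lemma arc2_share_end:
  assumes "arc2 p q" "arc2 p q'" "(q - p) * (q' - p) < 0"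
  shows False
proof -
  have rat: "p + y \<in> \<rat> \<and> (y - p)\<^sup>2 \<in> \<rat>" if y: "arc2 p y" for y
  proof -
    have arc: "(min p y, max p y) \<in> arcs \<sigma>" using y by (simp add: arc2_def)
    obtain c :: nat where c: "0 < c" "(max p y - min p y)\<^sup>2 * (real c)\<^sup>2 = (real_of_int (trace2 (shift 3 ** B)))\<^sup>2 - 4"
      "min p y + max p y \<in> \<rat>"
      by (rule arc_data[OF lift arc]) (rule that)
    have "(max p y - min p y)\<^sup>2 = (y - p)\<^sup>2" by (simp add: min_def max_def power2_commute)
    then have "(y - p)\<^sup>2 = ((real_of_int (trace2 (shift 3 ** B)))\<^sup>2 - 4) / (real c)\<^sup>2"
      using c(1,2) by (simp add: field_simps)
    then have "(y - p)\<^sup>2 \<in> \<rat>" by simp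
    then show ?thesis using c(3) by (simp add: min_def max_def add.commute split: if_splits)
  qed
  define s where "s = (q - p) - (q' - p)"
  define t where "t = (q - p) + (q' - p)"
  have "(p + q) - (p + q') \<in> \<rat>" using rat[OF assms(1)] rat[OF assms(2)] by (intro Rats_diff) auto
  then have s: "s \<in> \<rat>" by (simp add: s_def)
  have s0: "s \<noteq> 0" using assms(3) by (auto simp: s_def)
  have "s * t = (q - p)\<^sup>2 - (q' - p)\<^sup>2" by (simp add: s_def t_def power2_eq_square algebra_simps)
  then have "s * t \<in> \<rat>" using rat[OF assms(1)] rat[OF assms(2)] by simp
  then have "s * t / s \<in> \<rat>" using s by (rule Rats_divide)
  then have "t \<in> \<rat>" using s0 by simp
  then have "(s + t) / 2 \<in> \<rat>" using s by simp
  moreover have "p = ((p + q) - (s + t) / 2) / 2" by (simp add: s_def t_def field_simps)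
  ultimately have "p \<in> \<rat>" using rat[OF assms(1)] by (metis Rats_diff Rats_divide Rats_number_of)
  then show False using arc2_irrational[OF assms(1)] by simp
qed

lemma axis_arc: "arc2 (v + gap) (v + 3 - gap)"
proof -
  have "mob (mat 1) \<circ> \<sigma> = \<sigma>" by (simp add: fun_eq_iff)
  then have "range (mob (mat 1) \<circ> \<sigma>) = geo (v + gap) (v + 3 - gap)" using range_sigma by simp
  moreover have "v + gap \<noteq> v + 3 - gap" using gap by simp
  ultimately show ?thesis unfolding arc2_iff using torus_matrices_one by (intro conjI bexI[of _ "mat 1"])
qed

text \<open>Arcs over a common point are nested. An arc below a different widest arc has the ray from its top meet
  the latter.\<close>

lemma under_longest_arc:
  assumes pq: "arc2 p q" "p < q" and ab: "arc2 a b" "b - a = 2 * r" "a \<le> (p + q) / 2" "(p + q) / 2 \<le> b"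
    and free: "\<And>y. (q - p) / 2 < y \<Longrightarrow> Complex ((p + q) / 2) y \<notin> geo a b"
  shows "p = a" "q = b"
proof -
  define x where "x = (p + q) / 2"
  define h where "h = (q - p) / 2"
  have xh: "p = x - h" "q = x + h" "0 < h" using pq(2) by (auto simp: x_def h_def field_simps)
  have hr: "h \<le> r" using arc2_length[OF pq(1)] pq(2) by (simp add: h_def)
  have abx: "a \<le> x" "x \<le> b" using ab by (simp_all add: x_def)
  have "a \<noteq> x"
  proof
    assume "a = x"
    then show False
      using arc2_noncrossing[OF pq(1) ab(1), of "x + h / 2"] xh hr ab(2) by auto
  qed
  moreover have "x \<noteq> b"
  proof
    assume "x = b"
    then show False
      using arc2_noncrossing[OF pq(1) ab(1), of "x - h / 2"] xh hr ab(2) by auto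
  qed
  ultimately have ax: "a < x" "x < b" using abx by auto
  have "p = a \<and> q = b"
  proof (rule ccontr)
    assume ne: "\<not> ?thesis"
    from arc2_noncrossing[OF pq(1) ab(1), of x] ax xh
    have "p \<le> a \<and> b \<le> q \<or> a \<le> p \<and> q \<le> b" by auto
    then have in_ab: "a \<le> p" "q \<le> b" using xh(1,2) hr ab(2) by linarith+
    have "h * h < (x - a) * (b - x)"
    proof (cases "a < p")
      case True
      then have "h < x - a" "h \<le> b - x" using xh(1,2) in_ab by auto
      then show ?thesis using xh(3) by (intro mult_less_le_imp_less) auto
    next
      case False
      then have "q < b" using in_ab ne by linarith
      then have "h \<le> x - a" "h < b - x" using xh(1,2) in_ab by auto
      then show ?thesis using xh(3) by (intro mult_le_less_imp_less) auto
    qed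
    then have hh: "h\<^sup>2 < (x - a) * (b - x)" by (simp add: power2_eq_square)
    define y where "y = sqrt ((x - a) * (b - x))"
    have y2: "y\<^sup>2 = (x - a) * (b - x)" using ax by (simp add: y_def)
    have "0 < y" using ax by (simp add: y_def)
    have "h\<^sup>2 < y\<^sup>2" unfolding y2 by (rule hh)
    then have "h < y" using less_imp_le[OF \<open>0 < y\<close>] by (rule power2_less_imp_less)
    moreover have "Complex x y \<in> geo a b"
      using \<open>0 < y\<close> y2 by (simp add: geo_def algebra_simps)
    ultimately show False using free[of y] by (simp add: x_def h_def)
  qed
  then show "p = a" "q = b" by auto
qed

text \<open>An arc at one side of the vertical line of \<open>B\<close>, closer than \<open>gap\<close>. The matrix \<open>K\<close> is a translation
  along the neighbouring translate of the axis, with one end at the distance \<open>gap\<close> from the line. In the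
  coordinate \<open>t\<close>, the distance from the line, it acts on the boundary by \<open>f\<close> and moves the arc
  away from this end. The image of the arc does not cross the arc, whence \<open>f P \<le> Q\<close>. This inequality
  says that a point \<open>y2\<close> of the vertical ray that \<open>K\<close> moves to another point \<open>y1\<close> of the ray lies
  above the start of the ray.\<close>

lemma ray_near_line:
  fixes s :: int and P Q :: real
  assumes s: "s = 1 \<or> s = - 1" and PQ: "0 < Q" "Q < P" "P < gap"
    and arc: "arc2 (v - s * P) (v - s * Q)"
    and inj: "\<And>y y'. (P - Q) / 2 \<le> y \<Longrightarrow> (P - Q) / 2 \<le> y' \<Longrightarrow>
      orb (Complex (v - s * ((P + Q) / 2)) y) = orb (Complex (v - s * ((P + Q) / 2)) y') \<Longrightarrow> y = y'"
  shows False
proof -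
  have n0: "0 < n" using n_pos by simp
  have ss: "real_of_int s * real_of_int s = 1" using s by auto
  define f where "f t = 3 - 1 / (n\<^sup>2 * t)" for t
  have f_less: "f t < t" if "0 < t" "t < gap" for t
  proof -
    have "t - f t = (gap - t) * (3 - gap - t) / t"
      using that n0 gap(3) by (simp add: f_def field_simps power2_eq_square)
    moreover have "0 < (gap - t) * (3 - gap - t) / t" using that gap by simp
    ultimately show ?thesis by simp
  qed
  have f_mono: "f Q < f P" using PQ n0 by (simp add: f_def divide_strict_left_mono)
  have image: "v - 1 / (n\<^sup>2 * (v - s * t - v)) + 3 * of_int (- s) = v - s * f t" if "0 < t" for t :: real
    using s that n0 by (auto simp: f_def)
  have "arc2 (v - 1 / (n\<^sup>2 * (v - s * P - v))) (v - 1 / (n\<^sup>2 * (v - s * Q - v)))"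
    by (rule arc2_B[OF arc]) (use s PQ in auto)
  from arc2_shift[OF this, of "- s"] have arc': "arc2 (v - s * f P) (v - s * f Q)"
    unfolding image[OF less_trans[OF PQ(1,2)]] image[OF PQ(1)] .
  have "f P \<le> Q"
  proof (rule ccontr)
    assume "\<not> f P \<le> Q"
    then have m: "Q < (Q + f P) / 2" "(Q + f P) / 2 < f P" by auto
    have l: "f P < P" "f Q < Q" using f_less PQ by auto
    from s show False
    proof
      assume "s = 1"
      then show False
        using arc2_noncrossing[of "v - P" "v - Q" "v - f P" "v - f Q" "v - (Q + f P) / 2"] arc arc' m l by auto
    next
      assume "s = - 1"
      then show False
        using arc2_noncrossing[of "v + Q" "v + P" "v + f Q" "v + f P" "v + (Q + f P) / 2"] arc arc' m l
          arc2_commute by auto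
    qed
  qed
  then have key: "P * (3 - Q) \<le> 1 / n\<^sup>2"
    using PQ n0 by (simp add: f_def field_simps)
  define m where "m = (P + Q) / 2"
  define h where "h = (P - Q) / 2"
  have mh: "P = m + h" "Q = m - h" "0 < h" "h < m" "m < 1 / 2"
    using PQ gap(2) by (auto simp: m_def h_def field_simps)
  define w where "w = 1 / n\<^sup>2 - 3 * m + m\<^sup>2"
  have w: "3 * h + h\<^sup>2 \<le> w"
    using key unfolding mh(1,2) w_def by (simp add: power2_eq_square algebra_simps)
  define y2 where "y2 = sqrt (m * w / (3 - m))"
  define y1 where "y1 = y2 * ((3 - m) / m)"
  have m: "0 < m" "0 < 3 - m" using mh(3-5) by simp_all
  have "0 < 3 * h + h\<^sup>2" using mh(3) by (simp add: add_pos_pos)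
  then have w0: "0 < w" using w by (rule less_le_trans)
  then have "0 < m * w / (3 - m)" using m by simp
  then have y2_sq: "y2\<^sup>2 = m * w / (3 - m)" and y2_pos: "0 < y2" by (simp_all add: y2_def)
  have "h\<^sup>2 * (3 - m) < m * w"
  proof -
    have "0 < m * h" using m mh(3) by simp
    then have "h * (3 - m) < m * (3 + h)" using mh(4) by (simp add: algebra_simps)
    then have "h * (h * (3 - m)) < h * (m * (3 + h))" using mh(3) by simp
    also have "\<dots> = m * (3 * h + h\<^sup>2)" by (simp add: power2_eq_square algebra_simps)
    also have "\<dots> \<le> m * w" using w m by simp
    finally show ?thesis by (simp add: power2_eq_square mult.assoc)
  qed
  then have "h\<^sup>2 < y2\<^sup>2" unfolding y2_sq using m by (simp add: pos_less_divide_eq)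
  then have hy: "h < y2" using less_imp_le[OF y2_pos] by (rule power2_less_imp_less)
  have "1 < (3 - m) / m" using m mh(5) by simp
  from mult_strict_left_mono[OF this y2_pos] have y12: "y2 < y1" unfolding y1_def by simp
  have sum: "n\<^sup>2 * (m\<^sup>2 + y2\<^sup>2) = m / (3 - m)"
  proof -
    have "m\<^sup>2 + y2\<^sup>2 = m / ((3 - m) * n\<^sup>2)"
      unfolding y2_sq w_def using m n0 by (simp add: field_simps power2_eq_square)
    then show ?thesis using n0 by simp
  qed
  define K where "K = shift (- 3 * s) ** B"
  have K: "K \<in> torus_matrices"
    using s shift_3_odd markov_basis_odd(2)[OF mb] odd_mult_odd by (auto simp: K_def)
  define z where "z = Complex (v - s * m) y2"
  have "mob K z = Complex (v - s * m) y1"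
  proof -
    have zv: "z - of_real v = Complex (- (s * m)) y2" by (simp add: z_def complex_eq_iff)
    have prod: "of_real (n\<^sup>2) * Complex (- (s * m)) y2 * Complex (s * (3 - m)) y1 = - 1"
    proof -
      have "n\<^sup>2 * (m * (3 - m) + y2 * y1) = n\<^sup>2 * (m\<^sup>2 + y2\<^sup>2) * ((3 - m) / m)"
        using m by (simp add: y1_def field_simps power2_eq_square)
      also have "\<dots> = 1" unfolding sum using m by simp
      finally have 1: "n\<^sup>2 * (m * (3 - m) + y2 * y1) = 1" .
      have 2: "y2 * (3 - m) - m * y1 = 0" using m by (simp add: y1_def)
      have "Re (Complex (- (s * m)) y2 * Complex (s * (3 - m)) y1) = - (m * (3 - m) + y2 * y1)"
        using ss by (simp add: algebra_simps)
      moreover have "Im (Complex (- (s * m)) y2 * Complex (s * (3 - m)) y1) = s * (y2 * (3 - m) - m * y1)"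
        by (simp add: algebra_simps)
      ultimately have "Complex (- (s * m)) y2 * Complex (s * (3 - m)) y1 = of_real (- (m * (3 - m) + y2 * y1))"
        using 2 by (simp add: complex_eq_iff)
      then have "of_real (n\<^sup>2) * (Complex (- (s * m)) y2 * Complex (s * (3 - m)) y1)
         = of_real (- (n\<^sup>2 * (m * (3 - m) + y2 * y1)))"
        by (simp only: of_real_mult[symmetric] mult_minus_right)
      then show ?thesis unfolding 1 mult.assoc by simp
    qed
    have nz: "of_real (n\<^sup>2) * Complex (- (s * m)) y2 \<noteq> 0" using prod by auto
    have "Complex (s * (3 - m)) y1 = - 1 / (of_real (n\<^sup>2) * Complex (- (s * m)) y2)"
      using prod nz by (metis nonzero_eq_divide_eq mult.commute)
    then have "- (1 / (of_real (n\<^sup>2) * Complex (- (s * m)) y2)) = Complex (s * (3 - m)) y1"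
      by (simp only: minus_divide_left)
    then have "mob B z = of_real v + Complex (s * (3 - m)) y1"
      using half_turn_mob[OF ht(2), of z] y2_pos zv
      by (simp add: z_def v_def n_def)
    moreover have "mob K z = mob B z + of_int (- 3 * s)"
      unfolding K_def using y2_pos ht(2) by (subst mob_mult) (simp_all add: half_turn_det z_def)
    ultimately show ?thesis by (simp add: complex_eq_iff algebra_simps)
  qed
  moreover have "orb (mob K z) = orb z" using orb_mob[OF K] y2_pos by (simp add: z_def)
  ultimately have "orb (Complex (v - s * m) y1) = orb (Complex (v - s * m) y2)" by (simp add: z_def)
  then have "y1 = y2" using inj[of y1 y2] hy y12 by (simp add: m_def h_def)
  with y12 show False by simp
qed

text \<open>Noncrossing with the axis and its translate by -3 keeps both ends of the arc within \<open>gap\<close> of the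
  vertical line of \<open>B\<close>. If the arc passes over the line, its image under \<open>B\<close> is too wide; otherwise
  the preceding lemma applies.\<close>

lemma no_foot_near_line:
  assumes pq: "arc2 p q" "p < q" and x: "\<bar>(p + q) / 2 - v\<bar> < gap"
    and inj: "\<And>y y'. (q - p) / 2 \<le> y \<Longrightarrow> (q - p) / 2 \<le> y' \<Longrightarrow>
      orb (Complex ((p + q) / 2) y) = orb (Complex ((p + q) / 2) y') \<Longrightarrow> y = y'"
  shows False
proof -
  have n0: "0 < n" using n_pos by simp
  have r: "2 * r = 3 - 2 * gap" by (simp add: gap_def)
  have len: "q - p \<le> 3 - 2 * gap" using arc2_length[OF pq(1)] pq(2) r by simp
  have right: "arc2 (v + gap) (v + 3 - gap)" by (rule axis_arc)
  have left: "arc2 (v - 3 + gap) (v - gap)" using arc2_shift[OF axis_arc, of "- 1"] by (simp add: algebra_simps)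
  have xx: "p + q < 2 * v + 2 * gap" "2 * v - 2 * gap < p + q" using x by (simp_all add: abs_less_iff field_simps)
  have "v - gap \<le> p"
  proof (rule ccontr)
    assume lt: "\<not> ?thesis"
    then have ge: "v - 3 + gap < p" using xx pq(2) len gap(2) by linarith
    with lt have "p \<le> v - 3 + gap \<and> v - gap \<le> q \<or> v - 3 + gap \<le> p \<and> q \<le> v - gap"
      using xx pq(2) gap(2)
      by (intro arc2_noncrossing[OF pq(1) left, of "(p + (v - gap)) / 2"]) (simp_all add: field_simps)
    then show False using ge xx lt by auto
  qed
  moreover have "p \<noteq> v - gap"
  proof
    assume p: "p = v - gap"
    then have "(q - p) * ((v - 3 + gap) - p) < 0" using pq(2) gap by (intro mult_pos_neg) auto
    then show False using arc2_share_end[OF pq(1)] left p arc2_commute by blast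
  qed
  ultimately have p: "v - gap < p" by simp
  have "q \<le> v + gap"
  proof (rule ccontr)
    assume lt: "\<not> ?thesis"
    then have ge: "q < v + 3 - gap" using xx pq(2) len gap(2) by linarith
    with lt have "p \<le> v + gap \<and> v + 3 - gap \<le> q \<or> v + gap \<le> p \<and> q \<le> v + 3 - gap"
      using xx pq(2) gap(2)
      by (intro arc2_noncrossing[OF pq(1) right, of "(q + (v + gap)) / 2"]) (simp_all add: field_simps)
    then show False using ge xx lt by auto
  qed
  moreover have "q \<noteq> v + gap"
  proof
    assume q: "q = v + gap"
    then have "(p - q) * ((v + 3 - gap) - q) < 0" using pq(2) gap by (intro mult_neg_pos) auto
    then show False using arc2_share_end[of q p "v + 3 - gap"] pq(1) right q arc2_commute by blast
  qed
  ultimately have q: "q < v + gap" by simp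
  have "v \<in> \<rat>" by (simp add: v_def line_def)
  then have ne: "p \<noteq> v" "q \<noteq> v" using arc2_irrational[of p q] arc2_irrational[of q p] pq(1) arc2_commute by metis+
  consider "q < v" | "v < p" | "p < v" "v < q" using ne by linarith
  then show False
  proof cases
    case 1
    show False
      by (rule ray_near_line[of 1 "v - q" "v - p"]) (use 1 p pq inj in \<open>auto simp: field_simps\<close>)
  next
    case 2
    show False
    proof (rule ray_near_line[of "- 1" "p - v" "q - v"])
      show "arc2 (v - real_of_int (- 1) * (q - v)) (v - real_of_int (- 1) * (p - v))"
        using pq(1) arc2_commute by simp
      show "y = y'" if "(q - v - (p - v)) / 2 \<le> y" "(q - v - (p - v)) / 2 \<le> y'"
        "orb (Complex (v - real_of_int (- 1) * ((q - v + (p - v)) / 2)) y)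
          = orb (Complex (v - real_of_int (- 1) * ((q - v + (p - v)) / 2)) y')" for y y'
      proof -
        have x: "v - real_of_int (- 1) * ((q - v + (p - v)) / 2) = (p + q) / 2" by (simp add: field_simps)
        have h: "(q - v - (p - v)) / 2 = (q - p) / 2" by simp
        show ?thesis using inj[of y y'] that unfolding x h by blast
      qed
    qed (use 2 q pq in auto)
  next
    case 3
    have "arc2 (v - 1 / (n\<^sup>2 * (p - v))) (v - 1 / (n\<^sup>2 * (q - v)))" by (rule arc2_B[OF pq(1) ne])
    note arc2_length[OF this]
    moreover have big: "3 - gap \<le> 1 / (n\<^sup>2 * t)" if "0 < t" "t < gap" for t
    proof -
      have "(3 - gap) * t \<le> (3 - gap) * gap" using that gap by (intro mult_left_mono) auto
      also have "\<dots> = 1 / n\<^sup>2" using gap(3) by (simp add: mult.commute)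
      finally show ?thesis using that n0 by (simp add: field_simps)
    qed
    have "1 / (n\<^sup>2 * (p - v)) = - (1 / (n\<^sup>2 * (v - p)))"
      by (metis minus_diff_eq minus_divide_right mult_minus_right)
    ultimately show False using big[of "v - p"] big[of "q - v"] 3 p q r gap by auto
  qed
qed

lemma orb_shift:
  assumes "orb z = orb w" "0 < Im z" "0 < Im w"
  shows "orb (z + of_int k) = orb (w + of_int k)"
proof -
  obtain M where M: "M \<in> torus_matrices" "w = mob M z" using assms orb_eq_iff by blast
  have d: "det M = 1" using M torus_matrices_det by blast
  have "mob (shift k ** M ** shift (- k)) (z + of_int k) = w + of_int k"
    using d assms by (simp add: mob_mult det_mul M(2))
  moreover have "shift k ** M ** shift (- k) \<in> torus_matrices" by (rule torus_shift_conj[OF M(1)])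
  ultimately show ?thesis using orb_mob[of "shift k ** M ** shift (- k)" "z + of_int k"] assms by simp
qed

text \<open>A translation by a multiple of 3 brings the top within \<open>3 / 2\<close> of the line of \<open>B\<close>. There it is either
  closer than \<open>gap\<close> to the line, or below the axis or its translate by -3.\<close>

lemma foot_position:
  assumes pq: "arc2 p q" "p < q"
    and free: "\<And>a b y. arc2 a b \<Longrightarrow> (q - p) / 2 < y \<Longrightarrow> Complex ((p + q) / 2) y \<notin> geo a b"
    and inj: "\<And>y y'. (q - p) / 2 \<le> y \<Longrightarrow> (q - p) / 2 \<le> y' \<Longrightarrow>
      orb (Complex ((p + q) / 2) y) = orb (Complex ((p + q) / 2) y') \<Longrightarrow> y = y'"
  shows "\<exists>j::int. p = v + gap + 3 * j \<and> q = v + 3 - gap + 3 * j"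
proof -
  define j where "j = round (((p + q) / 2 - v) / 3)"
  define p0 where "p0 = p - 3 * j"
  define q0 where "q0 = q - 3 * j"
  have x0: "(p0 + q0) / 2 = (p + q) / 2 - 3 * j" "(q0 - p0) / 2 = (q - p) / 2"
    by (simp_all add: p0_def q0_def field_simps)
  have arc: "arc2 p0 q0" "p0 < q0"
    using arc2_shift[OF pq(1), of "- j"] pq(2) by (simp_all add: p0_def q0_def)
  have "\<bar>of_int j - ((p + q) / 2 - v) / 3\<bar> \<le> 1 / 2" unfolding j_def by (rule of_int_round_abs_le)
  then have near: "\<bar>(p0 + q0) / 2 - v\<bar> \<le> 3 / 2" unfolding x0 by (simp add: abs_le_iff field_simps)
  have free0: "Complex ((p0 + q0) / 2) y \<notin> geo a b" if "arc2 a b" "(q0 - p0) / 2 < y" for a b y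
  proof
    assume "Complex ((p0 + q0) / 2) y \<in> geo a b"
    then have "Complex ((p + q) / 2) y \<in> geo (a + 3 * j) (b + 3 * j)" unfolding x0 by (simp add: geo_def algebra_simps)
    then show False using free[OF arc2_shift[OF that(1), of j], of y] that(2) unfolding x0 by simp
  qed
  have far: "\<not> \<bar>(p0 + q0) / 2 - v\<bar> < gap"
  proof
    assume "\<bar>(p0 + q0) / 2 - v\<bar> < gap"
    then show False
    proof (rule no_foot_near_line[OF arc])
      fix y y' assume y: "(q0 - p0) / 2 \<le> y" "(q0 - p0) / 2 \<le> y'"
        "orb (Complex ((p0 + q0) / 2) y) = orb (Complex ((p0 + q0) / 2) y')"
      then have "0 < y" "0 < y'" using arc(2) by auto
      then have "orb (Complex ((p0 + q0) / 2) y + of_int (3 * j)) = orb (Complex ((p0 + q0) / 2) y' + of_int (3 * j))"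
        using y by (intro orb_shift) auto
      moreover have "Complex ((p0 + q0) / 2) y + of_int (3 * j) = Complex ((p + q) / 2) y" for y
        unfolding x0 by (simp add: complex_eq_iff)
      ultimately show "y = y'" using inj[of y y'] y unfolding x0 by simp
    qed
  qed
  then consider "v + gap \<le> (p0 + q0) / 2" | "(p0 + q0) / 2 \<le> v - gap" by linarith
  then show ?thesis
  proof cases
    case 1
    have "v + 3 - gap - (v + gap) = 2 * r" by (simp add: gap_def)
    moreover have "v + gap \<le> (p0 + q0) / 2" "(p0 + q0) / 2 \<le> v + 3 - gap" using 1 near gap(2) by linarith+
    ultimately have "p0 = v + gap" "q0 = v + 3 - gap"
      using under_longest_arc[OF arc axis_arc] free0[OF axis_arc] by blast+
    then show ?thesis by (intro exI[of _ j]) (simp add: p0_def q0_def)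
  next
    case 2
    have left: "arc2 (v - 3 + gap) (v - gap)" using arc2_shift[OF axis_arc, of "- 1"] by (simp add: algebra_simps)
    have "v - gap - (v - 3 + gap) = 2 * r" by (simp add: gap_def)
    moreover have "v - 3 + gap \<le> (p0 + q0) / 2" "(p0 + q0) / 2 \<le> v - gap" using 2 near gap(2) by linarith+
    ultimately have "p0 = v - 3 + gap" "q0 = v - gap"
      using under_longest_arc[OF arc left] free0[OF left] by blast+
    then show ?thesis by (intro exI[of _ "j - 1"]) (simp add: p0_def q0_def algebra_simps)
  qed
qed

end

section \<open>The two feet and the twist\<close>

lemma semicircle_inj: "0 < r \<Longrightarrow> semicircle x r s = semicircle x r t \<Longrightarrow> s = t"
proof -
  assume r: "0 < r" and eq: "semicircle x r s = semicircle x r t"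
  have "Re (semicircle x r s) = Re (semicircle x r t)" using eq by simp
  then have "tanh s = tanh t" using r by simp
  then show "s = t" by simp
qed

lemma semicircle_shift: "semicircle x r s + of_int k = semicircle (x + of_int k) r s"
  by (simp add: complex_eq_iff)

context markov_geodesic
begin

lemma translate_arc:
  assumes "M \<in> torus_matrices"
  obtains p q where "arc2 p q" "p < q" "range (mob M \<circ> \<sigma>) = geo p q"
proof -
  have ax: "axis (M ** (shift 3 ** B) ** adj M) L (mob M \<circ> \<sigma>)"
    using lift assms by (intro axis_mob) (auto simp: simple_lift_def torus_matrices_det)
  obtain x \<rho> e a where s: "e \<in> {1, -1}" "0 < \<rho>" "\<And>t. (mob M \<circ> \<sigma>) t = semicircle x \<rho> (e * t + a)"
    by (rule axis_semicircle[OF ax]) (rule that)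
  have "range (mob M \<circ> \<sigma>) = geo (x - \<rho>) (x + \<rho>)"
    unfolding geo_center[OF s(2)] by (rule axis_range[OF s])
  then show thesis using that[of "x - \<rho>" "x + \<rho>"] s(2) assms by (auto simp: arc2_iff)
qed

text \<open>The half-circle of the foot is a translate of the axis by \<open>3 * j\<close>. For even \<open>j\<close> the translation
  is in the group, and the lift is traversed to the right like the axis. For odd \<open>j\<close> the
  translation has to be composed with \<open>R\<close>, which reverses the direction. So the side of the foot determines
  the parity of \<open>j\<close>.\<close>

lemma foot_unique:
  assumes e: "e \<in> {1, - 1 :: real}" and foot: "cusp_orthogeodesic_foot (of_real e * \<i>) (orb \<circ> \<sigma>) F"
  shows "F = orb (Complex (if e = 1 then v + 3 / 2 else v + 9 / 2) r)"
proof -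
  obtain N x \<rho> a where N: "N \<in> torus_matrices" "0 < \<rho>" "\<And>t. mob N (\<sigma> t) = semicircle x \<rho> (e * t + a)"
    "F = orb (Complex x \<rho>)" "\<And>y. \<rho> < y \<Longrightarrow> orb (Complex x y) \<notin> range (orb \<circ> \<sigma>)"
    "\<And>y y'. \<rho> \<le> y \<Longrightarrow> \<rho> \<le> y' \<Longrightarrow> orb (Complex x y) = orb (Complex x y') \<Longrightarrow> y = y'"
    by (rule foot_normal_form[OF lift foot e refl]) (rule that)
  have "range (mob N \<circ> \<sigma>) = geo (x - \<rho>) (x + \<rho>)"
    unfolding geo_center[OF N(2)] by (rule axis_range[OF e N(2)]) (simp add: N(3))
  then have arc: "arc2 (x - \<rho>) (x + \<rho>)" "x - \<rho> < x + \<rho>" using N(1,2) by (auto simp: arc2_iff)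
  have mid: "(x - \<rho> + (x + \<rho>)) / 2 = x" "(x + \<rho> - (x - \<rho>)) / 2 = \<rho>" by simp_all
  have free: "Complex x y \<notin> geo p q" if pq: "arc2 p q" and y: "\<rho> < y" for p q y
  proof
    assume "Complex x y \<in> geo p q"
    obtain M where M: "M \<in> torus_matrices" "range (mob M \<circ> \<sigma>) = geo p q"
      using pq unfolding arc2_iff by blast
    with \<open>Complex x y \<in> geo p q\<close> obtain t where "Complex x y = mob M (\<sigma> t)" by auto
    then have "orb (Complex x y) = (orb \<circ> \<sigma>) t" using orb_mob[OF M(1) Im_sigma] by simp
    then show False using N(5)[OF y] by (metis rangeI)
  qed
  have "\<exists>j::int. x - \<rho> = v + gap + 3 * j \<and> x + \<rho> = v + 3 - gap + 3 * j"
  proof (rule foot_position[OF arc])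
    show "Complex ((x - \<rho> + (x + \<rho>)) / 2) y \<notin> geo p q" if "arc2 p q" "(x + \<rho> - (x - \<rho>)) / 2 < y" for p q y
      using free that unfolding mid by blast
    show "y = y'" if "(x + \<rho> - (x - \<rho>)) / 2 \<le> y" "(x + \<rho> - (x - \<rho>)) / 2 \<le> y'"
      "orb (Complex ((x - \<rho> + (x + \<rho>)) / 2) y) = orb (Complex ((x - \<rho> + (x + \<rho>)) / 2) y')" for y y'
      using that unfolding mid by (rule N(6))
  qed
  then obtain j :: int where "x - \<rho> = v + gap + 3 * of_int j" "x + \<rho> = v + 3 - gap + 3 * of_int j" by blast
  then have x: "x = v + 3 / 2 + 3 * of_int j" and \<rho>: "\<rho> = r" by (simp_all add: gap_def)
  have dN: "det N = 1" using N(1) by (rule torus_matrices_det)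
  have r0: "0 < r" using r_bounds by simp
  define K where "K = shift (- 3 * j) ** N"
  have K\<sigma>: "mob K (\<sigma> t) = semicircle (v + 3 / 2) r (e * t + a)" for t
  proof -
    have "mob K (\<sigma> t) = mob N (\<sigma> t) + of_int (- 3 * j)"
      unfolding K_def using dN Im_sigma by (subst mob_mult) simp_all
    then show ?thesis unfolding N(3) semicircle_shift by (simp add: x \<rho>)
  qed
  have meet: "mob M (\<sigma> s) = \<sigma> t \<Longrightarrow> M \<in> torus_matrices \<Longrightarrow> \<exists>k. \<forall>u. mob M (\<sigma> u) = \<sigma> (u + k)" for M s t
    using simple_lift_meet[OF lift, of M s t] by metis
  show ?thesis
  proof (cases "even j")
    case True
    then obtain i where i: "j = 2 * i" by blast
    have "shift (- 3 * j) = shift (6 * (- i))" by (simp add: i)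
    then have sh: "shift (- 3 * j) \<in> torus_matrices" by (simp only: shift_6_multiple)
    then have K: "K \<in> torus_matrices" unfolding K_def using N(1) torus_matrices_mult by blast
    have "e * (e * (phase - a)) + a = 0 + phase" using e by auto
    then have "mob K (\<sigma> (e * (phase - a))) = \<sigma> 0"
      using K\<sigma>[of "e * (phase - a)"] sigma[of 0] by metis
    then obtain k where k: "\<And>u. mob K (\<sigma> u) = \<sigma> (u + k)" using meet[OF _ K] by blast
    have "e * u + a = u + k + phase" for u
      by (rule semicircle_inj[OF r0, of "v + 3 / 2"]) (use k[of u] K\<sigma>[of u] sigma[of "u + k"] in metis)
    from this[of 0] this[of 1] have "e = 1" by simp
    moreover have "orb (Complex x r + of_int (- 3 * j)) = orb (Complex x r)"
      using orb_mob[OF sh, of "Complex x r"] r0 by simp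
    moreover have "Complex x r + of_int (- 3 * j) = Complex (v + 3 / 2) r" by (simp add: complex_eq_iff x)
    ultimately show ?thesis using N(4) \<rho> by simp
  next
    case False
    then obtain i where i: "j = 2 * i + 1" by (metis oddE)
    have "shift (- 3 * j) = shift (6 * (- i)) ** shift (- 3)" by (simp add: i shift_mult)
    then have sh: "shift (- 3 * j) \<in> odd_matrices"
      using even_mult_odd[OF shift_6_multiple[of "- i"] shift_3_odd(2)] by simp
    then have "K \<in> odd_matrices" unfolding K_def using N(1) odd_mult_even by blast
    then have K: "K ** R \<in> torus_matrices" using R_odd odd_mult_odd by blast
    have KR: "mob (K ** R) (\<sigma> u) = semicircle (v + 3 / 2) r (e * (2 * d - 2 * phase - u) + a)" for u
      using \<open>K \<in> odd_matrices\<close> R_odd Im_sigma by (simp add: mob_mult odd_det R_reverses K\<sigma>)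
    let ?u = "2 * d - 2 * phase - e * (phase - a)"
    have "e * (2 * d - 2 * phase - ?u) + a = 0 + phase" using e by auto
    then have "mob (K ** R) (\<sigma> ?u) = \<sigma> 0" using KR[of ?u] sigma[of 0] by metis
    then obtain k where k: "\<And>u. mob (K ** R) (\<sigma> u) = \<sigma> (u + k)" using meet[OF _ K] by blast
    have eq: "e * (2 * d - 2 * phase - u) + a = u + k + phase" for u
      by (rule semicircle_inj[OF r0, of "v + 3 / 2"]) (use k[of u] KR[of u] sigma[of "u + k"] in metis)
    have "e \<noteq> 1" using eq[of 0] eq[of 1] by auto
    moreover have "orb (Complex x r + of_int (6 * (- i))) = orb (Complex x r)"
      using orb_mob[OF shift_6_multiple, of "Complex x r" "- i"] r0 by simp
    moreover have "Complex x r + of_int (6 * (- i)) = Complex (v + 9 / 2) r" by (simp add: complex_eq_iff x i)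
    ultimately show ?thesis using N(4) \<rho> by simp
  qed
qed

text \<open>No translate of the axis is higher than \<open>r\<close>.\<close>

lemma vertical_ray_avoids:
  assumes y: "r < y"
  shows "orb (Complex x y) \<notin> range (orb \<circ> \<sigma>)"
proof
  have r0: "0 < r" using r_bounds by simp
  assume "orb (Complex x y) \<in> range (orb \<circ> \<sigma>)"
  then obtain t where t: "orb (\<sigma> t) = orb (Complex x y)" by auto
  obtain M where M: "M \<in> torus_matrices" "Complex x y = mob M (\<sigma> t)"
    using t orb_eq_iff[OF Im_sigma, of "Complex x y"] y r0 by auto
  obtain p q where pq: "arc2 p q" "p < q" "range (mob M \<circ> \<sigma>) = geo p q" using translate_arc[OF M(1)] by blast
  have "Complex x y \<in> geo p q" unfolding pq(3)[symmetric] M(2) by (metis comp_apply rangeI)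
  then have "(x - p) * (x - q) + y\<^sup>2 = 0" by (simp add: geo_def)
  then have "y\<^sup>2 = ((q - p) / 2)\<^sup>2 - (x - (p + q) / 2)\<^sup>2"
    by (simp add: power2_eq_square field_simps)
  then have "y\<^sup>2 \<le> ((q - p) / 2)\<^sup>2" by simp
  also have "\<dots> \<le> r\<^sup>2" using arc2_length[OF pq(1)] pq(2) by (intro power_mono) auto
  finally have "y \<le> r" by (rule power2_le_imp_le) (use r0 in simp)
  with y show False by simp
qed

text \<open>An element that does not fix infinity moves a point of height \<open>y > 1\<close> to a height of at most
  \<open>1 / y\<close>, which is below the start of the ray.\<close>

lemma vertical_ray_simple:
  assumes y: "r \<le> y" "r \<le> y'" and eq: "orb (Complex x y) = orb (Complex x y')"
  shows "y = y'"
proof -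
  have r1: "1 < r" by (rule r_bounds)
  obtain M where M: "M \<in> torus_matrices" "Complex x y' = mob M (Complex x y)"
    using eq orb_eq_iff[of "Complex x y" "Complex x y'"] y r1 by auto
  have d: "det M = 1" using M(1) by (rule torus_matrices_det)
  have Im: "y' = y / ((M$2$1 * x + M$2$2)\<^sup>2 + (M$2$1 * y)\<^sup>2)"
    using arg_cong[OF M(2), of Im] unfolding Im_mob[OF d] by (simp add: cmod_def)
  show "y = y'"
  proof (cases "M$2$1 = 0")
    case True
    then have "M$1$1 * M$2$2 = 1" using d by (simp add: det_2)
    then have "M$2$2 = 1 \<or> M$2$2 = - 1" by (metis zmult_eq_1_iff)
    then have "(real_of_int (M$2$2))\<^sup>2 = 1" by auto
    then show ?thesis using Im True by simp
  next
    case False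
    have "1 \<le> \<bar>real_of_int (M$2$1)\<bar>" using False by linarith
    then have "1\<^sup>2 \<le> (real_of_int (M$2$1))\<^sup>2" by (subst abs_le_square_iff[symmetric]) simp
    then have "1 * y\<^sup>2 \<le> (real_of_int (M$2$1))\<^sup>2 * y\<^sup>2" by (intro mult_right_mono) auto
    then have den: "y * y \<le> (M$2$1 * x + M$2$2)\<^sup>2 + (M$2$1 * y)\<^sup>2"
      by (simp add: power_mult_distrib power2_eq_square[of y] add_increasing)
    have yy: "0 < y * y" using y r1 by simp
    have "y' \<le> y / (y * y)" unfolding Im
      by (rule divide_left_mono[OF den]) (use y r1 less_le_trans[OF yy den] yy in \<open>auto intro!: mult_pos_pos\<close>)
    also have "\<dots> = 1 / y" by simp
    also have "\<dots> \<le> 1" using y r1 by simp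
    finally show ?thesis using y r1 by simp
  qed
qed

text \<open>The heights of the translates of a compact set are bounded: elements that fix infinity preserve heights,
  and others at most invert them.\<close>

lemma vertical_ray_cusp: "tends_to_cusp (\<lambda>t. vertical x (t + a))"
  unfolding tends_to_cusp_def
proof (intro allI impI)
  fix K assume K: "compact K \<and> K \<subseteq> upper_half_plane"
  have "\<exists>h. \<forall>z\<in>K. \<forall>M\<in>torus_matrices. Im (mob M z) \<le> h"
  proof (cases "K = {}")
    case False
    have "compact (Im ` K)" using K by (intro compact_continuous_image continuous_intros) auto
    moreover have "Im ` K \<noteq> {}" using False by simp
    ultimately obtain z1 z2 where z: "z1 \<in> K" "z2 \<in> K" "\<And>z. z \<in> K \<Longrightarrow> Im z1 \<le> Im z" "\<And>z. z \<in> K \<Longrightarrow> Im z \<le> Im z2"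
      using compact_attains_inf[of "Im ` K"] compact_attains_sup[of "Im ` K"] by (metis imageE imageI)
    have pos: "0 < Im z" if "z \<in> K" for z using K that by (auto simp: upper_half_plane_def)
    have "Im (mob M z) \<le> max (Im z2) (1 / Im z1)" if zM: "z \<in> K" "M \<in> torus_matrices" for z M
    proof -
      have d: "det M = 1" using zM(2) by (rule torus_matrices_det)
      have Im: "Im (mob M z) = Im z / ((M$2$1 * Re z + M$2$2)\<^sup>2 + (M$2$1 * Im z)\<^sup>2)"
        unfolding Im_mob[OF d] by (simp add: cmod_def)
      show ?thesis
      proof (cases "M$2$1 = 0")
        case True
        then have "M$1$1 * M$2$2 = 1" using d by (simp add: det_2)
        then have "M$2$2 = 1 \<or> M$2$2 = - 1" by (metis zmult_eq_1_iff)
        then have "(real_of_int (M$2$2))\<^sup>2 = 1" by auto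
        then have "Im (mob M z) = Im z" using Im True by simp
        then show ?thesis using z(4)[OF zM(1)] by simp
      next
        case False
        have "1 \<le> \<bar>real_of_int (M$2$1)\<bar>" using False by linarith
        then have "1\<^sup>2 \<le> (real_of_int (M$2$1))\<^sup>2" by (subst abs_le_square_iff[symmetric]) simp
        then have "1 * (Im z)\<^sup>2 \<le> (real_of_int (M$2$1))\<^sup>2 * (Im z)\<^sup>2" by (intro mult_right_mono) auto
        then have den: "Im z * Im z \<le> (M$2$1 * Re z + M$2$2)\<^sup>2 + (M$2$1 * Im z)\<^sup>2"
          by (simp add: power_mult_distrib power2_eq_square[of "Im z"] add_increasing)
        have zz: "0 < Im z * Im z" using pos[OF zM(1)] by simp
        have "Im (mob M z) \<le> Im z / (Im z * Im z)" unfolding Im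
          by (rule divide_left_mono[OF den])
            (use pos[OF zM(1)] less_le_trans[OF zz den] zz in \<open>auto intro!: mult_pos_pos\<close>)
        also have "\<dots> = 1 / Im z" by simp
        also have "\<dots> \<le> 1 / Im z1" using z(3)[OF zM(1)] pos[OF z(1)] by (simp add: frac_le)
        finally show ?thesis by simp
      qed
    qed
    then show ?thesis by blast
  qed simp
  then obtain h where h: "\<And>z M. z \<in> K \<Longrightarrow> M \<in> torus_matrices \<Longrightarrow> Im (mob M z) \<le> h" by blast
  have "orb (vertical x (t + a)) \<notin> orb ` K" if t: "ln (max h 1) - a < t" for t
  proof
    assume "orb (vertical x (t + a)) \<in> orb ` K"
    then obtain z where z: "z \<in> K" "orb z = orb (vertical x (t + a))" by force
    have "0 < Im z" using K z(1) by (auto simp: upper_half_plane_def)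
    then obtain M where "M \<in> torus_matrices" "vertical x (t + a) = mob M z"
      using z(2) orb_eq_iff[of z "vertical x (t + a)"] by auto
    then have "exp (t + a) \<le> h" using h[OF z(1), of M] by (metis vertical_simps(2))
    moreover have "max h 1 < exp (t + a)"
    proof -
      have "exp (ln (max h 1)) < exp (t + a)" using t by (simp only: exp_less_cancel_iff)
      then show ?thesis by simp
    qed
    ultimately show False by simp
  qed
  then show "\<forall>\<^sub>F t in at_top. orb (vertical x (t + a)) \<notin> orb ` K"
    unfolding eventually_at_top_dense by blast
qed

lemma vertical_foot:
  assumes "is_lift \<tau> (orb \<circ> \<sigma>)" "\<tau> s = Complex x r" "(\<tau> has_vector_derivative w) (at s)" "e * w = \<i> * of_real r"
  shows "cusp_orthogeodesic_foot e (orb \<circ> \<sigma>) (orb (Complex x r))"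
  unfolding cusp_orthogeodesic_foot_def
proof (intro exI conjI)
  have r0: "0 < r" using r_bounds by simp
  let ?\<rho> = "\<lambda>t. vertical x (t + ln r)"
  show "is_lift \<tau> (orb \<circ> \<sigma>)" "(\<tau> has_vector_derivative w) (at s)" by (fact assms)+
  show "(orb \<circ> \<sigma>) s = orb (Complex x r)" using assms(1,2) by (simp add: is_lift_def)
  show "unit_speed_geodesic {0..} ?\<rho>" using unit_speed_vertical[of 1] by simp
  have pt: "?\<rho> t = Complex x (r * exp t)" for t using r0 by (simp add: complex_eq_iff exp_add)
  show "?\<rho> 0 = \<tau> s" unfolding pt assms(2) by simp
  have "Complex 0 (exp (0 + ln r)) = e * w" using r0 assms(4) by (simp add: complex_eq_iff)
  then show "(?\<rho> has_vector_derivative e * w) (at 0 within {0..})"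
    using vertical_derivative[of x "ln r" 0 "{0..}"] by simp
  show "inj_on (orb \<circ> ?\<rho>) {0..}"
  proof (rule inj_onI)
    fix t t' assume t: "t \<in> {0..}" "t' \<in> {0..}" "(orb \<circ> ?\<rho>) t = (orb \<circ> ?\<rho>) t'"
    then have "r * exp t = r * exp t'"
      using r0 by (intro vertical_ray_simple[of _ _ x]) (simp_all add: pt)
    then show "t = t'" using r0 by simp
  qed
  show "\<forall>t>0. orb (?\<rho> t) \<notin> range (orb \<circ> \<sigma>)"
    using r0 vertical_ray_avoids by (simp add: pt)
  show "tends_to_cusp ?\<rho>" by (rule vertical_ray_cusp)
qed

lemma sigma_top: "\<sigma> (- phase) = Complex (v + 3 / 2) r"
  by (simp add: sigma semicircle_def)

lemma left_foot: "left_foot (orb \<circ> \<sigma>) = orb (Complex (v + 3 / 2) r)"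
  unfolding left_foot_def
proof (rule the_equality)
  have ax: "unit_speed_geodesic UNIV \<sigma>" using lift by (simp add: simple_lift_def axis_def)
  have "\<sigma> = (\<lambda>t. semicircle (v + 3 / 2) r (1 * t + phase))" using sigma by auto
  then have deriv: "(\<sigma> has_vector_derivative Complex r 0) (at (- phase))"
    using semicircle_derivative[of "v + 3 / 2" r 1 phase "- phase"] by simp
  have "is_lift \<sigma> (orb \<circ> \<sigma>)" using ax by (simp add: is_lift_def)
  from vertical_foot[OF this sigma_top deriv]
  show "cusp_orthogeodesic_foot \<i> (orb \<circ> \<sigma>) (orb (Complex (v + 3 / 2) r))"
    by (simp add: complex_eq_iff)
  show "F = orb (Complex (v + 3 / 2) r)" if "cusp_orthogeodesic_foot \<i> (orb \<circ> \<sigma>) F" for F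
    using foot_unique[of 1 F] that by simp
qed

lemma shifted_R: "shift 3 ** R \<in> torus_matrices" "mob (shift 3 ** R) (\<sigma> t) = \<sigma> (2 * d - 2 * phase - t) + 3"
proof -
  show "shift 3 ** R \<in> torus_matrices" by (rule odd_mult_odd[OF shift_3_odd(1) R_odd])
  show "mob (shift 3 ** R) (\<sigma> t) = \<sigma> (2 * d - 2 * phase - t) + 3"
    using R_odd Im_sigma by (simp add: mob_mult odd_det R_reverses)
qed

text \<open>The lift that \<open>shift 3 ** R\<close> makes of the axis is traversed to the left, so its right side is above.\<close>

lemma right_foot: "right_foot (orb \<circ> \<sigma>) = orb (Complex (v + 9 / 2) r)"
  unfolding right_foot_def
proof (rule the_equality)
  have ax: "unit_speed_geodesic UNIV \<sigma>" using lift by (simp add: simple_lift_def axis_def)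
  let ?\<tau> = "mob (shift 3 ** R) \<circ> \<sigma>"
  have \<tau>: "?\<tau> = (\<lambda>t. semicircle (v + 9 / 2) r (- 1 * t + (2 * d - phase)))"
  proof
    fix t
    have "?\<tau> t = \<sigma> (2 * d - 2 * phase - t) + of_int 3" by (simp only: comp_apply shifted_R(2) of_int_numeral)
    also have "\<dots> = semicircle (v + 9 / 2) r (2 * d - 2 * phase - t + phase)"
      unfolding sigma[of "2 * d - 2 * phase - t"] semicircle_shift by (simp add: add.commute)
    also have "2 * d - 2 * phase - t + phase = - 1 * t + (2 * d - phase)" by simp
    finally show "?\<tau> t = semicircle (v + 9 / 2) r (- 1 * t + (2 * d - phase))" .
  qed
  have lift': "is_lift ?\<tau> (orb \<circ> \<sigma>)"
    unfolding is_lift_def using simple_lift_mob(2)[OF lift shifted_R(1)] unit_speed_mob[OF _ ax]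
      torus_matrices_det[OF shifted_R(1)] by metis
  have top: "?\<tau> (2 * d - phase) = Complex (v + 9 / 2) r" unfolding \<tau> by (simp add: semicircle_def)
  have "(?\<tau> has_vector_derivative Complex (- r) 0) (at (2 * d - phase))"
    unfolding \<tau> using semicircle_derivative[of "v + 9 / 2" r "- 1" "2 * d - phase" "2 * d - phase"] by simp
  then show "cusp_orthogeodesic_foot (- \<i>) (orb \<circ> \<sigma>) (orb (Complex (v + 9 / 2) r))"
    by (rule vertical_foot[OF lift' top]) (simp add: complex_eq_iff)
  show "F = orb (Complex (v + 9 / 2) r)" if "cusp_orthogeodesic_foot (- \<i>) (orb \<circ> \<sigma>) F" for F
    using foot_unique[of "- 1" F] that by simp
qed

text \<open>The feet have the parameters \<open>- phase\<close> and \<open>2 * d - phase\<close> up to multiples of \<open>L\<close>, and \<open>2 * d\<close> is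
  between 0 and \<open>L\<close>.\<close>

theorem twist_value: "twist (orb \<circ> \<sigma>) = 2 * arcosh (n1 / 2 * sqrt (9 - 4 / n\<^sup>2))"
proof -
  let ?c = "orb \<circ> \<sigma>"
  have left: "?c (- phase) = left_foot ?c" by (simp add: left_foot sigma_top)
  have "orb (mob (shift 3 ** R) (\<sigma> (2 * d - phase))) = orb (\<sigma> (2 * d - phase))"
    by (rule orb_mob[OF shifted_R(1) Im_sigma])
  moreover have "mob (shift 3 ** R) (\<sigma> (2 * d - phase)) = Complex (v + 9 / 2) r"
    using sigma_top by (simp add: shifted_R(2) complex_eq_iff)
  ultimately have right: "?c (2 * d - phase) = right_foot ?c" by (simp add: right_foot)
  have "twist ?c = 2 * d"
    unfolding twist_def
  proof (rule Least_equality)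
    show "0 \<le> 2 * d \<and> (\<exists>s. ?c s = left_foot ?c \<and> ?c (s + 2 * d) = right_foot ?c)"
      using left right d_bounds(1) by (intro conjI exI[of _ "- phase"]) (simp_all add: algebra_simps)
  next
    fix t assume t: "0 \<le> t \<and> (\<exists>s. ?c s = left_foot ?c \<and> ?c (s + t) = right_foot ?c)"
    then obtain s where s: "0 \<le> t" "orb (\<sigma> s) = orb (\<sigma> (- phase))" "orb (\<sigma> (s + t)) = orb (\<sigma> (2 * d - phase))"
      using left right by auto
    obtain k :: int where k: "- phase = s + k * L" by (rule simple_lift_period[OF lift s(2)])
    obtain j :: int where j: "2 * d - phase = s + t + j * L" by (rule simple_lift_period[OF lift s(3)])
    have t_eq: "t = 2 * d + of_int (k - j) * L" using k j by (simp add: algebra_simps)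
    show "2 * d \<le> t"
    proof (rule ccontr)
      assume "\<not> 2 * d \<le> t"
      then have "of_int (k - j) * L < 0" using t_eq by simp
      then have "k - j < 0" using L_pos by (simp add: mult_less_0_iff)
      then have "of_int (k - j) * L \<le> - 1 * L" using L_pos by (intro mult_right_mono) linarith+
      then show False using t_eq s(1) d_bounds(2) by simp
    qed
  qed
  then show ?thesis by (simp add: d_def r_def)
qed

end

theorem theorem7p1:
  fixes \<phi> :: "(int^2^2) set set \<Rightarrow> int \<times> int"
    and \<gamma>1 \<gamma> \<gamma>2 :: "real \<Rightarrow> complex set"
    and n1 n n2 :: int
  assumes "H1_identification \<phi>"
    and "trio \<gamma>2 \<gamma> \<gamma>1"
    and "corresponding_ordered_markov_triple \<phi> \<gamma>2 \<gamma> \<gamma>1 n1 n n2"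
  shows "twist \<gamma> = 2 * arcosh (real_of_int n1 / 2 * sqrt (9 - 4 / (real_of_int n)\<^sup>2))"
proof -
  obtain x1 x x2 where tri: "ordered_markov_triple_at x1 x x2 n1 n n2" and gam: "is_gamma \<phi> x \<gamma>"
    using assms(3) by (auto simp: corresponding_ordered_markov_triple_def)
  obtain L g where g: "simple_closed_geodesic \<gamma> L g" "\<phi> (H1_class g) = (snd x, fst x)"
    using gam by (auto simp: is_gamma_def)
  obtain \<sigma> M where \<sigma>: "simple_lift M L \<sigma>" "\<gamma> = orb \<circ> \<sigma>" "g = PSL_class M"
    using simple_closed_geodesic_lift[OF g(1)] by blast
  obtain A B C where mb: "markov_basis A B C" and sl: "basis_slopes \<phi> A B C x1 x2"
    and lab: "A$2$1 = n1" "B$2$1 = n" "C$2$1 = n2" and less: "n1 < n" "n2 < n"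
    using ordered_triple_basis[OF assms(1) tri] by metis
  \<comment> \<open>The right child of the basis, whose first half-turn is \<open>B\<close>: for it the centre of the triple is
    a side, and the geodesic of the centre is the one in the class of \<open>C ** ?B'\<close>.\<close>
  let ?B' = "C ** shift 3 ** B"
  have F: "farey_triple x1 x x2" using tri by (simp add: ordered_markov_triple_at_def)
  then have "x1 + x2 = x" by (simp add: farey_triple_def prod_eq_iff)
  then have sl': "basis_slopes \<phi> B ?B' C x x2" using basis_slopes_right[OF assms(1) mb sl] by simp
  then have cl: "hclass \<phi> M = hclass \<phi> (C ** ?B')"
    using g(2) \<sigma>(3) by (simp add: basis_slopes_def hclass_def)
  have "\<bar>fst x * snd x2 - snd x * fst x2\<bar> = 1" using F by (simp add: farey_triple_def farey_neighbors_def)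
  then have indep: "fst (hclass \<phi> (B ** ?B')) * snd (hclass \<phi> (C ** ?B'))
      \<noteq> snd (hclass \<phi> (B ** ?B')) * fst (hclass \<phi> (C ** ?B'))"
    using sl' by (auto simp: basis_slopes_def mult.commute)
  obtain N where N: "N \<in> torus_matrices" "simple_lift (C ** ?B') L (mob N \<circ> \<sigma>)"
    using simple_geodesic_in_class[OF assms(1) markov_basis_right[OF mb] \<sigma>(1) cl indep] by blast
  have "C ** ?B' = - (shift 3 ** B)"
    using half_turn_cancel[OF markov_basis_half_turns(3)[OF mb]] by (simp flip: matrix_mul_assoc)
  then have "simple_lift (shift 3 ** B) L (mob N \<circ> \<sigma>)"
    using N(2) by (simp add: simple_lift_def)
  then interpret markov_geodesic A B C L "mob N \<circ> \<sigma>"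
    using mb less lab by unfold_locales simp_all
  have "\<gamma> = orb \<circ> (mob N \<circ> \<sigma>)" using simple_lift_mob(2)[OF \<sigma>(1) N(1)] \<sigma>(2) by simp
  then show ?thesis using twist_value lab unfolding n1_def n_def by simp
qed

end
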